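(* Let $N=(n_1,\ldots,n_m)$ be an $m$-tuple of positive integers with $n_1\le\cdots\le n_m$ and $N\neq(1,\ldots,1)$, let $l$ be the smallest nonnegative integer such that $n_{l+1}>1$, and let $|N|=\sum_{j=1}^m n_j$. Let $$\Omega_N=\Big\{Z=(Z_1,\ldots,Z_m)\in\mathbb C^{n_1}\times\cdots\times\mathbb C^{n_m}:\ \sum_{j=1}^m\big(|Z_j|^2+|Z_j\bullet Z_j|\big)<1\Big\}.$$ Let $p\in(0,\infty]$ satisfy $p>2(|N|+m-l+1)$ if $N\ne(2,\ldots,2)$, and $p>6m$ if $N=(2,\ldots,2)$, and put $$\alpha=\alpha(N,p)=\begin{cases}\frac12-\frac{|N|+m-l+1}{p}, & N\neq(2,\ldots,2),\\[2pt] \frac12-\frac{3m}{p}, & N=(2,\ldots,2),\end{cases}$$ (with $1/p=0$ if $p=\infty$). Then there exists a $\overline\partial$-closed $(0,1)$-form $f$ with coefficients in $\mathcal C^\infty(\Omega_N)$ such that $$f\in L^s(\Omega_N)\ \text{ for all } s<p,\ \text{ if } p<\infty;\qquad f\in L^\infty(\Omega_N),\ \text{ if } p=\infty;$$ and such that every function $u$ on $\Omega_N$ with $\overline\partial u=f$ satisfies $u\notin\Lambda_{\alpha+\epsilon}(\Omega_N)$ for all $\epsilon>0$.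
   Context: For $a,b\in\mathbb C^k$, $a\bullet b=\sum_{j=1}^k a_jb_j$ and $|a|=\sqrt{a\bullet\overline a}$. A form is in $L^s(\Omega_N)$ if its coefficients are (Lebesgue measure). For $0<\beta<1$, $\Lambda_\beta(\Omega_N)$ is the classical Lipschitz (Hölder) space of functions with finite norm $\|u\|_{L^\infty(\Omega_N)}+\sup_{z,z+h\in\Omega_N,\ h\ne0}\frac{|u(z+h)-u(z)|}{|h|^\beta}$; for $\beta\ge1$, $\Lambda_\beta$ is the classical Lipschitz (Hölder–Zygmund) space of order $\beta$, which is contained in $\Lambda_{\beta'}$ for every $0<\beta'<1$. *)

theory Defs
  imports "HOL-Analysis.Analysis"
begin

definition cdot :: "nat \<Rightarrow> (nat \<Rightarrow> complex) \<Rightarrow> (nat \<Rightarrow> complex) \<Rightarrow> complex" where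
  "cdot k a b = (\<Sum>j=1..k. a j * b j)"

text \<open>The sum below is real and nonnegative, so taking \<^const>\<open>Re\<close> only changes its type.\<close>

definition cvnorm :: "nat \<Rightarrow> (nat \<Rightarrow> complex) \<Rightarrow> real" where
  "cvnorm k a = sqrt (Re (cdot k a (\<lambda>j. cnj (a j))))"

text \<open>
  A tuple \<open>N = (n 1, \<dots>, n m)\<close> is given by its length \<open>m\<close> and the values of \<open>n\<close> on \<open>{1..m}\<close>.
  The product of the spaces of complex vectors of dimensions \<open>n 1, \<dots>, n m\<close> is modelled by
  \<^typ>\<open>complex ^ 'k\<close>, where \<open>'k\<close> is a finite type with as many elements as there are coordinates
  and \<open>e j i\<close> is the coordinate in \<open>'k\<close> which plays the role of the \<open>i\<close>-th coordinate of the
  \<open>j\<close>-th factor.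
\<close>

definition coord_labelling :: "nat \<Rightarrow> (nat \<Rightarrow> nat) \<Rightarrow> (nat \<Rightarrow> nat \<Rightarrow> 'k::finite) \<Rightarrow> bool" where
  "coord_labelling m n e \<longleftrightarrow> bij_betw (\<lambda>(j, i). e j i) (SIGMA j:{1..m}. {1..n j}) UNIV"

definition block :: "(nat \<Rightarrow> nat \<Rightarrow> 'k::finite) \<Rightarrow> complex ^ 'k \<Rightarrow> nat \<Rightarrow> nat \<Rightarrow> complex" where
  "block e Z j = (\<lambda>i. Z $ e j i)"

definition Omega :: "nat \<Rightarrow> (nat \<Rightarrow> nat) \<Rightarrow> (nat \<Rightarrow> nat \<Rightarrow> 'k::finite) \<Rightarrow> (complex ^ 'k) set" where
  "Omega m n e =
    {Z. (\<Sum>j=1..m. (cvnorm (n j) (block e Z j))\<^sup>2 + cmod (cdot (n j) (block e Z j) (block e Z j))) < 1}"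

definition tuple_sum :: "nat \<Rightarrow> (nat \<Rightarrow> nat) \<Rightarrow> nat" where
  "tuple_sum m n = (\<Sum>j=1..m. n j)"

definition ell :: "nat \<Rightarrow> (nat \<Rightarrow> nat) \<Rightarrow> nat" where
  "ell m n = (LEAST l. l < m \<and> n (l + 1) > 1)"

definition all_eq :: "nat \<Rightarrow> (nat \<Rightarrow> nat) \<Rightarrow> nat \<Rightarrow> bool" where
  "all_eq m n c \<longleftrightarrow> (\<forall>j\<in>{1..m}. n j = c)"

text \<open>Division in \<^typ>\<open>ereal\<close> satisfies \<open>x / \<infinity> = 0\<close> for real \<open>x\<close>.\<close>

definition alpha :: "nat \<Rightarrow> (nat \<Rightarrow> nat) \<Rightarrow> ereal \<Rightarrow> real" where
  "alpha m n p =
    (if all_eq m n 2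
     then 1 / 2 - real_of_ereal (ereal (3 * real m) / p)
     else 1 / 2 - real_of_ereal (ereal (real (tuple_sum m n) + real m - real (ell m n) + 1) / p))"

text \<open>
  These notions are meant for open \<open>S\<close>. Differentiability at every level makes all
  iterated directional derivatives continuous.
\<close>

primrec times_differentiable_on ::
    "nat \<Rightarrow> 'a::real_normed_vector set \<Rightarrow> ('a \<Rightarrow> 'b::real_normed_vector) \<Rightarrow> bool" where
  "times_differentiable_on 0 S g \<longleftrightarrow> continuous_on S g"
| "times_differentiable_on (Suc k) S g \<longleftrightarrow>
     (\<forall>x\<in>S. g differentiable (at x)) \<and>
     (\<forall>v. times_differentiable_on k S (\<lambda>x. frechet_derivative g (at x) v))"

definition C_infinity_on :: "'a::real_normed_vector set \<Rightarrow> ('a \<Rightarrow> 'b::real_normed_vector) \<Rightarrow> bool" where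
  "C_infinity_on S g \<longleftrightarrow> (\<forall>k. times_differentiable_on k S g)"

definition in_Lp :: "real \<Rightarrow> 'a::euclidean_space set \<Rightarrow> ('a \<Rightarrow> complex) \<Rightarrow> bool" where
  "in_Lp s S g \<longleftrightarrow> set_borel_measurable lebesgue S g \<and>
     set_integrable lebesgue S (\<lambda>x. cmod (g x) powr s)"

definition in_Linfty :: "'a::euclidean_space set \<Rightarrow> ('a \<Rightarrow> complex) \<Rightarrow> bool" where
  "in_Linfty S g \<longleftrightarrow> set_borel_measurable lebesgue S g \<and>
     (\<exists>C. AE x in lebesgue. x \<in> S \<longrightarrow> cmod (g x) \<le> C)"

text \<open>
  The Lipschitz (Hoelder--Zygmund) scale. A finite supremum of quotients is expressed by a
  bound \<open>C\<close>. Order \<open>1\<close> is the Zygmund class, defined by second differences. For \<open>\<beta> > 1\<close>, a function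
  is of class \<open>\<beta>\<close> if it and its first-order derivatives are of class \<open>\<beta> - 1\<close>; in
  \<open>Lipschitz_aux k \<sigma>\<close> the order is \<open>k + \<sigma>\<close> with \<open>0 < \<sigma> \<le> 1\<close>.
\<close>

definition Hoelder_class :: "real \<Rightarrow> 'a::euclidean_space set \<Rightarrow> ('a \<Rightarrow> complex) \<Rightarrow> bool" where
  "Hoelder_class \<sigma> S u \<longleftrightarrow> in_Linfty S u \<and>
     (\<exists>C. \<forall>z h. z \<in> S \<longrightarrow> z + h \<in> S \<longrightarrow> h \<noteq> 0 \<longrightarrow>
        cmod (u (z + h) - u z) / norm h powr \<sigma> \<le> C)"

definition Zygmund_class :: "'a::euclidean_space set \<Rightarrow> ('a \<Rightarrow> complex) \<Rightarrow> bool" where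
  "Zygmund_class S u \<longleftrightarrow> in_Linfty S u \<and>
     (\<exists>C. \<forall>z h. z \<in> S \<longrightarrow> z + h \<in> S \<longrightarrow> z - h \<in> S \<longrightarrow> h \<noteq> 0 \<longrightarrow>
        cmod (u (z + h) + u (z - h) - 2 * u z) / norm h \<le> C)"

primrec Lipschitz_aux :: "nat \<Rightarrow> real \<Rightarrow> 'a::euclidean_space set \<Rightarrow> ('a \<Rightarrow> complex) \<Rightarrow> bool" where
  "Lipschitz_aux 0 \<sigma> S u \<longleftrightarrow> (if \<sigma> < 1 then Hoelder_class \<sigma> S u else Zygmund_class S u)"
| "Lipschitz_aux (Suc k) \<sigma> S u \<longleftrightarrow>
     Lipschitz_aux k \<sigma> S u \<and>
     (\<forall>x\<in>S. u differentiable (at x)) \<and>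
     (\<forall>b\<in>Basis. Lipschitz_aux k \<sigma> S (\<lambda>x. frechet_derivative u (at x) b))"

definition Lipschitz_space :: "real \<Rightarrow> 'a::euclidean_space set \<Rightarrow> ('a \<Rightarrow> complex) set" where
  "Lipschitz_space \<beta> S =
    {u. let k = nat (\<lceil>\<beta>\<rceil> - 1) in Lipschitz_aux k (\<beta> - real k) S u}"

text \<open>The Wirtinger derivative with respect to the conjugate of the coordinate \<open>i\<close>.\<close>

definition dbar_coord :: "'k::finite \<Rightarrow> (complex ^ 'k \<Rightarrow> complex) \<Rightarrow> complex ^ 'k \<Rightarrow> complex" where
  "dbar_coord i g Z =
    (frechet_derivative g (at Z) (axis i 1) + \<i> * frechet_derivative g (at Z) (axis i \<i>)) / 2"

text \<open>
  A \<open>(0,1)\<close>-form is given by its coefficients: \<open>f i\<close> is the coefficient of the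
  differential of the conjugate of the coordinate \<open>i\<close>.
\<close>

type_synonym 'k form01 = "'k \<Rightarrow> complex ^ 'k \<Rightarrow> complex"

definition dbar_closed_on :: "(complex ^ 'k::finite) set \<Rightarrow> 'k form01 \<Rightarrow> bool" where
  "dbar_closed_on S f \<longleftrightarrow>
     (\<forall>Z\<in>S. \<forall>i j. dbar_coord i (f j) Z - dbar_coord j (f i) Z = 0)"

definition test_function_on :: "(complex ^ 'k::finite) set \<Rightarrow> (complex ^ 'k \<Rightarrow> complex) \<Rightarrow> bool" where
  "test_function_on S \<phi> \<longleftrightarrow> C_infinity_on UNIV \<phi> \<and>
     (\<exists>K. compact K \<and> K \<subseteq> S \<and> (\<forall>Z. Z \<notin> K \<longrightarrow> \<phi> Z = 0))"

text \<open>
  The equation is understood in the sense of distributions, for locally integrable \<open>u\<close>, so that no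
  regularity of \<open>u\<close> is presupposed. Every continuously differentiable solution is a solution in
  this sense.
\<close>

definition dbar_solution_on ::
    "(complex ^ 'k::finite) set \<Rightarrow> (complex ^ 'k \<Rightarrow> complex) \<Rightarrow> 'k form01 \<Rightarrow> bool" where
  "dbar_solution_on S u f \<longleftrightarrow>
     (\<forall>K. compact K \<longrightarrow> K \<subseteq> S \<longrightarrow> set_integrable lebesgue K u) \<and>
     (\<forall>i \<phi>. test_function_on S \<phi> \<longrightarrow>
        (LINT Z:S|lebesgue. u Z * dbar_coord i \<phi> Z) = - (LINT Z:S|lebesgue. f i Z * \<phi> Z))"

end

theory Submission
  imports Defs "HOL-Computational_Algebra.Polynomial"
begin

text \<open>
  All coefficients of the form are \<open>g\<^bsup>-(a + \<i>)\<^esup>\<close> with \<open>a = E / p\<close>, where \<open>g\<close> is a holomorphic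
  polynomial of positive real part on the domain that vanishes at a boundary point, and
  the set \<open>|g| < d\<close> has volume at most a multiple of \<open>d\<^sup>E\<close>; this gives the integrability.
  The domain contains polydiscs around \<open>(1 - t d) P\<close>, for \<open>1 \<le> t \<le> 3\<close>, of radius comparable to \<open>sqrt d\<close> in one
  coordinate and to \<open>d\<close> in the others. Testing \<open>\<partial>\<close>-bar \<open>u = f\<close> with the three translates of a bump function
  to \<open>t = 1, 2, 3\<close> and taking second differences, a solution of Lipschitz order \<open>\<beta>\<close> gives
  \<open>d\<^bsup>-a\<^esup> \<le> C d\<^bsup>\<beta> - 1/2\<^esup>\<close> for all small \<open>d\<close>, hence \<open>\<beta> \<le> 1/2 - a\<close>. The imaginary part of the exponent keeps
  the second difference of \<open>t\<^bsup>-(a + \<i>)\<^esup>\<close> away from \<open>0\<close> also when \<open>a = 0\<close>.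

  The exponent \<open>E\<close> comes from the choice of \<open>P\<close>: on a set \<open>J\<close> of blocks of length at least two, the
  blocks of \<open>P\<close> are isotropic vectors. Then \<open>E = |N| + |J| + 1\<close>, provided that a coordinate outside the
  first two of each of these blocks is left as the wide direction. For \<open>N = (2, \<dots>, 2)\<close> this forces one block
  out of \<open>J\<close>, which explains the exceptional value \<open>3 m\<close>; \<open>N = (2)\<close> needs a different \<open>g\<close>.
\<close>

section \<open>Smooth functions\<close>

text \<open>The count behind \<open>E\<close> for isotropic blocks: \<open>2 * Re g\<close>
  dominates the squared distance to \<open>P\<close> on the domain, so \<open>|g| < d\<close>
  confines each complex coordinate to a disc of area of order \<open>d\<close>; this gives the power
  \<open>|N|\<close>. The same bound controls \<open>|Z_j \<bullet> Z_j|\<close> in each block of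
  \<open>J\<close>. At a nonzero isotropic vector this product vanishes only to first order, so one
  coordinate of the block is pinned to precision \<open>d\<close> instead of \<open>sqrt d\<close>:
  one more factor \<open>d\<close> per block. The condition \<open>|g| < d\<close> itself pins one
  last coordinate, hence the final \<open>+ 1\<close>. A block of length one cannot join
  \<open>J\<close>, since \<open>z^2 = 0\<close> forces \<open>z = 0\<close>; this is where
  \<open>l\<close> enters. The two powers in the decisive estimate: a step of length of order
  \<open>d\<close> gives \<open>d\<close> to the power \<beta> (at most 1), and moving the
  derivative onto the bump costs the reciprocal of a radius. In the wide direction that is only
  \<open>1 / sqrt d\<close>. A coordinate can be wide if it vanishes at \<open>P\<close>, because
  the domain depends on the coordinates only through their squares: an offset of order
  \<open>sqrt d\<close> then changes the square by order \<open>d\<close>.\<close>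

lemma has_derivative_frechet:
  "f differentiable (at x) \<Longrightarrow> (f has_derivative frechet_derivative f (at x)) (at x)"
  using frechet_derivative_works by blast

text \<open>Congruence at level \<open>k\<close> is a hypothesis because the rule is applied inside
  the induction that proves congruence; \<open>times_differentiable_on_SucI\<close> is the version
  with it discharged.\<close>

lemma times_differentiable_onI:
  fixes f :: "'a::real_normed_vector \<Rightarrow> 'b::real_normed_vector"
  assumes "open S" "\<And>x. x \<in> S \<Longrightarrow> (f has_derivative D x) (at x)"
    and "\<And>v. times_differentiable_on k S (\<lambda>x. D x v)"
    and cong: "\<And>f g :: 'a \<Rightarrow> 'b. times_differentiable_on k S f \<Longrightarrow> (\<And>x. x \<in> S \<Longrightarrow> f x = g x)
      \<Longrightarrow> times_differentiable_on k S g"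
  shows "times_differentiable_on (Suc k) S f"
proof -
  have "frechet_derivative f (at x) = D x" if "x \<in> S" for x
    using frechet_derivative_at[OF assms(2)[OF that]] by simp
  then have "times_differentiable_on k S (\<lambda>x. frechet_derivative f (at x) v)" for v
    using cong[OF assms(3)[of v], where g = "\<lambda>x. frechet_derivative f (at x) v"] by simp
  then show ?thesis
    using assms(2) by (auto simp: differentiable_def)
qed

lemma times_differentiable_on_cong:
  assumes "open S" "times_differentiable_on k S f" "\<And>x. x \<in> S \<Longrightarrow> f x = g x"
  shows "times_differentiable_on k S g"
  using assms(2,3)
proof (induction k arbitrary: f g)
  case 0
  then show ?case using continuous_on_cong by force
next
  case (Suc k)
  show ?case
  proof (rule times_differentiable_onI[OF \<open>open S\<close>])
    fix x assume "x \<in> S"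
    show "(g has_derivative frechet_derivative f (at x)) (at x)"
    proof (rule has_derivative_transform_within_open)
      show "(f has_derivative frechet_derivative f (at x)) (at x)"
        using Suc.prems(1) \<open>x \<in> S\<close> by (auto intro: has_derivative_frechet)
    qed (use \<open>open S\<close> \<open>x \<in> S\<close> Suc.prems(2) in auto)
  qed (use Suc in auto)
qed

lemma times_differentiable_on_SucI:
  assumes "open S" "\<And>x. x \<in> S \<Longrightarrow> (f has_derivative D x) (at x)"
    and "\<And>v. times_differentiable_on k S (\<lambda>x. D x v)"
  shows "times_differentiable_on (Suc k) S f"
  using times_differentiable_onI[OF assms] times_differentiable_on_cong[OF \<open>open S\<close>] by blast

lemma times_differentiable_on_SucD:
  "times_differentiable_on (Suc k) S f \<Longrightarrow> times_differentiable_on k S f"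
proof (induction k arbitrary: f)
  case 0
  then show ?case
    by (auto intro!: differentiable_imp_continuous_on
        simp: differentiable_on_def differentiable_at_withinI)
next
  case (Suc k)
  then show ?case by auto
qed

lemma times_differentiable_on_add:
  assumes "open S" "times_differentiable_on k S f" "times_differentiable_on k S g"
  shows "times_differentiable_on k S (\<lambda>x. f x + g x)"
  using assms(2,3)
proof (induction k arbitrary: f g)
  case 0
  then show ?case by (simp add: continuous_on_add)
next
  case (Suc k)
  show ?case
  proof (rule times_differentiable_on_SucI[OF \<open>open S\<close>])
    show "((\<lambda>x. f x + g x) has_derivative (\<lambda>v. frechet_derivative f (at x) v + frechet_derivative g (at x) v))
      (at x)" if "x \<in> S" for x
      using that Suc.prems by (intro has_derivative_add has_derivative_frechet) auto
  qed (use Suc in auto)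
qed

lemma times_differentiable_on_mult:
  fixes f g :: "'a::real_normed_vector \<Rightarrow> 'b::real_normed_algebra"
  assumes "open S" "times_differentiable_on k S f" "times_differentiable_on k S g"
  shows "times_differentiable_on k S (\<lambda>x. f x * g x)"
  using assms(2,3)
proof (induction k arbitrary: f g)
  case 0
  then show ?case by (simp add: continuous_on_mult)
next
  case (Suc k)
  note low = times_differentiable_on_SucD[OF Suc.prems(1)] times_differentiable_on_SucD[OF Suc.prems(2)]
  show ?case
  proof (rule times_differentiable_on_SucI[OF \<open>open S\<close>])
    show "((\<lambda>x. f x * g x) has_derivative
      (\<lambda>v. f x * frechet_derivative g (at x) v + frechet_derivative f (at x) v * g x)) (at x)"
      if "x \<in> S" for x
      using that Suc.prems by (intro has_derivative_mult has_derivative_frechet) auto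
    show "times_differentiable_on k S
      (\<lambda>x. f x * frechet_derivative g (at x) v + frechet_derivative f (at x) v * g x)" for v
      by (intro times_differentiable_on_add Suc.IH \<open>open S\<close> low) (use Suc.prems in auto)
  qed
qed

lemma times_differentiable_on_const: "open S \<Longrightarrow> times_differentiable_on k S (\<lambda>x. c)"
  by (induction k arbitrary: c) auto

lemma times_differentiable_on_compose_linear:
  assumes "open S" "bounded_linear L" "times_differentiable_on k S f"
  shows "times_differentiable_on k S (\<lambda>x. L (f x))"
  using assms(3)
proof (induction k arbitrary: f)
  case 0
  then show ?case using bounded_linear.continuous_on[OF assms(2)] by simp
next
  case (Suc k)
  show ?case
  proof (rule times_differentiable_on_SucI[OF \<open>open S\<close>])
    show "((\<lambda>x. L (f x)) has_derivative (\<lambda>v. L (frechet_derivative f (at x) v))) (at x)"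
      if "x \<in> S" for x
      using that Suc.prems
      by (intro bounded_linear.has_derivative[OF assms(2)] has_derivative_frechet) auto
  qed (use Suc in auto)
qed

lemma times_differentiable_on_bounded_linear:
  assumes "open S" "bounded_linear L"
  shows "times_differentiable_on k S L"
proof (cases k)
  case 0
  then show ?thesis using assms by (simp add: linear_continuous_on)
next
  case (Suc k)
  show ?thesis unfolding Suc
    by (rule times_differentiable_on_SucI[OF assms(1) bounded_linear_imp_has_derivative[OF assms(2)]])
      (simp add: times_differentiable_on_const assms)
qed

text \<open>Higher chain rules are bypassed: with \<open>H\<close> closed under differentiation,
  each derivative of the composition is a composition with another member of \<open>H\<close> times
  a derivative of \<open>g\<close>, so the induction on the order closes. Complex powers and the
  flat functions below both form such a class.\<close>

lemma times_differentiable_on_compose_field: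
  fixes g :: "'a::real_normed_vector \<Rightarrow> 'b::real_normed_field"
  assumes "open S" "g ` S \<subseteq> U" "\<And>k. times_differentiable_on k S g"
    and H: "\<And>h. h \<in> H \<Longrightarrow> \<exists>h'\<in>H. \<forall>x\<in>U. (h has_field_derivative h' x) (at x)"
    and "h \<in> H"
  shows "times_differentiable_on k S (\<lambda>x. h (g x))"
  using \<open>h \<in> H\<close>
proof (induction k arbitrary: h)
  case 0
  obtain h' where "\<forall>x\<in>U. (h has_field_derivative h' x) (at x)" using H[OF 0] by blast
  then have "continuous_on U h"
    by (meson DERIV_continuous continuous_at_imp_continuous_on)
  then show ?case
    using assms(2) assms(3)[of 0] by (auto intro: continuous_on_compose2)
next
  case (Suc k)
  obtain h' where h': "h' \<in> H" "\<forall>x\<in>U. (h has_field_derivative h' x) (at x)"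
    using H[OF Suc.prems] by blast
  show ?case
  proof (rule times_differentiable_on_SucI[OF \<open>open S\<close>])
    fix x assume "x \<in> S"
    have "(g has_derivative frechet_derivative g (at x)) (at x)"
      using assms(3)[of 1] \<open>x \<in> S\<close> by (simp add: has_derivative_frechet)
    moreover have "(h has_derivative (*) (h' (g x))) (at (g x))"
      using h' assms(2) \<open>x \<in> S\<close> by (auto simp: has_field_derivative_def)
    ultimately show "((\<lambda>x. h (g x)) has_derivative (\<lambda>v. h' (g x) * frechet_derivative g (at x) v)) (at x)"
      by (rule has_derivative_compose)
  next
    show "times_differentiable_on k S (\<lambda>x. h' (g x) * frechet_derivative g (at x) v)" for v
      using assms(3)[of "Suc k"] Suc.IH[OF h'(1)]
      by (intro times_differentiable_on_mult[OF \<open>open S\<close>]) auto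
  qed
qed

lemma C_infinity_on_const: "open S \<Longrightarrow> C_infinity_on S (\<lambda>x. c)"
  and C_infinity_on_add: "open S \<Longrightarrow> C_infinity_on S f \<Longrightarrow> C_infinity_on S g \<Longrightarrow> C_infinity_on S (\<lambda>x. f x + g x)"
  by (simp_all add: C_infinity_on_def times_differentiable_on_const times_differentiable_on_add)

lemma C_infinity_on_mult:
  fixes f g :: "'a::real_normed_vector \<Rightarrow> 'b::real_normed_algebra"
  shows "open S \<Longrightarrow> C_infinity_on S f \<Longrightarrow> C_infinity_on S g \<Longrightarrow> C_infinity_on S (\<lambda>x. f x * g x)"
  by (simp add: C_infinity_on_def times_differentiable_on_mult)

lemma C_infinity_on_bounded_linear: "open S \<Longrightarrow> bounded_linear L \<Longrightarrow> C_infinity_on S L"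
  by (simp add: C_infinity_on_def times_differentiable_on_bounded_linear)

lemma C_infinity_on_compose_linear:
  "open S \<Longrightarrow> bounded_linear L \<Longrightarrow> C_infinity_on S f \<Longrightarrow> C_infinity_on S (\<lambda>x. L (f x))"
  by (simp add: C_infinity_on_def times_differentiable_on_compose_linear)

lemma C_infinity_on_sum:
  assumes "open S" "\<And>i. i \<in> I \<Longrightarrow> C_infinity_on S (f i)"
  shows "C_infinity_on S (\<lambda>x. \<Sum>i\<in>I. f i x)"
  using assms(2)
  by (induction I rule: infinite_finite_induct) (auto intro: C_infinity_on_add C_infinity_on_const assms(1))

lemma C_infinity_on_compose_field:
  fixes g :: "'a::real_normed_vector \<Rightarrow> 'b::real_normed_field"
  assumes "open S" "g ` S \<subseteq> U" "C_infinity_on S g"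
    and "\<And>h. h \<in> H \<Longrightarrow> \<exists>h'\<in>H. \<forall>x\<in>U. (h has_field_derivative h' x) (at x)"
    and "h \<in> H"
  shows "C_infinity_on S (\<lambda>x. h (g x))"
  using assms times_differentiable_on_compose_field[OF assms(1,2) _ assms(4,5)]
  by (auto simp: C_infinity_on_def)

lemma C_infinity_on_continuous: "C_infinity_on S f \<Longrightarrow> continuous_on S f"
  unfolding C_infinity_on_def by (metis times_differentiable_on.simps(1))

lemma C_infinity_on_has_derivative:
  "C_infinity_on S f \<Longrightarrow> x \<in> S \<Longrightarrow> (f has_derivative frechet_derivative f (at x)) (at x)"
  unfolding C_infinity_on_def by (metis times_differentiable_on.simps(2) has_derivative_frechet)

lemma C_infinity_on_powr:
  fixes g :: "'a::real_normed_vector \<Rightarrow> complex"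
  assumes "open S" "C_infinity_on S g" "\<And>x. x \<in> S \<Longrightarrow> Re (g x) > 0"
  shows "C_infinity_on S (\<lambda>x. g x powr s)"
proof -
  \<comment> \<open>The factor \<open>c\<close> makes the set of powers closed under
    differentiation.\<close>
  let ?H = "{\<lambda>z. c * z powr t |c t. True}"
  have "C_infinity_on S (\<lambda>x. (\<lambda>z. 1 * z powr s) (g x))"
  proof (rule C_infinity_on_compose_field[where H = ?H and U = "{z. Re z > 0}" and h = "\<lambda>z. 1 * z powr s"])
    fix h :: "complex \<Rightarrow> complex" assume "h \<in> ?H"
    then obtain c t where h: "h = (\<lambda>z. c * z powr t)" by blast
    have "(h has_field_derivative (c * t) * z powr (t - 1)) (at z)" if "Re z > 0" for z
      using that unfolding h complex_nonpos_Reals_iff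
      by (auto intro!: derivative_eq_intros simp: complex_nonpos_Reals_iff)
    then show "\<exists>h'\<in>?H. \<forall>z\<in>{z. Re z > 0}. (h has_field_derivative h' z) (at z)"
      by (intro bexI[of _ "\<lambda>z. (c * t) * z powr (t - 1)"]) auto
  next
    show "(\<lambda>z. 1 * z powr s) \<in> ?H" by blast
  qed (use assms in auto)
  then show ?thesis by simp
qed

section \<open>Functions that are flat at the origin\<close>

definition flat_exp :: "real poly \<Rightarrow> real \<Rightarrow> real" where
  "flat_exp p x = (if x > 0 then poly p (1 / x) * exp (- (1 / x)) else 0)"

lemma flat_exp_tendsto_0: "((\<lambda>y. poly p y * exp (- y)) \<longlongrightarrow> 0) at_top" for p :: "real poly"
proof -
  have "((\<lambda>y. \<Sum>i\<le>degree p. coeff p i * (y ^ i / exp y)) \<longlongrightarrow> (\<Sum>i\<le>degree p. coeff p i * 0)) at_top"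
    by (intro tendsto_intros tendsto_power_div_exp_0)
  moreover have "poly p y * exp (- y) = (\<Sum>i\<le>degree p. coeff p i * (y ^ i / exp y))" for y
    by (simp add: poly_altdef sum_distrib_right exp_minus divide_inverse mult.assoc)
  ultimately show ?thesis by simp
qed

text \<open>With \<open>y = 1 / x\<close>, differentiation in \<open>x\<close> is
  \<open>- y^2\<close> times differentiation in \<open>y\<close>, which turns \<open>p\<close> into
  \<open>y^2 (p - p')\<close>. So the family is closed under differentiation; \<open>p = 1\<close>
  is the standard cut-off \<open>exp (- 1 / x)\<close>.\<close>

lemma flat_exp_has_field_derivative:
  "(flat_exp p has_field_derivative flat_exp ([:0, 0, 1:] * (p - pderiv p)) x) (at x)"
proof -
  consider "x > 0" | "x < 0" | "x = 0" by linarith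
  then show ?thesis
  proof cases
    case 1
    have "((\<lambda>x. poly p (1 / x) * exp (- (1 / x))) has_field_derivative
      flat_exp ([:0, 0, 1:] * (p - pderiv p)) x) (at x)"
      using 1 by (auto intro!: derivative_eq_intros simp: flat_exp_def field_simps power2_eq_square)
    then show ?thesis
      by (rule DERIV_cong_ev[THEN iffD1, rotated 3])
         (use 1 in \<open>auto simp: flat_exp_def intro!: eventually_nhds_in_open[of "{0<..}", THEN eventually_mono]\<close>)
  next
    case 2
    have "((\<lambda>x. 0) has_field_derivative flat_exp ([:0, 0, 1:] * (p - pderiv p)) x) (at x)"
      using 2 by (simp add: flat_exp_def)
    then show ?thesis
      by (rule DERIV_cong_ev[THEN iffD1, rotated 3])
         (use 2 in \<open>auto simp: flat_exp_def intro!: eventually_nhds_in_open[of "{..<0}", THEN eventually_mono]\<close>)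
  next
    case 3
    \<comment> \<open>This is the difference quotient at \<open>0\<close>: dividing by
      \<open>h\<close> multiplies the polynomial by its variable \<open>1 / h\<close>.\<close>
    have lim: "((\<lambda>h. flat_exp ([:0, 1:] * p) h) \<longlongrightarrow> 0) (at 0)"
    proof -
      have "((\<lambda>h. poly ([:0, 1:] * p) (inverse h) * exp (- inverse h)) \<longlongrightarrow> 0) (at_right (0::real))"
        by (rule filterlim_compose[OF flat_exp_tendsto_0 filterlim_inverse_at_top_right])
      then have "((\<lambda>h. flat_exp ([:0, 1:] * p) h) \<longlongrightarrow> 0) (at_right 0)"
        by (rule Lim_transform_eventually)
          (auto simp: flat_exp_def eventually_at_filter inverse_eq_divide)
      moreover have "((\<lambda>h. flat_exp ([:0, 1:] * p) h) \<longlongrightarrow> 0) (at_left 0)"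
        by (rule Lim_transform_eventually[OF tendsto_const])
          (auto simp: flat_exp_def eventually_at_filter)
      ultimately show ?thesis by (simp add: filterlim_at_split)
    qed
    have "((\<lambda>h. (flat_exp p (0 + h) - flat_exp p 0) / h) \<longlongrightarrow> 0) (at 0)"
      using lim by (rule Lim_transform_eventually) (auto simp: flat_exp_def eventually_at_filter)
    then show ?thesis
      by (simp add: 3 DERIV_def flat_exp_def)
  qed
qed

lemma C_infinity_on_flat_exp:
  assumes "open S" "C_infinity_on S g"
  shows "C_infinity_on S (\<lambda>x. flat_exp p (g x))"
  by (rule C_infinity_on_compose_field[where H = "range flat_exp" and U = UNIV])
    (use assms flat_exp_has_field_derivative in auto)

section \<open>Volume and integrability\<close>

text \<open>The index set is arbitrary because the volume estimate inducts over sets of coordinates.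
  Outside \<open>I\<close> a point of the product takes the constant value \<open>undefined\<close>,
  which does not disturb measurability.\<close>

lemma measurable_vec_lambda:
  "(\<lambda>x. \<chi> i. x i) \<in> borel_measurable (Pi\<^sub>M I (\<lambda>_::'k::finite. lborel :: 'a::euclidean_space measure))"
proof (subst borel_measurable_euclidean_space, rule ballI)
  let ?P = "Pi\<^sub>M I (\<lambda>_::'k. lborel :: 'a measure)"
  fix b :: "'a ^ 'k" assume "b \<in> Basis"
  then obtain i u where b: "b = axis i u" "u \<in> Basis" by (auto simp: Basis_vec_def)
  have "(\<lambda>x. x i \<bullet> u) \<in> borel_measurable ?P"
  proof (cases "i \<in> I")
    case True
    then have [measurable]: "(\<lambda>x. x i) \<in> borel_measurable ?P"
      using measurable_component_singleton[of i I "\<lambda>_. lborel"] by simp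
    show ?thesis by measurable
  next
    case False
    have "(\<lambda>x. undefined \<bullet> u) \<in> borel_measurable ?P" by simp
    then show ?thesis
      by (rule measurable_cong[THEN iffD1, rotated])
        (use False in \<open>auto simp: space_PiM PiE_def extensional_def\<close>)
  qed
  then show "(\<lambda>x. (\<chi> i. x i) \<bullet> b) \<in> borel_measurable ?P"
    by (simp add: b inner_axis)
qed

text \<open>Gives Fubini one complex coordinate at a time, whereas \<open>lborel\<close> on vectors
  is built from real coordinates.\<close>

lemma lborel_vec_eq_distr_PiM:
  "(lborel :: ('a::euclidean_space ^ 'k::finite) measure)
    = distr (Pi\<^sub>M UNIV (\<lambda>_. lborel)) borel (\<lambda>x. \<chi> i. x i)"
proof (rule lborel_eqI)
  fix l u :: "'a ^ 'k"
  assume le: "\<And>b. b \<in> Basis \<Longrightarrow> l \<bullet> b \<le> u \<bullet> b"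
  have le': "l $ i \<bullet> b \<le> u $ i \<bullet> b" if "b \<in> Basis" for i b
    using le[of "axis i b"] that by (auto simp: inner_axis axis_in_Basis_iff)
  interpret product_sigma_finite "\<lambda>_::'k. lborel :: 'a measure" by standard
  have "emeasure (distr (Pi\<^sub>M UNIV (\<lambda>_. lborel)) borel (\<lambda>x. \<chi> i. x i)) (box l u)
    = emeasure (Pi\<^sub>M UNIV (\<lambda>_. lborel)) (Pi\<^sub>E UNIV (\<lambda>i. box (l $ i) (u $ i)))"
    by (subst emeasure_distr) (auto simp: measurable_vec_lambda mem_box Basis_vec_def inner_axis space_PiM PiE_iff
        intro!: arg_cong2[where f = emeasure])
  also have "\<dots> = (\<Prod>i\<in>UNIV. ennreal (\<Prod>b\<in>Basis. (u $ i - l $ i) \<bullet> b))"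
    by (subst emeasure_PiM) (auto simp: le')
  also have "\<dots> = ennreal (\<Prod>i\<in>UNIV. \<Prod>b\<in>Basis. (u $ i - l $ i) \<bullet> b)"
    by (intro prod_ennreal prod_nonneg) (simp add: le' inner_diff_left)
  also have "(\<Prod>i\<in>UNIV. \<Prod>b\<in>Basis. (u $ i - l $ i) \<bullet> b) = (\<Prod>b\<in>Basis. (u - l) \<bullet> b)"
  proof -
    have "(\<Prod>b\<in>Basis. (u - l) \<bullet> b) = (\<Prod>i\<in>UNIV. \<Prod>b\<in>(\<Union>v\<in>Basis. {axis i v}). (u - l) \<bullet> b)"
      unfolding Basis_vec_def by (rule prod.UNION_disjoint) (auto simp: axis_eq_axis nonzero_Basis)
    also have "\<dots> = (\<Prod>i\<in>UNIV. \<Prod>b\<in>Basis. (u - l) \<bullet> axis i b)"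
    proof (rule prod.cong[OF refl])
      fix i :: 'k
      show "(\<Prod>b\<in>(\<Union>v\<in>Basis. {axis i v}). (u - l) \<bullet> b) = (\<Prod>b\<in>Basis. (u - l) \<bullet> axis i b)"
        by (subst prod.UNION_disjoint) (auto simp: axis_eq_axis)
    qed
    finally show ?thesis by (simp add: inner_axis)
  qed
  finally show "emeasure (distr (Pi\<^sub>M UNIV (\<lambda>_. lborel)) borel (\<lambda>x. \<chi> i. x i)) (box l u)
    = (\<Prod>b\<in>Basis. (u - l) \<bullet> b)" .
qed simp

lemma emeasure_cball_complex_le: "emeasure lborel (cball (a::complex) r) \<le> ennreal (4 * r\<^sup>2)"
proof (cases "r \<ge> 0")
  case True
  have "cball a r \<subseteq> cbox (a - Complex r r) (a + Complex r r)"
  proof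
    fix x assume "x \<in> cball a r"
    then have "cmod (x - a) \<le> r" by (simp add: dist_norm norm_minus_commute)
    then show "x \<in> cbox (a - Complex r r) (a + Complex r r)"
      using abs_Re_le_cmod[of "x - a"] abs_Im_le_cmod[of "x - a"]
      by (auto simp: mem_box Basis_complex_def)
  qed
  then have "emeasure lborel (cball a r) \<le> emeasure lborel (cbox (a - Complex r r) (a + Complex r r))"
    by (intro emeasure_mono) auto
  also have "\<dots> = ennreal (4 * r\<^sup>2)"
    using True by (subst emeasure_lborel_cbox) (auto simp: Basis_complex_def power2_eq_square)
  finally show ?thesis .
qed auto

text \<open>The set becomes a polydisc after subtracting the centers one coordinate at a time, in the order
  of decreasing rank; only the radii matter for the volume.\<close>

lemma emeasure_triangular_polydisc_le:
  fixes c :: "'k::finite \<Rightarrow> complex ^ 'k \<Rightarrow> complex" and rank :: "'k \<Rightarrow> nat"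
  assumes meas: "\<And>i. c i \<in> borel_measurable borel"
    and dep: "\<And>i Z Z'. (\<And>j. rank j < rank i \<Longrightarrow> Z $ j = Z' $ j) \<Longrightarrow> c i Z = c i Z'"
    and A: "\<And>Z i. Z \<in> A \<Longrightarrow> cmod (Z $ i - c i Z) \<le> r i"
  shows "emeasure lborel A \<le> ennreal (\<Prod>i\<in>UNIV. 4 * (r i)\<^sup>2)"
proof -
  define B where "B I = {x. \<forall>i\<in>I. cmod (x i - c i (\<chi> i. x i)) \<le> r i}" for I :: "'k set"
  define P where "P I = Pi\<^sub>M I (\<lambda>_. lborel :: complex measure)" for I :: "'k set"
  interpret product_sigma_finite "\<lambda>_::'k. lborel :: complex measure" by standard
  have vec: "(\<lambda>x. \<chi> i. x i) \<in> borel_measurable (P I)" for I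
    unfolding P_def by (rule measurable_vec_lambda)
  have Bm: "(\<lambda>x. indicator (B I) x :: ennreal) \<in> borel_measurable (P K)" if "I \<subseteq> K" for I K
  proof -
    have [measurable]: "(\<lambda>x. c i (\<chi> i. x i)) \<in> borel_measurable (P K)" for i
      using measurable_compose[OF vec meas] by simp
    have [measurable]: "(\<lambda>x. x i) \<in> borel_measurable (P K)" if "i \<in> K" for i
      using measurable_component_singleton[of i K "\<lambda>_. lborel"] that by (simp add: P_def)
    have "Measurable.pred (P K) (\<lambda>x. \<forall>i\<in>I. cmod (x i - c i (\<chi> i. x i)) \<le> r i)"
      using that by (intro pred_intros_finite) (auto intro!: borel_measurable_le borel_measurable_const)
    then have "{x\<in>space (P K). x \<in> B I} \<in> sets (P K)"
      by (simp add: B_def pred_def)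
    then show ?thesis
      by (subst borel_measurable_indicator_iff) (simp add: Int_def conj_commute)
  qed
  have "(\<integral>\<^sup>+x. indicator (B I) x \<partial>P I) \<le> ennreal (\<Prod>i\<in>I. 4 * (r i)\<^sup>2)" for I
  proof (induction I rule: finite_ranking_induct[where f = rank, OF finite])
    case 1
    have "(\<integral>\<^sup>+x. indicator (B {}) x \<partial>P {}) = emeasure (P {}) (space (P {}))"
      by (simp add: B_def P_def)
    then show ?case by (simp add: P_def PiM_empty)
  next
    case (2 i I)
    show ?case
    proof (cases "i \<in> I")
      case True
      then show ?thesis using 2 by (simp add: insert_absorb)
    next
      case False
      have split: "indicator (B (insert i I)) (x(i := y)) =
          (indicator (B I) x * indicator (cball (c i (\<chi> i. x i)) (r i)) y :: ennreal)" for x y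
      proof -
        \<comment> \<open>\<open>i\<close> has the largest rank in \<open>insert i I\<close>, so
          none of the centers involved depends on the coordinate being integrated.\<close>
        have eq: "c j (\<chi> k. (x(i := y)) k) = c j (\<chi> k. x k)" if "j \<in> insert i I" for j
          by (rule dep) (use 2(2) that in force)
        have "x(i := y) \<in> B (insert i I) \<longleftrightarrow>
            (\<forall>j\<in>insert i I. cmod ((x(i := y)) j - c j (\<chi> k. x k)) \<le> r j)"
          unfolding B_def mem_Collect_eq by (intro ball_cong refl) (simp only: eq)
        also have "\<dots> \<longleftrightarrow> x \<in> B I \<and> y \<in> cball (c i (\<chi> i. x i)) (r i)"
        proof -
          have "j \<noteq> i" if "j \<in> I" for j using that False by blast
          then show ?thesis by (simp add: B_def dist_norm norm_minus_commute conj_commute)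
        qed
        finally show ?thesis by (simp add: indicator_def)
      qed
      have "(\<integral>\<^sup>+x. indicator (B (insert i I)) x \<partial>P (insert i I))
        = (\<integral>\<^sup>+x. (\<integral>\<^sup>+y. indicator (B (insert i I)) (x(i := y)) \<partial>lborel) \<partial>P I)"
        unfolding P_def
        by (rule product_nn_integral_insert) (use False Bm[OF order_refl] in \<open>auto simp: P_def\<close>)
      also have "\<dots> = (\<integral>\<^sup>+x. indicator (B I) x * emeasure lborel (cball (c i (\<chi> i. x i)) (r i)) \<partial>P I)"
        by (simp only: split) (simp add: nn_integral_cmult_indicator)
      also have "\<dots> \<le> (\<integral>\<^sup>+x. indicator (B I) x * ennreal (4 * (r i)\<^sup>2) \<partial>P I)"
        by (intro nn_integral_mono mult_left_mono emeasure_cball_complex_le) auto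
      also have "\<dots> = (\<integral>\<^sup>+x. indicator (B I) x \<partial>P I) * ennreal (4 * (r i)\<^sup>2)"
        by (rule nn_integral_multc) (rule Bm[OF order_refl])
      also have "\<dots> \<le> ennreal (\<Prod>i\<in>I. 4 * (r i)\<^sup>2) * ennreal (4 * (r i)\<^sup>2)"
        by (intro mult_right_mono 2) auto
      also have "\<dots> = ennreal (\<Prod>i\<in>insert i I. 4 * (r i)\<^sup>2)"
        using False by (simp add: ennreal_mult[symmetric] prod_nonneg mult.commute)
      finally show ?thesis .
    qed
  qed
  note main = this[of UNIV]
  define A' where "A' = {Z. \<forall>i. cmod (Z $ i - c i Z) \<le> r i}"
  have [measurable]: "(\<lambda>Z. Z $ i) \<in> borel_measurable borel" for i :: 'k
    by (intro borel_measurable_continuous_onI continuous_intros)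
  note meas[measurable]
  have A'_sets: "A' \<in> sets borel"
    unfolding A'_def by measurable
  have "emeasure lborel A \<le> emeasure lborel A'"
    using A A'_sets by (intro emeasure_mono) (auto simp: A'_def)
  also have "\<dots> = emeasure (distr (P UNIV) borel (\<lambda>x. \<chi> i. x i)) A'"
    unfolding P_def by (subst lborel_vec_eq_distr_PiM) simp
  also have "\<dots> = (\<integral>\<^sup>+x. indicator A' x \<partial>distr (P UNIV) borel (\<lambda>x. \<chi> i. x i))"
    using A'_sets by simp
  also have "\<dots> = (\<integral>\<^sup>+x. indicator A' (\<chi> i. x i) \<partial>P UNIV)"
    by (rule nn_integral_distr) (use vec A'_sets in auto)
  also have "\<dots> = (\<integral>\<^sup>+x. indicator (B UNIV) x \<partial>P UNIV)"
    by (simp add: A'_def B_def indicator_def)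
  finally show ?thesis using main by simp
qed

text \<open>Dyadic decomposition by the size of \<open>g\<close>: near the level \<open>2^-k\<close>
  the integrand is of order \<open>2^(k q)\<close> on a set of measure at most of order
  \<open>2^(-k E)\<close>, so the series is geometric with ratio \<open>2^(q - E) < 1\<close>.
  Points with \<open>g x \<ge> 1\<close> contribute at most the measure of \<open>A\<close>.\<close>

lemma nn_integral_powr_finite:
  fixes g :: "'a \<Rightarrow> real"
  assumes [measurable]: "g \<in> borel_measurable M" "A \<in> sets M"
    and fin: "emeasure M A < \<infinity>"
    and pos: "\<And>x. x \<in> A \<Longrightarrow> g x > 0"
    and vol: "\<And>d. d > 0 \<Longrightarrow> emeasure M {x\<in>A. g x < d} \<le> ennreal (C * d powr E)"
    and "C \<ge> 0" "0 \<le> q" "q < E"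
  shows "(\<integral>\<^sup>+x. ennreal (g x powr (- q)) * indicator A x \<partial>M) < \<infinity>"
proof -
  define D where "D k = (1 / 2::real) ^ k" for k
  have D: "D k > 0" for k by (simp add: D_def)
  let ?S = "\<lambda>k x. ennreal (D (Suc k) powr (- q)) * indicator {x\<in>A. g x < 2 * D k} x"
  have pt: "ennreal (g x powr (- q)) * indicator A x \<le> indicator A x + (\<Sum>k. ?S k x)" for x
  proof (cases "x \<in> A")
    case True
    show ?thesis
    proof (cases "g x \<ge> 1")
      case True
      then have "g x powr (- q) \<le> 1" using \<open>0 \<le> q\<close> powr_mono[of "-q" 0 "g x"] by simp
      then have "ennreal (g x powr (- q)) \<le> indicator A x"
        using \<open>x \<in> A\<close> ennreal_leI[of "g x powr - q" 1] by simp
      then show ?thesis using \<open>x \<in> A\<close> by (simp add: add_increasing2)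
    next
      case False
      have g0: "g x > 0" using pos True by simp
      have ex: "\<exists>k. D k \<le> g x"
        using real_arch_pow_inv[of "g x" "1/2"] g0 by (auto simp: D_def intro: less_imp_le)
      define k where "k = (LEAST k. D k \<le> g x)"
      have k: "D k \<le> g x" unfolding k_def using ex by (rule LeastI_ex)
      have "k \<noteq> 0" using k False by (intro notI) (simp add: D_def)
      then obtain l where l: "k = Suc l" using not0_implies_Suc by blast
      have "\<not> D l \<le> g x" using not_less_Least[of l "\<lambda>k. D k \<le> g x"] l by (simp add: k_def)
      then have lt: "g x < 2 * D l" using D[of l] by linarith
      have "g x powr (- q) \<le> D (Suc l) powr (- q)"
        using k l D[of "Suc l"] \<open>0 \<le> q\<close> by (intro powr_mono2') auto
      then have "ennreal (g x powr (- q)) * indicator A x \<le> ?S l x"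
        using lt True by (simp add: ennreal_leI)
      also have "\<dots> \<le> (\<Sum>k. ?S k x)"
        using sum_le_suminf[of "\<lambda>k. ?S k x" "{l}"] by (simp del: sum_mult_indicator)
      finally show ?thesis by (simp add: add_increasing)
    qed
  qed simp
  \<comment> \<open>\<open>D (Suc k) powr (- q)\<close> is \<open>2^((k + 1) q)\<close> and
    \<open>(2 * D k) powr E\<close> is \<open>2^((1 - k) E)\<close>; the part of the product free of
    \<open>k\<close> is \<open>2^(q + E)\<close>.\<close>
  define K where "K = C * 2 powr (q + E)"
  have S: "(\<integral>\<^sup>+x. ?S k x \<partial>M) \<le> ennreal (K * (2 powr (q - E)) ^ k)" for k
  proof -
    have "(\<integral>\<^sup>+x. ?S k x \<partial>M) = ennreal (D (Suc k) powr (- q)) * emeasure M {x\<in>A. g x < 2 * D k}"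
      by (subst nn_integral_cmult) auto
    also have "\<dots> \<le> ennreal (D (Suc k) powr (- q)) * ennreal (C * (2 * D k) powr E)"
      by (intro mult_left_mono vol) (use D[of k] in auto)
    also have "\<dots> = ennreal (D (Suc k) powr (- q) * (C * (2 * D k) powr E))"
      using \<open>C \<ge> 0\<close> by (simp add: ennreal_mult)
    also have "D (Suc k) powr (- q) * (C * (2 * D k) powr E) = K * (2 powr (q - E)) ^ k"
    proof -
      have "D k = 2 powr (- real k)" for k
        by (simp add: D_def powr_minus powr_realpow power_one_over inverse_eq_divide)
      moreover have "2 * 2 powr (- real k) = 2 powr (1 - real k)"
        by (simp add: powr_diff powr_minus inverse_eq_divide)
      ultimately have "D (Suc k) powr (- q) * (2 * D k) powr E
          = 2 powr (real (Suc k) * q) * 2 powr ((1 - real k) * E)"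
        by (simp only: powr_powr) (simp add: algebra_simps)
      also have "\<dots> = 2 powr ((q + E) + (q - E) * real k)"
        by (simp only: powr_add[symmetric]) (simp add: algebra_simps)
      also have "\<dots> = 2 powr (q + E) * (2 powr (q - E)) ^ k"
        by (simp only: powr_add powr_powr[symmetric]) (simp add: powr_realpow)
      finally show ?thesis by (simp add: K_def mult_ac)
    qed
    finally show ?thesis .
  qed
  have "2 powr (q - E) < 1" using \<open>q < E\<close> by (simp add: powr_less_one)
  then have summ: "summable (\<lambda>k. K * (2 powr (q - E)) ^ k)"
    by (intro summable_mult summable_geometric) simp
  have K0: "K \<ge> 0" using \<open>C \<ge> 0\<close> by (simp add: K_def)
  have "(\<integral>\<^sup>+x. ennreal (g x powr (- q)) * indicator A x \<partial>M) \<le> (\<integral>\<^sup>+x. indicator A x + (\<Sum>k. ?S k x) \<partial>M)"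
    by (rule nn_integral_mono) (rule pt)
  also have "\<dots> = emeasure M A + (\<Sum>k. \<integral>\<^sup>+x. ?S k x \<partial>M)"
    by (subst nn_integral_add) (auto simp: nn_integral_suminf)
  also have "\<dots> \<le> emeasure M A + (\<Sum>k. ennreal (K * (2 powr (q - E)) ^ k))"
    by (intro add_left_mono suminf_le S) auto
  also have "\<dots> < \<infinity>"
    using fin summ K0 by (subst suminf_ennreal2) (auto simp: ennreal_add_eq_top less_top[symmetric])
  finally show ?thesis .
qed

section \<open>Second differences of Lipschitz functions\<close>

lemma Lipschitz_aux_mono:
  "Lipschitz_aux k \<sigma> S u \<Longrightarrow> j \<le> k \<Longrightarrow> Lipschitz_aux j \<sigma> S u"
  by (induction k) (auto simp: le_Suc_eq)

text \<open>\<open>in_Linfty\<close> bounds \<open>v\<close> only almost everywhere; the Hoelder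
  quotient from one base point turns this into a bound at every point of a bounded set.\<close>

lemma Hoelder_class_bounded:
  assumes "Hoelder_class \<sigma> S v" "bounded S" "\<sigma> > 0"
  shows "\<exists>B. \<forall>z\<in>S. cmod (v z) \<le> B"
proof (cases "S = {}")
  case False
  then obtain z0 where z0: "z0 \<in> S" by blast
  obtain C where C: "\<And>z h. z \<in> S \<Longrightarrow> z + h \<in> S \<Longrightarrow> h \<noteq> 0 \<Longrightarrow> cmod (v (z + h) - v z) / norm h powr \<sigma> \<le> C"
    using assms(1) unfolding Hoelder_class_def by blast
  obtain D where D: "\<And>z. z \<in> S \<Longrightarrow> norm (z - z0) \<le> D"
    using assms(2) z0 unfolding bounded_any_center[of S z0] by (auto simp: dist_norm norm_minus_commute)
  have "cmod (v z) \<le> cmod (v z0) + \<bar>C\<bar> * D powr \<sigma>" if "z \<in> S" for z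
  proof (cases "z = z0")
    case False
    have "cmod (v z - v z0) \<le> C * norm (z - z0) powr \<sigma>"
      using C[of z0 "z - z0"] z0 that False by (simp add: field_simps)
    also have "\<dots> \<le> \<bar>C\<bar> * norm (z - z0) powr \<sigma>"
      by (intro mult_right_mono) auto
    also have "\<dots> \<le> \<bar>C\<bar> * D powr \<sigma>"
      using D[OF that] \<open>\<sigma> > 0\<close> by (intro mult_left_mono powr_mono2) auto
    finally show ?thesis using norm_triangle_sub[of "v z" "v z0"] by linarith
  qed simp
  then show ?thesis by blast
qed auto

text \<open>The first-order derivatives are of positive Hoelder order on a bounded set, hence
  bounded, and the mean value inequality applies along segments inside \<open>S\<close>.\<close>

lemma Lipschitz_aux_1_difference:
  fixes u :: "'a::euclidean_space \<Rightarrow> complex"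
  assumes "Lipschitz_aux 1 \<sigma> S u" "bounded S" "0 < \<sigma>" "\<sigma> < 1"
  shows "\<exists>C. \<forall>x y. closed_segment x y \<subseteq> S \<longrightarrow> cmod (u y - u x) \<le> C * norm (y - x)"
proof -
  have diff: "(u has_derivative frechet_derivative u (at x)) (at x)" if "x \<in> S" for x
    using assms(1) that by (auto simp: frechet_derivative_works[symmetric])
  have "\<forall>b\<in>Basis. \<exists>B. \<forall>z\<in>S. cmod (frechet_derivative u (at z) b) \<le> B"
    using assms by (auto intro: Hoelder_class_bounded)
  then obtain B where B: "\<And>b z. b \<in> Basis \<Longrightarrow> z \<in> S \<Longrightarrow> cmod (frechet_derivative u (at z) b) \<le> B b"
    by metis
  define C where "C = (\<Sum>b\<in>Basis. B b)"
  have on: "onorm (frechet_derivative u (at z)) \<le> C" if "z \<in> S" for z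
  proof (rule onorm_bound)
    have lin: "linear (frechet_derivative u (at z))"
      using diff[OF that] has_derivative_linear by blast
    show "0 \<le> C" unfolding C_def
      by (intro sum_nonneg) (use B that norm_ge_zero order_trans in blast)
    fix v
    have "frechet_derivative u (at z) v = frechet_derivative u (at z) (\<Sum>b\<in>Basis. (v \<bullet> b) *\<^sub>R b)"
      by (simp add: euclidean_representation)
    also have "\<dots> = (\<Sum>b\<in>Basis. (v \<bullet> b) *\<^sub>R frechet_derivative u (at z) b)"
      by (simp add: linear_sum[OF lin] linear_scale[OF lin])
    also have "cmod \<dots> \<le> (\<Sum>b\<in>Basis. norm v * B b)"
      by (rule sum_norm_le) (use B that Basis_le_norm in \<open>auto intro!: mult_mono\<close>)
    finally show "cmod (frechet_derivative u (at z) v) \<le> C * norm v"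
      by (simp add: C_def sum_distrib_left mult.commute)
  qed
  have "cmod (u y - u x) \<le> C * norm (y - x)" if "closed_segment x y \<subseteq> S" for x y
    by (rule differentiable_bound[where S = "closed_segment x y"])
      (use that on diff in \<open>auto intro: has_derivative_at_withinI\<close>)
  then show ?thesis by blast
qed

text \<open>Second differences treat all orders alike: they are the only differences that the Zygmund
  class controls.\<close>

lemma Lipschitz_space_second_difference:
  fixes u :: "'a::euclidean_space \<Rightarrow> complex"
  assumes "u \<in> Lipschitz_space \<beta> S" "bounded S" "0 < \<beta>"
  shows "\<exists>C. \<forall>z h. closed_segment (z - h) (z + h) \<subseteq> S \<longrightarrow>
    cmod (u (z + h) + u (z - h) - 2 * u z) \<le> C * norm h powr min \<beta> 1"
proof -
  define k where "k = nat (\<lceil>\<beta>\<rceil> - 1)"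
  define \<sigma> where "\<sigma> = \<beta> - real k"
  have aux: "Lipschitz_aux k \<sigma> S u"
    using assms(1) by (simp add: Lipschitz_space_def Let_def k_def \<sigma>_def)
  \<comment> \<open>The ceiling sends integer orders to \<sigma> = 1, the Zygmund case.\<close>
  have "real k = of_int \<lceil>\<beta>\<rceil> - 1" using \<open>0 < \<beta>\<close> by (simp add: k_def)
  then have \<sigma>: "0 < \<sigma>" "\<sigma> \<le> 1" unfolding \<sigma>_def by linarith+
  have mid: "z \<in> closed_segment (z - h) (z + h)" for z h :: 'a
  proof -
    have "z = midpoint (z - h) (z + h)"
      by (simp add: midpoint_def scaleR_2[symmetric])
    then show ?thesis by (metis midpoint_in_closed_segment)
  qed
  have segs: "closed_segment (z - h) z \<subseteq> closed_segment (z - h) (z + h)"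
    "closed_segment z (z + h) \<subseteq> closed_segment (z - h) (z + h)" for z h :: 'a
    using mid[of z h] by (simp_all add: subset_closed_segment)
  have two: "cmod (u (z + h) + u (z - h) - 2 * u z) \<le> cmod (u (z + h) - u z) + cmod (u z - u (z - h))" for z h
    using norm_triangle_ineq4[of "u (z + h) - u z" "u z - u (z - h)"] by (simp add: algebra_simps)
  consider "\<sigma> = 1" | "\<sigma> < 1" "k = 0" | "\<sigma> < 1" "k \<ge> 1" using \<sigma> by linarith
  then show ?thesis
  proof cases
    case 1
    \<comment> \<open>All levels share the same \<sigma>, so level \<open>0\<close> is the Zygmund
      class even when \<open>k > 0\<close>.\<close>
    then have "Zygmund_class S u" using Lipschitz_aux_mono[OF aux, of 0] by simp
    then obtain C where C: "\<And>z h. z \<in> S \<Longrightarrow> z + h \<in> S \<Longrightarrow> z - h \<in> S \<Longrightarrow> h \<noteq> 0 \<Longrightarrow>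
        cmod (u (z + h) + u (z - h) - 2 * u z) / norm h \<le> C"
      unfolding Zygmund_class_def by blast
    have "min \<beta> 1 = 1" using 1 by (simp add: \<sigma>_def)
    moreover have "cmod (u (z + h) + u (z - h) - 2 * u z) \<le> C * norm h"
      if "closed_segment (z - h) (z + h) \<subseteq> S" for z h
    proof (cases "h = 0")
      case False
      have "z \<in> S" "z + h \<in> S" "z - h \<in> S" using that mid[of z h] by auto
      then show ?thesis using C[of z h] False by (simp add: field_simps)
    qed simp
    ultimately show ?thesis by (intro exI[of _ C]) auto
  next
    case 2
    then have min: "min \<beta> 1 = \<sigma>" by (simp add: \<sigma>_def)
    have "Hoelder_class \<sigma> S u" using aux 2 by simp
    then obtain C where C: "\<And>z h. z \<in> S \<Longrightarrow> z + h \<in> S \<Longrightarrow> h \<noteq> 0 \<Longrightarrow>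
        cmod (u (z + h) - u z) / norm h powr \<sigma> \<le> C"
      unfolding Hoelder_class_def by blast
    have "cmod (u (z + h) + u (z - h) - 2 * u z) \<le> (2 * C) * norm h powr \<sigma>"
      if "closed_segment (z - h) (z + h) \<subseteq> S" for z h
    proof (cases "h = 0")
      case False
      have "z \<in> S" "z + h \<in> S" "z - h \<in> S" using that mid[of z h] by auto
      then show ?thesis using C[of z h] C[of "z - h" h] two[of z h] False by (simp add: field_simps)
    qed simp
    then show ?thesis unfolding min by blast
  next
    case 3
    \<comment> \<open>\<open>k \<ge> 1\<close> gives \<beta> > 1, so a linear bound is enough, and
      two first differences supply it.\<close>
    then have min: "min \<beta> 1 = 1" using \<sigma> by (auto simp: \<sigma>_def)
    have "Lipschitz_aux 1 \<sigma> S u" using Lipschitz_aux_mono[OF aux] 3(2) .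
    then obtain C where C: "\<And>x y. closed_segment x y \<subseteq> S \<Longrightarrow> cmod (u y - u x) \<le> C * norm (y - x)"
      using Lipschitz_aux_1_difference[OF _ assms(2) \<sigma>(1) 3(1)] by blast
    have "cmod (u (z + h) + u (z - h) - 2 * u z) \<le> (2 * C) * norm h powr 1"
      if "closed_segment (z - h) (z + h) \<subseteq> S" for z h
    proof -
      have "cmod (u (z + h) - u z) \<le> C * norm h" "cmod (u z - u (z - h)) \<le> C * norm h"
        using C[of z "z + h"] C[of "z - h" z] segs[of z h] that by auto
      then show ?thesis using two[of z h] by simp
    qed
    then show ?thesis unfolding min by blast
  qed
qed

section \<open>Testing the equation with bump functions\<close>

lemma flat_exp_nonneg: "0 \<le> flat_exp 1 x"
  by (simp add: flat_exp_def)

text \<open>\<open>[:0, 0, 1:]\<close> is the polynomial of the derivative of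
  \<open>flat_exp 1\<close>; the bound is \<open>y^2 exp (- y) \<le> 2\<close>, from the quadratic
  term of \<open>exp y\<close>.\<close>

lemma flat_exp_deriv_bound: "\<bar>flat_exp [:0, 0, 1:] x\<bar> \<le> 2"
proof (cases "x > 0")
  case True
  define y where "y = 1 / x"
  have y: "y > 0" using True by (simp add: y_def)
  have "y\<^sup>2 / 2 \<le> exp y" using exp_lower_Taylor_quadratic[of y] y by simp
  then have "y\<^sup>2 * exp (- y) \<le> 2" by (simp add: exp_minus field_simps)
  then show ?thesis using True by (simp add: flat_exp_def y_def power2_eq_square)
qed (simp add: flat_exp_def)

text \<open>Each coordinate has its own radius, so that differentiation in coordinate
  \<open>i\<close> costs only \<open>1 / R i\<close>, whatever the other radii.\<close>

definition bump :: "('k::finite \<Rightarrow> real) \<Rightarrow> complex ^ 'k \<Rightarrow> real" where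
  "bump R Y = flat_exp 1 (1 - (\<Sum>i\<in>UNIV. (cmod (Y $ i) / R i)\<^sup>2))"

text \<open>Chain rule: \<open>flat_exp [:0, 0, 1:]\<close> is the derivative of
  \<open>flat_exp 1\<close>, and the conjugate derivative of \<open>- |z|^2 / R^2\<close> is
  \<open>- z / R^2\<close>.\<close>

definition bump_dbar :: "('k::finite \<Rightarrow> real) \<Rightarrow> 'k \<Rightarrow> complex ^ 'k \<Rightarrow> complex" where
  "bump_dbar R i Y = of_real (flat_exp [:0, 0, 1:] (1 - (\<Sum>i\<in>UNIV. (cmod (Y $ i) / R i)\<^sup>2)))
     * (- (Y $ i) / (of_real (R i))\<^sup>2)"

lemma bump_support:
  assumes "\<not> (\<forall>i. cmod (Y $ i) \<le> R i)" "\<And>i. R i > 0"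
  shows "bump R Y = 0" "bump_dbar R j Y = 0"
proof -
  obtain i where "cmod (Y $ i) > R i" using assms(1) by (auto simp: not_le)
  then have "1 < cmod (Y $ i) / R i" using assms(2)[of i] by simp
  then have "1 < (cmod (Y $ i) / R i)\<^sup>2" by (rule one_less_power) simp
  also have "\<dots> \<le> (\<Sum>i\<in>UNIV. (cmod (Y $ i) / R i)\<^sup>2)"
    by (rule member_le_sum) auto
  finally show "bump R Y = 0" "bump_dbar R j Y = 0"
    by (simp_all add: bump_def bump_dbar_def flat_exp_def)
qed

lemma bump_nonneg: "0 \<le> bump R Y"
  by (simp add: bump_def flat_exp_nonneg)

lemma bump_dbar_bound:
  assumes "\<And>i. R i > 0"
  shows "cmod (bump_dbar R i Y) \<le> 2 / R i"
proof (cases "\<forall>i. cmod (Y $ i) \<le> R i")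
  case True
  have "cmod (bump_dbar R i Y)
    = \<bar>flat_exp [:0, 0, 1:] (1 - (\<Sum>i\<in>UNIV. (cmod (Y $ i) / R i)\<^sup>2))\<bar> * (cmod (Y $ i) / (R i)\<^sup>2)"
    by (simp add: bump_dbar_def norm_mult norm_divide norm_power)
  also have "\<dots> \<le> 2 * (R i / (R i)\<^sup>2)"
    using True by (intro mult_mono flat_exp_deriv_bound divide_right_mono) auto
  also have "\<dots> = 2 / R i" by (simp add: power2_eq_square)
  finally show ?thesis .
next
  case False
  then show ?thesis using bump_support(2)[OF False assms] assms[of i] by (simp add: less_imp_le)
qed

lemma bump_argument_smooth:
  fixes R :: "'k::finite \<Rightarrow> real"
  shows "C_infinity_on UNIV (\<lambda>Z. 1 - (\<Sum>i\<in>UNIV. (cmod ((Z - P) $ i) / R i)\<^sup>2))"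
proof -
  have lin: "bounded_linear (\<lambda>Z::complex^'k. Re (Z $ i))" "bounded_linear (\<lambda>Z::complex^'k. Im (Z $ i))" for i
    by (intro bounded_linear_compose[OF bounded_linear_Re] bounded_linear_compose[OF bounded_linear_Im]
        bounded_linear_vec_nth)+
  have "C_infinity_on UNIV (\<lambda>Z. 1 + (\<Sum>i\<in>UNIV. (- 1 / (R i)\<^sup>2) *
     ((Re (Z $ i) + (- Re (P $ i))) * (Re (Z $ i) + (- Re (P $ i)))
     + (Im (Z $ i) + (- Im (P $ i))) * (Im (Z $ i) + (- Im (P $ i))))))"
    by (intro C_infinity_on_add C_infinity_on_mult C_infinity_on_const C_infinity_on_sum
        C_infinity_on_bounded_linear lin open_UNIV)
  also have "(\<lambda>Z. 1 + (\<Sum>i\<in>UNIV. (- 1 / (R i)\<^sup>2) *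
     ((Re (Z $ i) + (- Re (P $ i))) * (Re (Z $ i) + (- Re (P $ i)))
     + (Im (Z $ i) + (- Im (P $ i))) * (Im (Z $ i) + (- Im (P $ i))))))
     = (\<lambda>Z. 1 - (\<Sum>i\<in>UNIV. (cmod ((Z - P) $ i) / R i)\<^sup>2))"
    by (simp add: power_divide cmod_power2 sum_negf flip: power2_eq_square)
  finally show ?thesis .
qed

lemma C_infinity_on_bump: "C_infinity_on UNIV (\<lambda>Z. complex_of_real (bump R (Z - P)))"
  unfolding bump_def
  by (intro C_infinity_on_compose_linear[OF open_UNIV bounded_linear_of_real] C_infinity_on_flat_exp
      open_UNIV bump_argument_smooth)

lemma dbar_coord_bump:
  fixes R :: "'k::finite \<Rightarrow> real"
  shows "dbar_coord i (\<lambda>Z. complex_of_real (bump R (Z - P))) Z = bump_dbar R i (Z - P)"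
proof -
  define q where "q Z = 1 - (\<Sum>i\<in>UNIV. (cmod ((Z - P) $ i) / R i)\<^sup>2)" for Z
  define h where "h = flat_exp [:0, 0, 1:] (q Z)"
  let ?Y = "Z - P"
  define D where "D v = - (\<Sum>j\<in>UNIV. inverse ((R j)\<^sup>2) * (2 * (Re (?Y $ j) * Re (v $ j) + Im (?Y $ j) * Im (v $ j))))" for v
  have q: "q = (\<lambda>Z. 1 - (\<Sum>i\<in>UNIV. inverse ((R i)\<^sup>2) * ((Re (Z $ i - P $ i))\<^sup>2 + (Im (Z $ i - P $ i))\<^sup>2)))"
    by (simp add: q_def power_divide power_mult_distrib power_inverse cmod_power2 fun_eq_iff divide_inverse mult.commute)
  have "(q has_derivative D) (at Z)"
    unfolding q D_def
    by (auto intro!: derivative_eq_intros bounded_linear.has_derivative[OF bounded_linear_Re]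
        bounded_linear.has_derivative[OF bounded_linear_Im]
        bounded_linear_imp_has_derivative bounded_linear_vec_nth simp: fun_eq_iff sum_negf algebra_simps)
  moreover have "(flat_exp 1 has_derivative (*) h) (at (q Z))"
    using flat_exp_has_field_derivative[of 1 "q Z"] by (simp add: h_def has_field_derivative_def)
  ultimately have "((\<lambda>Z. flat_exp 1 (q Z)) has_derivative (\<lambda>v. h * D v)) (at Z)"
    by (rule has_derivative_compose)
  then have "((\<lambda>Z. complex_of_real (flat_exp 1 (q Z))) has_derivative (\<lambda>v. of_real (h * D v))) (at Z)"
    by (rule bounded_linear.has_derivative[OF bounded_linear_of_real])
  then have fd: "frechet_derivative (\<lambda>Z. complex_of_real (bump R (Z - P))) (at Z) = (\<lambda>v. of_real (h * D v))"
    unfolding bump_def q_def by (rule frechet_derivative_at[symmetric])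
  have "D (axis i 1) = - (\<Sum>j\<in>UNIV. if j = i then inverse ((R i)\<^sup>2) * (2 * Re (?Y $ i)) else 0)"
    "D (axis i \<i>) = - (\<Sum>j\<in>UNIV. if j = i then inverse ((R i)\<^sup>2) * (2 * Im (?Y $ i)) else 0)"
    unfolding D_def by (intro arg_cong[of _ _ uminus] sum.cong refl; simp add: axis_def)+
  then have D: "D (axis i 1) = 2 * (- Re (?Y $ i) / (R i)\<^sup>2)" "D (axis i \<i>) = 2 * (- Im (?Y $ i) / (R i)\<^sup>2)"
    by (simp_all add: divide_inverse algebra_simps)
  have "dbar_coord i (\<lambda>Z. complex_of_real (bump R (Z - P))) Z
    = of_real h * Complex (- Re (?Y $ i) / (R i)\<^sup>2) (- Im (?Y $ i) / (R i)\<^sup>2)"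
  proof -
    have "(of_real (h * (2 * a)) + \<i> * of_real (h * (2 * b))) / 2 = of_real h * Complex a b" for a b
      by (simp add: complex_eq_iff)
    then show ?thesis unfolding dbar_coord_def fd D .
  qed
  also have "Complex (- Re (?Y $ i) / (R i)\<^sup>2) (- Im (?Y $ i) / (R i)\<^sup>2) = - (?Y $ i) / (of_real (R i))\<^sup>2"
    by (simp add: complex_eq_iff flip: of_real_power)
  finally show ?thesis by (simp add: bump_dbar_def h_def q_def)
qed

lemma continuous_on_bump: "continuous_on UNIV (bump R)" "continuous_on UNIV (bump_dbar R i)"
proof -
  have fe: "continuous_on UNIV (flat_exp p)" for p
    by (meson DERIV_continuous continuous_at_imp_continuous_on flat_exp_has_field_derivative)
  have q: "continuous_on UNIV (\<lambda>Y. 1 - (\<Sum>i\<in>UNIV. (cmod (Y $ i) / R i)\<^sup>2))"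
    using C_infinity_on_continuous[OF bump_argument_smooth[of 0]] by simp
  have "continuous_on UNIV (\<lambda>Y. flat_exp p (1 - (\<Sum>i\<in>UNIV. (cmod (Y $ i) / R i)\<^sup>2)))" for p
    by (rule continuous_on_compose2[OF fe q]) auto
  then have cont: "continuous_on UNIV (\<lambda>Y. flat_exp p (1 - (\<Sum>i\<in>UNIV. (cmod (Y $ i) / R i)\<^sup>2)))" for p .
  show "continuous_on UNIV (bump R)"
    unfolding bump_def by (rule cont)
  have "continuous_on UNIV (\<lambda>Y. of_real (flat_exp [:0, 0, 1:] (1 - (\<Sum>i\<in>UNIV. (cmod (Y $ i) / R i)\<^sup>2)))
     * (- (Y $ i) * inverse ((complex_of_real (R i))\<^sup>2)))"
    by (intro continuous_on_mult continuous_on_of_real cont continuous_intros)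
  then show "continuous_on UNIV (bump_dbar R i)"
    unfolding bump_dbar_def by (simp only: divide_inverse[of "- _"])
qed

text \<open>A box has an explicit volume. It encloses the polydisc for the upper estimate, and a
  shrunken copy of it gives the lower bound for the integral of the bump.\<close>

definition polybox :: "('k::finite \<Rightarrow> real) \<Rightarrow> (complex ^ 'k) set" where
  "polybox R = cbox (- (\<chi> i. Complex (R i) (R i))) (\<chi> i. Complex (R i) (R i))"

lemma mem_polybox: "Y \<in> polybox R \<longleftrightarrow> (\<forall>i. \<bar>Re (Y $ i)\<bar> \<le> R i \<and> \<bar>Im (Y $ i)\<bar> \<le> R i)"
  by (auto simp: polybox_def mem_box Basis_vec_def Basis_complex_def inner_axis abs_le_iff) (smt (verit))+

lemma measure_polybox_pos:
  assumes "\<And>i. R i > 0" shows "0 < measure lborel (polybox R :: (complex ^ 'k::finite) set)"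
proof -
  have "\<forall>b\<in>Basis. (- (\<chi> i. Complex (R i) (R i))) \<bullet> b < (\<chi> i. Complex (R i) (R i)) \<bullet> (b :: complex ^ 'k)"
    using assms by (auto simp: Basis_vec_def Basis_complex_def inner_axis)
  then show ?thesis
    unfolding polybox_def by (simp add: content_pos_lt)
qed

lemma integral_bump_lower_bound:
  fixes R :: "'k::finite \<Rightarrow> real"
  assumes R: "\<And>i. R i > 0"
  shows "exp (- 2) * (1 / (2 * real CARD('k))) ^ DIM(complex ^ 'k) * measure lborel (polybox R)
    \<le> integral\<^sup>L lborel (bump R)" and "integrable lborel (bump R)"
proof -
  \<comment> \<open>On the box shrunk by \<open>c\<close> each summand is at most
    \<open>2 * c^2\<close>, so the sum is at most \<open>1 / 2\<close>, and the bump is at least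
    \<open>exp (- 2)\<close>, the value of \<open>flat_exp 1\<close> at
    \<open>1 / 2\<close>.\<close>
  define c where "c = 1 / (2 * real CARD('k))"
  have c: "c > 0" by (simp add: c_def)
  let ?B = "(\<lambda>x. c *\<^sub>R x + 0) ` polybox R"
  have B: "measure lborel ?B = c ^ DIM(complex ^ 'k) * measure lborel (polybox R)"
    unfolding polybox_def using content_image_affinity_cbox[of c "0 :: complex ^ 'k"] c by simp
  have Bset: "compact ?B"
    unfolding polybox_def by (intro compact_continuous_image continuous_intros compact_cbox)
  have K: "compact (polybox R)" by (simp add: polybox_def)
  have out: "bump R Y = 0" if "Y \<notin> polybox R" for Y
  proof (rule bump_support(1)[OF _ R], rule notI)
    assume "\<forall>i. cmod (Y $ i) \<le> R i"
    then have "Y \<in> polybox R"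
      by (auto simp: mem_polybox intro: order_trans[OF abs_Re_le_cmod] order_trans[OF abs_Im_le_cmod])
    then show False using that by simp
  qed
  have "integrable lborel (\<lambda>x. indicator (polybox R) x *\<^sub>R bump R x)"
    by (rule borel_integrable_compact[OF K]) (rule continuous_on_subset[OF continuous_on_bump(1)], simp)
  also have "(\<lambda>x. indicator (polybox R) x *\<^sub>R bump R x) = bump R"
    using out by (auto simp: indicator_def fun_eq_iff)
  finally show int: "integrable lborel (bump R)" .
  have low: "exp (- 2) \<le> bump R Y" if "Y \<in> ?B" for Y
  proof -
    from that obtain X where X: "Y = c *\<^sub>R X + 0" "X \<in> polybox R" by (rule imageE)
    have "(cmod (Y $ i) / R i)\<^sup>2 \<le> 2 * c\<^sup>2" for i
    proof -
      have "(cmod (X $ i))\<^sup>2 = \<bar>Re (X $ i)\<bar>\<^sup>2 + \<bar>Im (X $ i)\<bar>\<^sup>2" by (simp add: cmod_power2)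
      also have "\<dots> \<le> (R i)\<^sup>2 + (R i)\<^sup>2"
        using X(2) by (intro add_mono power_mono) (auto simp: mem_polybox)
      finally have "(cmod (X $ i))\<^sup>2 / (R i)\<^sup>2 \<le> 2" using R[of i] by (simp add: field_simps)
      then have "c\<^sup>2 * ((cmod (X $ i))\<^sup>2 / (R i)\<^sup>2) \<le> c\<^sup>2 * 2" by (intro mult_left_mono) auto
      then show ?thesis using X c by (simp add: power_divide power_mult_distrib)
    qed
    then have "(\<Sum>i\<in>UNIV. (cmod (Y $ i) / R i)\<^sup>2) \<le> (\<Sum>i\<in>(UNIV::'k set). 2 * c\<^sup>2)"
      by (intro sum_mono)
    also have "\<dots> = 1 / (2 * real CARD('k))"
      by (simp add: c_def power2_eq_square)
    also have "\<dots> \<le> 1 / 2"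
      by (simp add: divide_simps)
    finally have q: "1 / 2 \<le> 1 - (\<Sum>i\<in>UNIV. (cmod (Y $ i) / R i)\<^sup>2)" by simp
    have "exp (- 2) \<le> flat_exp 1 x" if "1 / 2 \<le> x" for x
      using that by (auto simp: flat_exp_def field_simps)
    then show ?thesis unfolding bump_def using q by blast
  qed
  have fin: "emeasure lborel ?B < \<infinity>" using Bset by (rule emeasure_compact_finite)
  have "exp (- 2) * measure lborel ?B = (\<integral>Y. exp (- 2) * indicator ?B Y \<partial>lborel)"
    using Bset fin by (simp add: borel_compact)
  also have "\<dots> \<le> integral\<^sup>L lborel (bump R)"
  proof (rule integral_mono)
    show "integrable lborel (\<lambda>Y. exp (- 2 :: real) * indicator ?B Y)"
      using integrable_real_indicator[of ?B lborel] borel_compact[OF Bset] fin by simp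
    show "exp (- 2) * indicator ?B Y \<le> bump R Y" for Y
      using low bump_nonneg[of R Y] by (auto simp: indicator_def)
  qed (rule int)
  finally have "exp (- 2) * (c ^ DIM(complex ^ 'k) * measure lborel (polybox R)) \<le> integral\<^sup>L lborel (bump R)"
    by (simp only: B)
  then show "exp (- 2) * (1 / (2 * real CARD('k))) ^ DIM(complex ^ 'k) * measure lborel (polybox R)
    \<le> integral\<^sup>L lborel (bump R)"
    by (simp only: c_def mult.assoc)
qed

text \<open>Stated for the completed measure because a weak solution is only known to be Lebesgue
  measurable.\<close>

lemma lebesgue_integral_translation:
  fixes F :: "'a::euclidean_space \<Rightarrow> 'b::{banach, second_countable_topology}"
  assumes "integrable lebesgue F"
  shows "integrable lebesgue (\<lambda>x. F (x + t))"
    and "(\<integral>x. F (x + t) \<partial>lebesgue) = (\<integral>x. F x \<partial>lebesgue)"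
proof -
  have T: "(\<lambda>x. t + (\<Sum>j\<in>Basis. (1 * (x \<bullet> j)) *\<^sub>R j)) = (\<lambda>x. x + t)"
    by (simp add: euclidean_representation add.commute)
  have meas: "(\<lambda>x. x + t) \<in> lebesgue \<rightarrow>\<^sub>M lebesgue"
    using lebesgue_affine_measurable[of "\<lambda>_. 1" t] unfolding T by simp
  have eq: "lebesgue = distr lebesgue lebesgue (\<lambda>x. x + t)"
    using lebesgue_affine_euclidean[of "\<lambda>_. 1" t] unfolding T by (simp add: density_1)
  have F: "F \<in> borel_measurable lebesgue" using assms by simp
  show "integrable lebesgue (\<lambda>x. F (x + t))"
    using integrable_distr_eq[OF meas F] assms eq by simp
  show "(\<integral>x. F (x + t) \<partial>lebesgue) = (\<integral>x. F x \<partial>lebesgue)"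
    using integral_distr[OF meas F] eq by simp
qed

text \<open>The imaginary part of \<open>t powr (- Complex a 1)\<close> is
  \<open>- t powr (- a) * sin (ln t)\<close>. It vanishes at 1. Since
  \<open>pi / 6 < ln 2 \<le> pi / 2\<close>, \<open>sin (ln 2) > 1 / 2\<close>, so the term at 2,
  counted twice, exceeds \<open>2 powr (- a)\<close>, hence \<open>3 powr (- a)\<close>, which
  bounds the term at 3. Continuity extends this to neighbourhoods of 1, 2 and 3.\<close>

lemma powr_second_difference_bound:
  fixes a :: real
  assumes "a \<ge> 0"
  obtains \<kappa> c where "\<kappa> > 0" "\<kappa> < 1" "c > 0"
    "\<And>x y z :: complex. cmod (x - 1) \<le> \<kappa> \<Longrightarrow> cmod (y - 2) \<le> \<kappa> \<Longrightarrow> cmod (z - 3) \<le> \<kappa> \<Longrightarrow>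
      c \<le> Im (x powr (- Complex a 1) + z powr (- Complex a 1) - 2 * y powr (- Complex a 1))"
proof -
  define s where "s = - Complex a 1"
  define V where "V = Im (1 powr s + 3 powr s - 2 * 2 powr s)"
  have Im: "Im (of_real t powr s) = - (t powr (- a) * sin (ln t))" if "t > 0" for t
    using that by (simp add: s_def powr_def Im_exp Ln_of_real)
  have "pi / 6 < ln 2" using ln2_ge_two_thirds pi_less_4 by linarith
  moreover have "ln (2::real) \<le> pi / 2" using ln2_le_25_over_36 pi_gt3 by linarith
  ultimately have "sin (pi / 6) < sin (ln (2::real))" using pi_gt3 by (intro sin_monotone_2pi) auto
  then have s2: "1 < 2 * sin (ln (2::real))" by (simp add: sin_30)
  have "V = 2 * (2 powr (- a) * sin (ln 2)) - 3 powr (- a) * sin (ln 3)"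
    using Im[of 1] Im[of 2] Im[of 3] by (simp add: V_def)
  moreover have "3 powr (- a) * sin (ln (3::real)) \<le> 3 powr (- a)"
    using mult_left_mono[of "sin (ln (3::real))" 1 "3 powr (- a)"] by simp
  moreover have "3 powr (- a) \<le> 2 powr (- a)" using assms by (intro powr_mono2') auto
  moreover have "2 powr (- a) < 2 * (2 powr (- a) * sin (ln (2::real)))"
    using mult_strict_left_mono[OF s2, of "2 powr (- a)"] by (simp add: mult.left_commute)
  ultimately have V: "V > 0" by linarith
  \<comment> \<open>The second difference has weights 1, 1 and 2, so errors below
    \<open>V / 8\<close> change it by less than \<open>V / 2\<close>.\<close>
  have "\<exists>d>0. \<forall>x. cmod (x - t) \<le> d \<longrightarrow> cmod (x powr s - t powr s) < V / 8" if "t \<in> {1, 2, 3}" for t :: complex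
  proof -
    have "t \<notin> \<real>\<^sub>\<le>\<^sub>0" using that by (auto simp: complex_nonpos_Reals_iff)
    then have "isCont (\<lambda>x. x powr s) t" by (blast intro: DERIV_isCont has_field_derivative_powr)
    then obtain d where "d > 0" "\<forall>x. cmod (x - t) < d \<longrightarrow> cmod (x powr s - t powr s) < V / 8"
      unfolding continuous_at_eps_delta dist_norm using V by (metis divide_pos_pos zero_less_numeral)
    then show ?thesis by (intro exI[of _ "d / 2"]) auto
  qed
  then obtain d where d: "\<And>t. t \<in> {1, 2, 3} \<Longrightarrow> d t > 0"
    "\<And>t x. t \<in> {1, 2, 3} \<Longrightarrow> cmod (x - t) \<le> d t \<Longrightarrow> cmod (x powr s - t powr s) < V / 8"
    by metis
  define \<kappa> where "\<kappa> = Min {d 1, d 2, d 3, 1 / 2}"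
  have \<kappa>: "\<kappa> > 0" "\<kappa> \<le> d 1" "\<kappa> \<le> d 2" "\<kappa> \<le> d 3" "\<kappa> \<le> 1 / 2"
    using d(1) by (auto simp: \<kappa>_def)
  show thesis
  proof
    fix x y z :: complex
    assume xyz: "cmod (x - 1) \<le> \<kappa>" "cmod (y - 2) \<le> \<kappa>" "cmod (z - 3) \<le> \<kappa>"
    have "cmod (x powr s - 1 powr s) < V / 8" "cmod (y powr s - 2 powr s) < V / 8"
      "cmod (z powr s - 3 powr s) < V / 8"
      using d(2)[of 1 x] d(2)[of 2 y] d(2)[of 3 z] xyz \<kappa> by auto
    then have "\<bar>Im (x powr s - 1 powr s)\<bar> < V / 8" "\<bar>Im (y powr s - 2 powr s)\<bar> < V / 8"
      "\<bar>Im (z powr s - 3 powr s)\<bar> < V / 8"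
      by (meson abs_Im_le_cmod le_less_trans)+
    moreover have arith: "V / 2 \<le> x' + z' - 2 * y'"
      if "\<bar>x' - p\<bar> < V / 8" "\<bar>y' - q\<bar> < V / 8" "\<bar>z' - r\<bar> < V / 8" "V = p + r - 2 * q"
      for x' y' z' p q r :: real
      using that by linarith
    ultimately show "V / 2 \<le> Im (x powr (- Complex a 1) + z powr (- Complex a 1) - 2 * y powr (- Complex a 1))"
      unfolding s_def[symmetric]
      using arith[of "Im (x powr s)" "Im (1 powr s)" "Im (y powr s)" "Im (2 powr s)" "Im (z powr s)" "Im (3 powr s)"]
      by (simp add: V_def)
  qed (use \<kappa> V in auto)
qed

text \<open>A positive real factor leaves the argument unchanged, so the principal branch is
  multiplicative here.\<close>

lemma powr_of_real_mult:
  fixes s w :: complex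
  assumes "d > 0" "w \<noteq> 0"
  shows "(of_real d * w) powr s = of_real d powr s * w powr s"
  using assms by (simp add: powr_def Ln_times_of_real exp_add[symmetric] distrib_left Ln_of_real)

definition polydisc :: "('k::finite \<Rightarrow> real) \<Rightarrow> (complex ^ 'k) set" where
  "polydisc R = {Y. \<forall>i. cmod (Y $ i) \<le> R i}"

lemma polydisc_subset_polybox: "polydisc R \<subseteq> polybox R"
  unfolding polydisc_def mem_polybox by (auto intro!: order_trans[OF abs_Re_le_cmod] order_trans[OF abs_Im_le_cmod] simp: mem_polybox)

lemma compact_polydisc: "compact (polydisc R)"
proof -
  have "closed (polydisc R)"
    unfolding polydisc_def by (intro closed_Collect_all closed_Collect_le continuous_intros)
  moreover have "bounded (polydisc R)"
    using polydisc_subset_polybox[of R] bounded_subset bounded_cbox unfolding polybox_def by blast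
  ultimately show ?thesis by (simp add: compact_eq_bounded_closed)
qed

text \<open>\<open>v\<close> is integrable only on compact subsets of \<open>S\<close>. The support
  of the translated \<open>w\<close> lies in such a set, so the integral over \<open>S\<close>
  becomes one over the whole space, where translation acts.\<close>

lemma translated_pairing:
  fixes v w :: "complex ^ 'k::finite \<Rightarrow> complex"
  assumes loc: "\<And>K. compact K \<Longrightarrow> K \<subseteq> S \<Longrightarrow> set_integrable lebesgue K v"
    and w: "continuous_on UNIV w" "\<And>Y. Y \<notin> polydisc R \<Longrightarrow> w Y = 0"
    and S: "\<And>Y. Y \<in> polydisc R \<Longrightarrow> Y + P \<in> S"
  shows "integrable lebesgue (\<lambda>Y. v (Y + P) * w Y)"
    and "(LINT Z:S|lebesgue. v Z * w (Z - P)) = (\<integral>Y. v (Y + P) * w Y \<partial>lebesgue)"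
proof -
  define K where "K = (\<lambda>Y. Y + P) ` polydisc R"
  have K: "compact K" "K \<subseteq> S"
    unfolding K_def using S
    by (auto intro!: compact_continuous_image continuous_intros compact_polydisc)
  have out: "w (Z - P) = 0" if "Z \<notin> K" for Z
  proof (rule w(2), rule notI)
    assume "Z - P \<in> polydisc R"
    then have "(Z - P) + P \<in> K" unfolding K_def by blast
    with that show False by simp
  qed
  have "bounded (w ` polydisc R)"
    by (intro compact_imp_bounded compact_continuous_image compact_polydisc continuous_on_subset[OF w(1)]) simp
  then obtain B where B: "B > 0" "\<And>Y. Y \<in> polydisc R \<Longrightarrow> cmod (w Y) \<le> B"
    unfolding bounded_pos by auto
  have B': "cmod (w Y) \<le> B" for Y using B w(2)[of Y] by (cases "Y \<in> polydisc R") auto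
  have F: "(\<lambda>Z. v Z * w (Z - P)) = (\<lambda>Z. (indicator K Z *\<^sub>R v Z) * w (Z - P))"
    using out by (auto simp: indicator_def fun_eq_iff)
  have int: "integrable lebesgue (\<lambda>Z. v Z * w (Z - P))"
  proof -
    have vK: "integrable lebesgue (\<lambda>Z. indicator K Z *\<^sub>R v Z)"
      using loc[OF K] by (simp add: set_integrable_def)
    have "continuous_on UNIV (\<lambda>Z. w (Z - P))"
      by (rule continuous_on_compose2[OF w(1)]) (auto intro!: continuous_intros)
    then have wm: "(\<lambda>Z. w (Z - P)) \<in> borel_measurable lebesgue"
      by (intro measurable_completion) (simp add: borel_measurable_continuous_onI)
    show ?thesis unfolding F
    proof (rule Bochner_Integration.integrable_bound)
      show "integrable lebesgue (\<lambda>Z. B * norm (indicator K Z *\<^sub>R v Z))"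
        using vK by (intro integrable_mult_right integrable_norm)
      show "(\<lambda>Z. (indicator K Z *\<^sub>R v Z) * w (Z - P)) \<in> borel_measurable lebesgue"
        by (rule borel_measurable_times[OF borel_measurable_integrable[OF vK] wm])
      show "AE Z in lebesgue. norm ((indicator K Z *\<^sub>R v Z) * w (Z - P)) \<le> norm (B * norm (indicator K Z *\<^sub>R v Z))"
        using B(1) mult_right_mono[OF B' norm_ge_zero] unfolding norm_mult
        by (intro AE_I2) (simp only: mult.commute[of _ "cmod (w _)"] real_norm_def abs_mult abs_norm_cancel abs_of_pos)
    qed
  qed
  show "integrable lebesgue (\<lambda>Y. v (Y + P) * w Y)"
    using lebesgue_integral_translation(1)[OF int, of P] by simp
  have "(LINT Z:S|lebesgue. v Z * w (Z - P)) = (\<integral>Z. v Z * w (Z - P) \<partial>lebesgue)"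
    unfolding set_lebesgue_integral_def
    using K(2) out by (intro Bochner_Integration.integral_cong) (auto simp: indicator_def)
  also have "\<dots> = (\<integral>Y. v (Y + P) * w Y \<partial>lebesgue)"
    using lebesgue_integral_translation(2)[OF int, of P] by simp
  finally show "(LINT Z:S|lebesgue. v Z * w (Z - P)) = (\<integral>Y. v (Y + P) * w Y \<partial>lebesgue)" .
qed

lemma test_function_bump:
  assumes R: "\<And>i. R i > 0" and S: "\<And>Y. Y \<in> polydisc R \<Longrightarrow> Y + P \<in> S"
  shows "test_function_on S (\<lambda>Z. complex_of_real (bump R (Z - P)))"
  unfolding test_function_on_def
proof (intro conjI C_infinity_on_bump exI allI impI)
  show "compact ((\<lambda>Y. Y + P) ` polydisc R)"
    by (intro compact_continuous_image continuous_intros compact_polydisc)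
  show "(\<lambda>Y. Y + P) ` polydisc R \<subseteq> S" using S by auto
  fix Z assume Z: "Z \<notin> (\<lambda>Y. Y + P) ` polydisc R"
  have "Z - P \<notin> polydisc R"
  proof
    assume "Z - P \<in> polydisc R"
    then have "(Z - P) + P \<in> (\<lambda>Y. Y + P) ` polydisc R" by blast
    then show False using Z by simp
  qed
  then show "complex_of_real (bump R (Z - P)) = 0"
    using bump_support(1)[of _ R, OF _ R] by (simp add: polydisc_def)
qed

text \<open>Pairing the equation with three translates of one bump function moves the second difference
  onto the solution; no regularity theory for weak solutions is needed.\<close>

lemma dbar_solution_second_difference:
  fixes u :: "complex ^ 'k::finite \<Rightarrow> complex"
  assumes sol: "dbar_solution_on S u f"
    and fc: "continuous_on S (f i)"
    and R: "\<And>i. R i > 0"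
    and S: "\<And>Y. Y \<in> polydisc R \<Longrightarrow> Y + L \<in> S \<and> Y + M \<in> S \<and> Y + N \<in> S"
    and ub: "\<And>Y. Y \<in> polydisc R \<Longrightarrow> cmod (u (Y + L) + u (Y + N) - 2 * u (Y + M)) \<le> B"
    and fb: "\<And>Y. Y \<in> polydisc R \<Longrightarrow> c \<le> Im (\<gamma> * (f i (Y + L) + f i (Y + N) - 2 * f i (Y + M)))"
    and "c \<ge> 0"
  shows "c * (exp (- 2) * (1 / (2 * real CARD('k))) ^ DIM(complex ^ 'k)) \<le> cmod \<gamma> * (B * (2 / R i))"
proof -
  define \<phi> where "\<phi> Y = complex_of_real (bump R Y)" for Y :: "complex ^ 'k"
  define \<psi> where "\<psi> = bump_dbar R i"
  have \<phi>: "continuous_on UNIV \<phi>" "\<And>Y. Y \<notin> polydisc R \<Longrightarrow> \<phi> Y = 0"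
    and \<psi>: "continuous_on UNIV \<psi>" "\<And>Y. Y \<notin> polydisc R \<Longrightarrow> \<psi> Y = 0"
    using bump_support[of _ R, OF _ R] continuous_on_bump
    by (auto simp: \<phi>_def[abs_def] \<psi>_def polydisc_def intro!: continuous_on_of_real)
  have uloc: "set_integrable lebesgue K u" if "compact K" "K \<subseteq> S" for K
    using sol that by (simp add: dbar_solution_on_def)
  have floc: "set_integrable lebesgue K (f i)" if "compact K" "K \<subseteq> S" for K
  proof -
    have "integrable lborel (\<lambda>x. indicator K x *\<^sub>R f i x)"
      by (rule borel_integrable_compact[OF that(1) continuous_on_subset[OF fc that(2)]])
    then show ?thesis
      unfolding set_integrable_def by (subst integrable_completion) auto
  qed
  define U where "U Y = u (Y + L) + u (Y + N) - 2 * u (Y + M)" for Y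
  define F where "F Y = f i (Y + L) + f i (Y + N) - 2 * f i (Y + M)" for Y
  \<comment> \<open>The weak equation tested with the bump centered at \<open>P\<close>, then moved
    back to the origin.\<close>
  have eq: "(\<integral>Y. u (Y + P) * \<psi> Y \<partial>lebesgue) = - (\<integral>Y. f i (Y + P) * \<phi> Y \<partial>lebesgue)"
    and ui: "integrable lebesgue (\<lambda>Y. u (Y + P) * \<psi> Y)"
    and fi: "integrable lebesgue (\<lambda>Y. f i (Y + P) * \<phi> Y)" if "P \<in> {L, M, N}" for P
  proof -
    have SP: "Y + P \<in> S" if "Y \<in> polydisc R" for Y using S[OF that] \<open>P \<in> {L, M, N}\<close> by auto
    show "integrable lebesgue (\<lambda>Y. u (Y + P) * \<psi> Y)"
      by (rule translated_pairing(1)[where S = S and R = R]) (fact uloc \<psi> SP)+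
    show "integrable lebesgue (\<lambda>Y. f i (Y + P) * \<phi> Y)"
      by (rule translated_pairing(1)[where S = S and R = R]) (fact floc \<phi> SP)+
    have u: "(LINT Z:S|lebesgue. u Z * \<psi> (Z - P)) = (\<integral>Y. u (Y + P) * \<psi> Y \<partial>lebesgue)"
      by (rule translated_pairing(2)[where S = S and R = R]) (fact uloc \<psi> SP)+
    have f: "(LINT Z:S|lebesgue. f i Z * \<phi> (Z - P)) = (\<integral>Y. f i (Y + P) * \<phi> Y \<partial>lebesgue)"
      by (rule translated_pairing(2)[where S = S and R = R]) (fact floc \<phi> SP)+
    have "(LINT Z:S|lebesgue. u Z * dbar_coord i (\<lambda>Z. complex_of_real (bump R (Z - P))) Z)
        = - (LINT Z:S|lebesgue. f i Z * complex_of_real (bump R (Z - P)))"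
      using sol test_function_bump[OF R SP] by (simp add: dbar_solution_on_def)
    then show "(\<integral>Y. u (Y + P) * \<psi> Y \<partial>lebesgue) = - (\<integral>Y. f i (Y + P) * \<phi> Y \<partial>lebesgue)"
      unfolding dbar_coord_bump using u f by (simp add: \<phi>_def \<psi>_def)
  qed
  have U: "has_bochner_integral lebesgue (\<lambda>Y. U Y * \<psi> Y)
     ((\<integral>Y. u (Y + L) * \<psi> Y \<partial>lebesgue) + (\<integral>Y. u (Y + N) * \<psi> Y \<partial>lebesgue)
       - 2 * (\<integral>Y. u (Y + M) * \<psi> Y \<partial>lebesgue))"
    unfolding U_def left_diff_distrib distrib_right mult.assoc
    by (intro has_bochner_integral_diff has_bochner_integral_add has_bochner_integral_mult_right
        has_bochner_integral_integrable ui) auto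
  have F: "has_bochner_integral lebesgue (\<lambda>Y. F Y * \<phi> Y)
     ((\<integral>Y. f i (Y + L) * \<phi> Y \<partial>lebesgue) + (\<integral>Y. f i (Y + N) * \<phi> Y \<partial>lebesgue)
       - 2 * (\<integral>Y. f i (Y + M) * \<phi> Y \<partial>lebesgue))"
    unfolding F_def left_diff_distrib distrib_right mult.assoc
    by (intro has_bochner_integral_diff has_bochner_integral_add has_bochner_integral_mult_right
        has_bochner_integral_integrable fi) auto
  have UF: "(\<integral>Y. U Y * \<psi> Y \<partial>lebesgue) = - (\<integral>Y. F Y * \<phi> Y \<partial>lebesgue)"
    using has_bochner_integral_integral_eq[OF U] has_bochner_integral_integral_eq[OF F]
      eq[of L] eq[of M] eq[of N] by simp
  \<comment> \<open>Upper and lower estimate are both multiples of \<open>V\<close>, which cancels;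
    of the radii only \<open>R i\<close>, that of the differentiated direction, survives.\<close>
  define V where "V = measure lborel (polybox R :: (complex ^ 'k) set)"
  have V: "V > 0" unfolding V_def by (rule measure_polybox_pos[OF R])
  have box: "has_bochner_integral lebesgue (\<lambda>Y. (B * (2 / R i)) * indicator (polybox R) Y) (B * (2 / R i) * V)"
  proof -
    have "has_bochner_integral lborel (indicator (polybox R :: (complex ^ 'k) set) :: _ \<Rightarrow> real) V"
      unfolding V_def polybox_def by (rule has_bochner_integral_real_indicator[OF _ emeasure_lborel_cbox_finite]) simp
    then have "has_bochner_integral lebesgue (indicator (polybox R :: (complex ^ 'k) set) :: _ \<Rightarrow> real) V"
      unfolding has_bochner_integral_iff
      using integrable_completion[of "indicator (polybox R) :: complex ^ 'k \<Rightarrow> real" lborel]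
        integral_completion[of "indicator (polybox R) :: complex ^ 'k \<Rightarrow> real" lborel]
      by (simp add: polybox_def)
    then show ?thesis by (intro has_bochner_integral_mult_right) auto
  qed
  have "0 \<in> polydisc R" using R by (simp add: polydisc_def less_imp_le)
  then have "0 \<le> B" using ub norm_ge_zero order_trans by blast
  have "cmod (\<integral>Y. U Y * \<psi> Y \<partial>lebesgue) \<le> (\<integral>Y. (B * (2 / R i)) * indicator (polybox R) Y \<partial>lebesgue)"
  proof (rule Bochner_Integration.integral_norm_bound_integral)
    show "integrable lebesgue (\<lambda>Y. U Y * \<psi> Y)" using U by (simp add: has_bochner_integral_iff)
    show "integrable lebesgue (\<lambda>Y. (B * (2 / R i)) * indicator (polybox R) Y)"
      using box by (simp only: has_bochner_integral_iff)
    fix Y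
    show "cmod (U Y * \<psi> Y) \<le> (B * (2 / R i)) * indicator (polybox R) Y"
    proof (cases "Y \<in> polydisc R")
      case True
      then have "cmod (U Y * \<psi> Y) \<le> B * (2 / R i)"
        unfolding norm_mult U_def \<psi>_def
        using ub bump_dbar_bound[OF R] \<open>0 \<le> B\<close> by (intro mult_mono) auto
      then show ?thesis using True polydisc_subset_polybox by (auto simp: indicator_def)
    next
      case False
      then show ?thesis using \<psi>(2) \<open>0 \<le> B\<close> R[of i] by (auto simp: indicator_def)
    qed
  qed
  also have "\<dots> = B * (2 / R i) * V" using box by (simp only: has_bochner_integral_iff)
  finally have upper: "cmod (\<integral>Y. F Y * \<phi> Y \<partial>lebesgue) \<le> B * (2 / R i) * V" using UF by simp
  have Fi: "integrable lebesgue (\<lambda>Y. \<gamma> * (F Y * \<phi> Y))"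
    using F by (auto simp: has_bochner_integral_iff)
  have bi: "integrable lebesgue (bump R)" "integral\<^sup>L lebesgue (bump R) = integral\<^sup>L lborel (bump R)"
    using integral_bump_lower_bound(2)[OF R] continuous_on_bump(1)[of R]
    by (auto simp: integrable_completion integral_completion borel_measurable_continuous_onI)
  have "c * ((exp (- 2) * (1 / (2 * real CARD('k))) ^ DIM(complex ^ 'k)) * V) \<le> c * integral\<^sup>L lebesgue (bump R)"
    using integral_bump_lower_bound(1)[OF R] \<open>c \<ge> 0\<close> unfolding bi V_def by (intro mult_left_mono) auto
  also have "\<dots> = (\<integral>Y. c * bump R Y \<partial>lebesgue)" by simp
  \<comment> \<open>Taking imaginary parts lets the pointwise lower bound survive integration; a
    lower bound on moduli would not.\<close>
  also have "\<dots> \<le> (\<integral>Y. Im (\<gamma> * (F Y * \<phi> Y)) \<partial>lebesgue)"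
  proof (rule integral_mono)
    show "integrable lebesgue (\<lambda>Y. c * bump R Y)" using bi(1) by simp
    show "integrable lebesgue (\<lambda>Y. Im (\<gamma> * (F Y * \<phi> Y)))" using Fi by (rule integrable_Im)
    fix Y
    have "Im (\<gamma> * (F Y * \<phi> Y)) = Im (\<gamma> * F Y) * bump R Y" by (simp add: \<phi>_def algebra_simps)
    moreover have "c * bump R Y \<le> Im (\<gamma> * F Y) * bump R Y"
    proof (cases "Y \<in> polydisc R")
      case True
      then show ?thesis using fb[OF True] bump_nonneg[of R Y] unfolding F_def by (intro mult_right_mono) auto
    next
      case False
      then show ?thesis using \<phi>(2) by (simp add: \<phi>_def)
    qed
    ultimately show "c * bump R Y \<le> Im (\<gamma> * (F Y * \<phi> Y))" by simp
  qed
  also have "\<dots> = Im (\<gamma> * (\<integral>Y. F Y * \<phi> Y \<partial>lebesgue))"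
    using integral_Im[OF Fi] by simp
  also have "\<dots> \<le> cmod \<gamma> * (B * (2 / R i) * V)"
    using abs_Im_le_cmod[of "\<gamma> * (\<integral>Y. F Y * \<phi> Y \<partial>lebesgue)"] mult_left_mono[OF upper, of "cmod \<gamma>"]
    by (simp add: norm_mult)
  finally have "(c * (exp (- 2) * (1 / (2 * real CARD('k))) ^ DIM(complex ^ 'k))) * V
      \<le> (cmod \<gamma> * (B * (2 / R i))) * V"
    by (simp only: mult.assoc)
  then show ?thesis using V by (rule mult_right_le_imp_le)
qed

lemma dbar_solution_not_Lipschitz:
  fixes u g :: "complex ^ 'k::finite \<Rightarrow> complex"
  assumes "bounded S" "continuous_on S g" and pos: "\<And>Z. Z \<in> S \<Longrightarrow> Re (g Z) > 0"
    and a: "0 \<le> a" "a < 1 / 2" and "\<epsilon> > 0"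
    and near: "\<And>\<kappa>. \<kappa> > 0 \<Longrightarrow> \<exists>r>0. \<exists>\<delta>0>0. \<forall>\<delta> t Z. 0 < \<delta> \<longrightarrow> \<delta> < \<delta>0 \<longrightarrow> 1 \<le> t \<longrightarrow> t \<le> 3 \<longrightarrow>
      (\<forall>i. cmod ((Z - (1 - t * \<delta>) *\<^sub>R P) $ i) \<le> (if i = i0 then r * sqrt \<delta> else r * \<delta>)) \<longrightarrow>
      Z \<in> S \<and> cmod (g Z - of_real (t * \<delta>)) \<le> \<kappa> * \<delta>"
    and sol: "dbar_solution_on S u f" and f: "f i0 = (\<lambda>Z. g Z powr (- Complex a 1))"
  shows "u \<notin> Lipschitz_space (1 / 2 - a + \<epsilon>) S"
proof
  assume "u \<in> Lipschitz_space (1 / 2 - a + \<epsilon>) S"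
  define \<beta> where "\<beta> = min (1 / 2 - a + \<epsilon>) 1"
  define s where "s = Complex a 1"
  obtain C where C: "\<And>z h. closed_segment (z - h) (z + h) \<subseteq> S \<Longrightarrow>
      cmod (u (z + h) + u (z - h) - 2 * u z) \<le> C * norm h powr \<beta>"
    using Lipschitz_space_second_difference[OF \<open>u \<in> _\<close> \<open>bounded S\<close>] a \<open>\<epsilon> > 0\<close> unfolding \<beta>_def by auto
  obtain \<kappa> c where "\<kappa> > 0" and c: "c > 0"
    and second: "\<And>x y z :: complex. cmod (x - 1) \<le> \<kappa> \<Longrightarrow> cmod (y - 2) \<le> \<kappa> \<Longrightarrow> cmod (z - 3) \<le> \<kappa> \<Longrightarrow>
      c \<le> Im (x powr (- s) + z powr (- s) - 2 * y powr (- s))"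
    using powr_second_difference_bound[OF a(1)] unfolding s_def by metis
  obtain r \<delta>0 where "r > 0" "\<delta>0 > 0"
    and nr: "\<And>\<delta> t Z. 0 < \<delta> \<Longrightarrow> \<delta> < \<delta>0 \<Longrightarrow> 1 \<le> t \<Longrightarrow> t \<le> 3 \<Longrightarrow>
      (\<And>i. cmod ((Z - (1 - t * \<delta>) *\<^sub>R P) $ i) \<le> (if i = i0 then r * sqrt \<delta> else r * \<delta>)) \<Longrightarrow>
      Z \<in> S \<and> cmod (g Z - of_real (t * \<delta>)) \<le> \<kappa> * \<delta>"
    using near[OF \<open>\<kappa> > 0\<close>] by metis
  define K where "K = exp (- 2) * (1 / (2 * real CARD('k))) ^ DIM(complex ^ 'k)"
  have K: "K > 0" by (simp add: K_def)
  define M where "M = C * norm P powr \<beta> * (2 / r)"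
  \<comment> \<open>This equals \<open>min \<epsilon> (a + 1 / 2)\<close>, so it is positive also
    when the cap at 1 in \<beta> is active.\<close>
  define \<eta> where "\<eta> = a + \<beta> - 1 / 2"
  have \<eta>: "\<eta> > 0" using a \<open>\<epsilon> > 0\<close> by (simp add: \<eta>_def \<beta>_def min_def)
  have fc: "continuous_on S (f i0)"
    unfolding f using \<open>continuous_on S g\<close> by (auto intro!: continuous_intros dest: pos)
  have main: "c * K \<le> M * \<delta> powr \<eta>" if \<delta>: "0 < \<delta>" "\<delta> < \<delta>0" for \<delta>
  proof -
    define R where "R i = (if i = i0 then r * sqrt \<delta> else r * \<delta>)" for i
    define Q where "Q t = (1 - t * \<delta>) *\<^sub>R P" for t
    \<comment> \<open>Multiplication by \<gamma> turns the power of \<open>g\<close> into the same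
      power of \<open>g / \<delta>\<close>, which is near \<open>t\<close> by the hypothesis
      \<open>near\<close>.\<close>
    define \<gamma> where "\<gamma> = of_real \<delta> powr s"
    have R: "R i > 0" for i using \<delta> \<open>r > 0\<close> by (simp add: R_def)
    have in_S: "Y + Q t \<in> S" and gt: "cmod (g (Y + Q t) - of_real (t * \<delta>)) \<le> \<kappa> * \<delta>"
      if "Y \<in> polydisc R" "1 \<le> t" "t \<le> 3" for Y t
      using nr[OF \<delta> that(2,3), of "Y + Q t"] that(1) by (auto simp: Q_def polydisc_def R_def)
    have ub: "cmod (u (Y + Q 1) + u (Y + Q 3) - 2 * u (Y + Q 2)) \<le> C * (\<delta> * norm P) powr \<beta>"
      if Y: "Y \<in> polydisc R" for Y
    proof -
      have shift: "Y + Q 2 + \<delta> *\<^sub>R P = Y + Q 1" "Y + Q 2 - \<delta> *\<^sub>R P = Y + Q 3"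
        by (simp_all add: Q_def algebra_simps scaleR_left_distrib[symmetric])
      \<comment> \<open>The segment consists of points \<open>Y + Q t\<close> with \<open>t\<close>
        between 1 and 3; this is why \<open>near\<close> ranges over all such \<open>t\<close> and
        not only over 1, 2, 3.\<close>
      have "closed_segment (Y + Q 3) (Y + Q 1) \<subseteq> S"
      proof
        fix x assume "x \<in> closed_segment (Y + Q 3) (Y + Q 1)"
        then obtain w where w: "0 \<le> w" "w \<le> 1" "x = (1 - w) *\<^sub>R (Y + Q 3) + w *\<^sub>R (Y + Q 1)"
          by (auto simp: closed_segment_def)
        have "x = Y + Q (3 - 2 * w)"
          unfolding w(3) by (simp add: Q_def vec_eq_iff scaleR_conv_of_real algebra_simps)
        then show "x \<in> S" using in_S[OF Y, of "3 - 2 * w"] w by simp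
      qed
      then show ?thesis
        using C[of "Y + Q 2" "\<delta> *\<^sub>R P"] \<delta>(1) unfolding shift by simp
    qed
    have scaled: "\<gamma> * g (Y + Q t) powr (- s) = (g (Y + Q t) / of_real \<delta>) powr (- s)"
      and quot: "cmod (g (Y + Q t) / of_real \<delta> - of_real t) \<le> \<kappa>"
      if "Y \<in> polydisc R" "1 \<le> t" "t \<le> 3" for Y t
    proof -
      let ?\<tau> = "g (Y + Q t) / of_real \<delta>"
      have "g (Y + Q t) \<noteq> 0" using pos[OF in_S[OF that]] by auto
      then have "(of_real \<delta> * ?\<tau>) powr (- s) = of_real \<delta> powr (- s) * ?\<tau> powr (- s)"
        using \<delta> by (intro powr_of_real_mult) auto
      then show "\<gamma> * g (Y + Q t) powr (- s) = ?\<tau> powr (- s)"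
        using \<delta>(1) by (simp add: \<gamma>_def powr_minus)
      have "?\<tau> - of_real t = (g (Y + Q t) - of_real (t * \<delta>)) / of_real \<delta>"
        using \<delta> by (simp add: field_simps)
      then have "cmod (?\<tau> - of_real t) = cmod (g (Y + Q t) - of_real (t * \<delta>)) / \<delta>"
        using \<delta> by (simp only: norm_divide norm_of_real abs_of_pos)
      then show "cmod (?\<tau> - of_real t) \<le> \<kappa>"
        using divide_right_mono[OF gt[OF that], of \<delta>] \<delta> by simp
    qed
    have fb: "c \<le> Im (\<gamma> * (f i0 (Y + Q 1) + f i0 (Y + Q 3) - 2 * f i0 (Y + Q 2)))"
      if Y: "Y \<in> polydisc R" for Y
    proof -
      have "\<gamma> * (f i0 (Y + Q 1) + f i0 (Y + Q 3) - 2 * f i0 (Y + Q 2))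
        = \<gamma> * g (Y + Q 1) powr (- s) + \<gamma> * g (Y + Q 3) powr (- s) - 2 * (\<gamma> * g (Y + Q 2) powr (- s))"
        by (simp add: f s_def algebra_simps)
      then show ?thesis
        using scaled[OF Y, of 1] scaled[OF Y, of 2] scaled[OF Y, of 3]
          second[of "g (Y + Q 1) / of_real \<delta>" "g (Y + Q 2) / of_real \<delta>" "g (Y + Q 3) / of_real \<delta>"]
          quot[OF Y, of 1] quot[OF Y, of 2] quot[OF Y, of 3] by simp
    qed
    have "c * K \<le> cmod \<gamma> * (C * (\<delta> * norm P) powr \<beta> * (2 / R i0))"
      unfolding K_def
      by (rule dbar_solution_second_difference[where f = f and R = R and u = u and S = S
            and L = "Q 1" and M = "Q 2" and N = "Q 3"])
        (use sol fc R in_S ub fb c in auto)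
    \<comment> \<open>The modulus of \<gamma> is \<open>\<delta> powr a\<close>, the step of length
      \<open>\<delta> * norm P\<close> gives \<open>\<delta> powr \<beta>\<close>, and the wide
      radius gives \<open>1 / sqrt \<delta>\<close>.\<close>
    also have "\<dots> = M * \<delta> powr \<eta>"
    proof -
      have "\<delta> powr \<eta> = \<delta> powr a * \<delta> powr \<beta> / sqrt \<delta>"
        unfolding \<eta>_def powr_diff powr_add using \<delta>(1) by (simp add: powr_half_sqrt)
      then show ?thesis
        using \<delta>(1) by (simp add: M_def \<gamma>_def s_def norm_powr_real_powr R_def powr_mult)
    qed
    finally show ?thesis .
  qed
  have "((\<lambda>\<delta>. M * \<delta> powr \<eta>) \<longlongrightarrow> M * 0) (at_right 0)"
    using \<eta> by (intro tendsto_mult tendsto_const tendsto_zero_powrI[where b = \<eta>] tendsto_ident_at)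
      (auto simp: eventually_at_filter)
  then have "\<forall>\<^sub>F \<delta> in at_right 0. M * \<delta> powr \<eta> < c * K"
    using c K by (intro order_tendstoD(2)[of _ "M * 0"]) auto
  moreover have "\<forall>\<^sub>F \<delta> in at_right 0. 0 < \<delta> \<and> \<delta> < \<delta>0"
    using eventually_at_right_less[of 0] eventually_at_right_real[OF \<open>\<delta>0 > 0\<close>]
    by eventually_elim auto
  ultimately have "\<forall>\<^sub>F \<delta> in at_right (0::real). False"
    by eventually_elim (use main in force)
  then show False by (simp add: trivial_limit_def[symmetric])
qed

section \<open>The form attached to a holomorphic function\<close>

lemma norm_powr_neg_Complex_1_le:
  assumes "Re w > 0"
  shows "cmod (w powr (- Complex a 1)) \<le> exp pi * cmod w powr (- a)"
proof -
  have w: "w \<noteq> 0" using assms by auto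
  \<comment> \<open>The imaginary part of the exponent contributes the factor
    \<open>exp (Im (Ln w))\<close>, which is bounded.\<close>
  have "cmod (w powr (- Complex a 1)) = exp (- a * ln (cmod w) + Im (Ln w))"
    using w by (simp add: powr_def)
  also have "\<dots> \<le> exp (- a * ln (cmod w) + pi)"
    using Im_Ln_le_pi[OF w] by simp
  also have "\<dots> = exp pi * cmod w powr (- a)"
    using w by (simp only: exp_add) (simp add: powr_def)
  finally show ?thesis .
qed

lemma dbar_coord_eq_0:
  assumes "(g has_derivative D) (at Z)" "D (axis i \<i>) = \<i> * D (axis i 1)"
  shows "dbar_coord i g Z = 0"
proof -
  have "frechet_derivative g (at Z) = D" using frechet_derivative_at[OF assms(1)] by simp
  then show ?thesis using assms(2) by (simp add: dbar_coord_def)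
qed

text \<open>The conclusion of the theorem with domain, \<open>p\<close> and order as parameters,
  shared by both constructions of the peak function.\<close>

definition dbar_sharpness :: "(complex ^ 'k::finite) set \<Rightarrow> ereal \<Rightarrow> real \<Rightarrow> bool" where
  "dbar_sharpness S p \<alpha> \<longleftrightarrow> (\<exists>f :: 'k form01.
    dbar_closed_on S f \<and>
    (\<forall>i. C_infinity_on S (f i)) \<and>
    (p < \<infinity> \<longrightarrow> (\<forall>s::real. 0 < s \<longrightarrow> ereal s < p \<longrightarrow> (\<forall>i. in_Lp s S (f i)))) \<and>
    (p = \<infinity> \<longrightarrow> (\<forall>i. in_Linfty S (f i))) \<and>
    (\<forall>u. dbar_solution_on S u f \<longrightarrow> (\<forall>\<epsilon>>0. u \<notin> Lipschitz_space (\<alpha> + \<epsilon>) S)))"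

text \<open>With \<open>a = E / p\<close>, the hypothesis on \<open>p\<close> gives
  \<open>a < 1 / 2\<close>, and \<open>s < p\<close> gives \<open>a * s < E\<close>, the condition
  for integrability under the volume bound. For \<open>p = \<infinity>\<close> the exponent is
  purely imaginary and the coefficients are bounded. Every coefficient is holomorphic, so the form
  is closed; the equation is tested only in coordinate \<open>i0\<close>.\<close>

lemma dbar_counterexample:
  fixes g :: "complex ^ 'k::finite \<Rightarrow> complex" and p :: ereal
  assumes S: "open S" "bounded S" and g: "C_infinity_on S g"
    and hol: "\<And>Z i. Z \<in> S \<Longrightarrow> frechet_derivative g (at Z) (axis i \<i>) = \<i> * frechet_derivative g (at Z) (axis i 1)"
    and pos: "\<And>Z. Z \<in> S \<Longrightarrow> Re (g Z) > 0"
    and vol: "\<And>d. d > 0 \<Longrightarrow> emeasure lborel {Z\<in>S. cmod (g Z) < d} \<le> ennreal (C * d powr E)"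
    and "C \<ge> 0" "E > 0" and p: "p > ereal (2 * E)"
    and near: "\<And>\<kappa>. \<kappa> > 0 \<Longrightarrow> \<exists>r>0. \<exists>\<delta>0>0. \<forall>\<delta> t Z. 0 < \<delta> \<longrightarrow> \<delta> < \<delta>0 \<longrightarrow> 1 \<le> t \<longrightarrow> t \<le> 3 \<longrightarrow>
      (\<forall>i. cmod ((Z - (1 - t * \<delta>) *\<^sub>R P) $ i) \<le> (if i = i0 then r * sqrt \<delta> else r * \<delta>)) \<longrightarrow>
      Z \<in> S \<and> cmod (g Z - of_real (t * \<delta>)) \<le> \<kappa> * \<delta>"
  shows "dbar_sharpness S p (1 / 2 - real_of_ereal (ereal E / p))"
proof -
  define a where "a = real_of_ereal (ereal E / p)"
  define F where "F Z = g Z powr (- Complex a 1)" for Z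
  have a: "0 \<le> a" "a < 1 / 2" and ap: "a * s < E" if "ereal s < p" for s
  proof -
    show "0 \<le> a" "a < 1 / 2" "a * s < E"
      using p \<open>E > 0\<close> that by (cases p; simp add: a_def field_simps)+
  qed
  then have a: "0 \<le> a" "a < 1 / 2" using p by blast+
  have gc: "continuous_on S g" using g by (rule C_infinity_on_continuous)
  have smooth: "C_infinity_on S F"
    unfolding F_def by (rule C_infinity_on_powr[OF S(1) g pos])
  have Fc: "continuous_on S F" using smooth by (rule C_infinity_on_continuous)
  have Sm: "S \<in> sets borel" using S(1) by simp
  have Fm: "(\<lambda>Z. indicator S Z *\<^sub>R F Z) \<in> borel_measurable borel"
    using Fc Sm by (intro borel_measurable_continuous_on_indicator)
  then have meas: "set_borel_measurable lebesgue S F"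
    unfolding set_borel_measurable_def by (intro measurable_completion) simp
  have dbar0: "dbar_coord i F Z = 0" if "Z \<in> S" for i Z
  proof (rule dbar_coord_eq_0)
    let ?s = "- Complex a 1"
    have "(g has_derivative frechet_derivative g (at Z)) (at Z)"
      by (rule C_infinity_on_has_derivative[OF g that])
    moreover have "((\<lambda>w. w powr ?s) has_derivative (*) (?s * g Z powr (?s - 1))) (at (g Z))"
      using pos[OF that] has_field_derivative_powr[of "g Z" ?s]
      by (simp add: has_field_derivative_def complex_nonpos_Reals_iff)
    ultimately show "(F has_derivative (\<lambda>v. ?s * g Z powr (?s - 1) * frechet_derivative g (at Z) v)) (at Z)"
      unfolding F_def by (rule has_derivative_compose)
    show "?s * g Z powr (?s - 1) * frechet_derivative g (at Z) (axis i \<i>)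
      = \<i> * (?s * g Z powr (?s - 1) * frechet_derivative g (at Z) (axis i 1))"
      using hol[OF that, of i] by (simp add: algebra_simps)
  qed
  have Fb: "cmod (F Z) \<le> exp pi * cmod (g Z) powr (- a)" if "Z \<in> S" for Z
    unfolding F_def by (rule norm_powr_neg_Complex_1_le[OF pos[OF that]])
  have Lp: "in_Lp s S F" if "0 < s" "ereal s < p" for s
  proof -
    define G where "G Z = cmod (indicator S Z *\<^sub>R g Z)" for Z
    have [measurable]: "G \<in> borel_measurable lborel"
      unfolding G_def
      using measurable_compose[OF borel_measurable_continuous_on_indicator[OF Sm gc] borel_measurable_norm]
      by simp
    have GS: "G Z = cmod (g Z)" if "Z \<in> S" for Z using that by (simp add: G_def)
    have fin: "(\<integral>\<^sup>+Z. ennreal (G Z powr (- (a * s))) * indicator S Z \<partial>lborel) < \<infinity>"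
    proof (rule nn_integral_powr_finite)
      show "emeasure lborel S < \<infinity>" using S(2) by (rule emeasure_bounded_finite)
      show "G Z > 0" if "Z \<in> S" for Z using pos[OF that] GS[OF that] by auto
      show "emeasure lborel {x\<in>S. G x < d} \<le> ennreal (C * d powr E)" if "d > 0" for d
        using vol[OF that] GS by (simp cong: conj_cong)
      show "a * s < E" using ap[OF that(2)] .
    qed (use a that \<open>C \<ge> 0\<close> Sm in auto)
    have "integrable lborel (\<lambda>Z. indicator S Z *\<^sub>R (cmod (F Z) powr s))"
    proof (rule integrableI_bounded)
      have "(\<lambda>Z. indicator S Z *\<^sub>R (cmod (F Z) powr s)) = (\<lambda>Z. cmod (indicator S Z *\<^sub>R F Z) powr s)"
        using that by (auto simp: fun_eq_iff indicator_def)
      moreover have "(\<lambda>Z. cmod (indicator S Z *\<^sub>R F Z)) \<in> borel_measurable lborel"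
        using measurable_compose[OF Fm borel_measurable_norm] by simp
      then have "(\<lambda>Z. cmod (indicator S Z *\<^sub>R F Z) powr s) \<in> borel_measurable lborel"
        by measurable
      ultimately show "(\<lambda>Z. indicator S Z *\<^sub>R (cmod (F Z) powr s)) \<in> borel_measurable lborel"
        by simp
      have "ennreal (norm (indicator S Z *\<^sub>R (cmod (F Z) powr s)))
          \<le> ennreal (exp pi powr s) * (ennreal (G Z powr (- (a * s))) * indicator S Z)" for Z
      proof (cases "Z \<in> S")
        case True
        have "cmod (F Z) powr s \<le> (exp pi * cmod (g Z) powr (- a)) powr s"
          using Fb[OF True] that by (intro powr_mono2) auto
        also have "\<dots> = exp pi powr s * G Z powr (- (a * s))"
          using GS[OF True] by (simp add: powr_mult powr_powr)
        finally show ?thesis using True by (simp add: ennreal_mult[symmetric] ennreal_leI)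
      qed simp
      then have "(\<integral>\<^sup>+Z. ennreal (norm (indicator S Z *\<^sub>R (cmod (F Z) powr s))) \<partial>lborel)
          \<le> (\<integral>\<^sup>+Z. ennreal (exp pi powr s) * (ennreal (G Z powr (- (a * s))) * indicator S Z) \<partial>lborel)"
        by (intro nn_integral_mono)
      also have "\<dots> = ennreal (exp pi powr s) * (\<integral>\<^sup>+Z. ennreal (G Z powr (- (a * s))) * indicator S Z \<partial>lborel)"
        using Sm by (intro nn_integral_cmult) auto
      also have "\<dots> < \<infinity>" using fin by (simp add: ennreal_mult_less_top)
      finally show "(\<integral>\<^sup>+Z. ennreal (norm (indicator S Z *\<^sub>R (cmod (F Z) powr s))) \<partial>lborel) < \<infinity>" .
    qed
    then have "set_integrable lebesgue S (\<lambda>Z. cmod (F Z) powr s)"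
      unfolding set_integrable_def by (subst integrable_completion) auto
    then show ?thesis using meas by (simp add: in_Lp_def)
  qed
  have Linf: "in_Linfty S F" if "p = \<infinity>"
  proof -
    have "a = 0" using that by (simp add: a_def)
    then have "cmod (F Z) \<le> exp pi" if "Z \<in> S" for Z
      using Fb[OF that] pos[OF that] by (cases "g Z = 0") auto
    then show ?thesis unfolding in_Linfty_def using meas by blast
  qed
  have "u \<notin> Lipschitz_space (1 / 2 - a + \<epsilon>) S" if "dbar_solution_on S u (\<lambda>i. F)" "\<epsilon> > 0" for u \<epsilon>
    by (rule dbar_solution_not_Lipschitz[OF S(2) gc pos a that(2) near that(1)]) (auto simp: F_def)
  then show ?thesis
    unfolding dbar_sharpness_def a_def[symmetric]
    by (intro exI[of _ "\<lambda>i. F"] conjI) (auto simp: dbar_closed_on_def dbar0 smooth Lp Linf)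
qed

section \<open>Geometry of the domain\<close>

lemma cvnorm_square: "(cvnorm k a)\<^sup>2 = (\<Sum>j=1..k. (cmod (a j))\<^sup>2)"
proof -
  have "Re (cdot k a (\<lambda>j. cnj (a j))) = (\<Sum>j=1..k. (cmod (a j))\<^sup>2)"
    by (simp add: cdot_def complex_norm_square[symmetric] flip: of_real_power)
  moreover have "(\<Sum>j=1..k. (cmod (a j))\<^sup>2) \<ge> 0" by (intro sum_nonneg) simp
  ultimately show ?thesis by (simp add: cvnorm_def)
qed

locale labelled_blocks =
  fixes m :: nat and n :: "nat \<Rightarrow> nat" and e :: "nat \<Rightarrow> nat \<Rightarrow> 'k::finite"
  assumes labelling: "coord_labelling m n e"
begin

lemma inj_label:
  assumes "j \<in> {1..m}" "i \<in> {1..n j}" "j' \<in> {1..m}" "i' \<in> {1..n j'}" "e j i = e j' i'"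
  shows "j = j'" "i = i'"
proof -
  have "inj_on (\<lambda>(j, i). e j i) (SIGMA j:{1..m}. {1..n j})"
    using labelling by (simp add: coord_labelling_def bij_betw_def)
  from inj_onD[OF this, of "(j, i)" "(j', i')"] assms show "j = j'" "i = i'" by auto
qed

lemma surj_label: obtains j i where "j \<in> {1..m}" "i \<in> {1..n j}" "k = e j i"
proof -
  have "k \<in> (\<lambda>(j, i). e j i) ` (SIGMA j:{1..m}. {1..n j})"
    using labelling by (simp add: coord_labelling_def bij_betw_def)
  then show ?thesis using that by auto
qed

lemma sum_label: "(\<Sum>j=1..m. \<Sum>i=1..n j. f (e j i)) = (\<Sum>k\<in>UNIV. f k)"
proof -
  have "(\<Sum>j=1..m. \<Sum>i=1..n j. f (e j i)) = (\<Sum>(j, i)\<in>(SIGMA j:{1..m}. {1..n j}). f (e j i))"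
    by (rule sum.Sigma) auto
  also have "\<dots> = (\<Sum>k\<in>UNIV. f k)"
    using sum.reindex_bij_betw[OF labelling[unfolded coord_labelling_def], of f]
    by (simp add: case_prod_unfold)
  finally show ?thesis .
qed

lemma card_label: "CARD('k) = tuple_sum m n"
  using sum_label[of "\<lambda>_. 1 :: nat"] by (simp add: tuple_sum_def)

definition gauge :: "complex ^ 'k \<Rightarrow> real" where
  "gauge Z = (\<Sum>j=1..m. (\<Sum>i=1..n j. (cmod (Z $ e j i))\<^sup>2) + cmod (\<Sum>i=1..n j. (Z $ e j i)\<^sup>2))"

lemma Omega_eq: "Omega m n e = {Z. gauge Z < 1}"
  by (simp add: Omega_def gauge_def cvnorm_square block_def cdot_def flip: power2_eq_square)

lemma gauge_eq: "gauge Z = (norm Z)\<^sup>2 + (\<Sum>j=1..m. cmod (\<Sum>i=1..n j. (Z $ e j i)\<^sup>2))"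
  unfolding gauge_def sum.distrib sum_label[of "\<lambda>k. (cmod (Z $ k))\<^sup>2"]
  by (simp add: norm_vec_def L2_set_def sum_nonneg)

lemma norm_le_gauge: "(norm Z)\<^sup>2 \<le> gauge Z"
  by (simp add: gauge_eq sum_nonneg)

lemma open_Omega: "open (Omega m n e)"
  unfolding Omega_eq gauge_def by (intro open_Collect_less continuous_intros)

lemma bounded_Omega: "bounded (Omega m n e)"
proof -
  have "norm Z \<le> 1" if "Z \<in> Omega m n e" for Z
  proof -
    have "(norm Z)\<^sup>2 \<le> 1\<^sup>2" using that norm_le_gauge[of Z] by (simp add: Omega_eq)
    then show ?thesis by (rule power2_le_imp_le) simp
  qed
  then show ?thesis by (rule boundedI)
qed

lemma gauge_scaleR: "gauge (c *\<^sub>R Z) = c\<^sup>2 * gauge Z"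
  by (simp add: gauge_eq power_mult_distrib scaleR_power sum_distrib_left distrib_left norm_mult norm_power
      flip: scaleR_sum_right)

text \<open>The gauge sees a point only through the squares of its coordinates, as
  \<open>(cmod z)^2 = cmod (z^2)\<close>. Each square enters twice, hence the factor 2.\<close>

lemma gauge_le: "gauge Z \<le> gauge W + 2 * (\<Sum>k\<in>UNIV. cmod ((Z $ k)\<^sup>2 - (W $ k)\<^sup>2))"
proof -
  let ?d = "\<lambda>k. cmod ((Z $ k)\<^sup>2 - (W $ k)\<^sup>2)"
  have "(\<Sum>i=1..n j. (cmod (Z $ e j i))\<^sup>2) + cmod (\<Sum>i=1..n j. (Z $ e j i)\<^sup>2)
    \<le> (\<Sum>i=1..n j. (cmod (W $ e j i))\<^sup>2) + cmod (\<Sum>i=1..n j. (W $ e j i)\<^sup>2)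
      + 2 * (\<Sum>i=1..n j. ?d (e j i))" for j
  proof -
    have "(cmod (Z $ k))\<^sup>2 \<le> (cmod (W $ k))\<^sup>2 + ?d k" for k
      using norm_triangle_sub[of "(Z $ k)\<^sup>2" "(W $ k)\<^sup>2"] by (simp add: norm_power)
    then have "(\<Sum>i=1..n j. (cmod (Z $ e j i))\<^sup>2) \<le> (\<Sum>i=1..n j. (cmod (W $ e j i))\<^sup>2 + ?d (e j i))"
      by (intro sum_mono)
    moreover have "cmod (\<Sum>i=1..n j. (Z $ e j i)\<^sup>2) \<le> cmod (\<Sum>i=1..n j. (W $ e j i)\<^sup>2) + (\<Sum>i=1..n j. ?d (e j i))"
    proof -
      have "cmod ((\<Sum>i=1..n j. (Z $ e j i)\<^sup>2) - (\<Sum>i=1..n j. (W $ e j i)\<^sup>2)) \<le> (\<Sum>i=1..n j. ?d (e j i))"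
        unfolding sum_subtractf[symmetric] by (rule norm_sum)
      then show ?thesis
        using norm_triangle_sub[of "\<Sum>i=1..n j. (Z $ e j i)\<^sup>2" "\<Sum>i=1..n j. (W $ e j i)\<^sup>2"] by linarith
    qed
    ultimately show ?thesis by (simp add: sum.distrib)
  qed
  then have "gauge Z \<le> (\<Sum>j=1..m. (\<Sum>i=1..n j. (cmod (W $ e j i))\<^sup>2) + cmod (\<Sum>i=1..n j. (W $ e j i)\<^sup>2)
      + 2 * (\<Sum>i=1..n j. ?d (e j i)))"
    unfolding gauge_def by (intro sum_mono)
  also have "\<dots> = gauge W + 2 * (\<Sum>k\<in>UNIV. ?d k)"
    using sum_label[of ?d] by (simp add: gauge_def sum.distrib flip: sum_distrib_left)
  finally show ?thesis .
qed

text \<open>As \<open>P $ i0 = 0\<close>, an offset of order \<open>sqrt \<delta>\<close> in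
  coordinate \<open>i0\<close> changes its square by order \<delta> only, like the offsets of order
  \<delta> elsewhere. Shrinking \<open>P\<close> by \<open>1 - t * \<delta>\<close> leaves room of
  order \<delta> below gauge 1, which a small \<open>r\<close> does not use up.\<close>

lemma near_boundary_point:
  assumes P: "gauge P = 1" "P $ i0 = 0"
    and g: "\<And>Z t. cmod (g Z - complex_of_real t)
      \<le> L * (\<Sum>k\<in>UNIV. if k = i0 then (cmod (Z $ k))\<^sup>2 else cmod (Z $ k - of_real (1 - t) * P $ k))"
    and "\<kappa> > 0"
  shows "\<exists>r>0. \<exists>\<delta>0>0. \<forall>\<delta> t Z. 0 < \<delta> \<longrightarrow> \<delta> < \<delta>0 \<longrightarrow> 1 \<le> t \<longrightarrow> t \<le> 3 \<longrightarrow>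
      (\<forall>i. cmod ((Z - (1 - t * \<delta>) *\<^sub>R P) $ i) \<le> (if i = i0 then r * sqrt \<delta> else r * \<delta>)) \<longrightarrow>
      Z \<in> Omega m n e \<and> cmod (g Z - of_real (t * \<delta>)) \<le> \<kappa> * \<delta>"
proof -
  define c where "c = real CARD('k)"
  have c: "c \<ge> 1" using zero_less_card_finite[where 'a='k] by (simp add: c_def)
  \<comment> \<open>The first bound keeps the gauge change \<open>6 * c * r * \<delta>\<close> at
    most \<open>\<delta> / 2\<close>, the second the error of \<open>g\<close> at most
    \<open>\<kappa> * \<delta>\<close>. Adding 1 to the modulus of \<open>L\<close> avoids a zero
    denominator.\<close>
  define r where "r = min (1 / (12 * c)) (\<kappa> / ((\<bar>L\<bar> + 1) * c))"
  have r: "r > 0" using c \<open>\<kappa> > 0\<close> by (simp add: r_def)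
  have "12 * c \<ge> 1" using c by simp
  then have r1: "r \<le> 1" using c by (simp add: r_def min_le_iff_disj)
  have rc: "12 * c * r \<le> 1" using c mult_left_mono[of r "1 / (12 * c)" "12 * c"] by (simp add: r_def)
  have rk: "\<bar>L\<bar> * (c * r) \<le> \<kappa>"
  proof -
    have pos: "(\<bar>L\<bar> + 1) * c > 0" using c by (simp add: add_nonneg_pos)
    have "((\<bar>L\<bar> + 1) * c) * r \<le> ((\<bar>L\<bar> + 1) * c) * (\<kappa> / ((\<bar>L\<bar> + 1) * c))"
      using pos by (intro mult_left_mono) (auto simp: r_def)
    also have "\<dots> = \<kappa>" using less_imp_neq[OF pos] by (simp del: mult_eq_0_iff)
    finally have "(\<bar>L\<bar> + 1) * (c * r) \<le> \<kappa>" by (simp add: mult.assoc)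
    moreover have "\<bar>L\<bar> * (c * r) \<le> (\<bar>L\<bar> + 1) * (c * r)" using c r by (intro mult_right_mono) auto
    ultimately show ?thesis by linarith
  qed
  \<comment> \<open>The bound \<open>1 / 3\<close> keeps \<open>1 - t * \<delta>\<close> nonnegative
    up to \<open>t = 3\<close>.\<close>
  have "Z \<in> Omega m n e \<and> cmod (g Z - of_real (t * \<delta>)) \<le> \<kappa> * \<delta>"
    if \<delta>: "0 < \<delta>" "\<delta> < 1 / 3" and t: "1 \<le> t" "t \<le> 3"
      and Z: "\<forall>i. cmod ((Z - (1 - t * \<delta>) *\<^sub>R P) $ i) \<le> (if i = i0 then r * sqrt \<delta> else r * \<delta>)"
    for \<delta> t Z
  proof -
    define w where "w = 1 - t * \<delta>"
    have td: "\<delta> \<le> t * \<delta>" "t * \<delta> \<le> 3 * \<delta>" using t \<delta> by simp_all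
    then have w: "0 \<le> w" "w \<le> 1 - \<delta>" "w \<le> 1" using \<delta> unfolding w_def by linarith+
    have "(norm P)\<^sup>2 \<le> 1\<^sup>2" using norm_le_gauge[of P] P(1) by simp
    then have "norm P \<le> 1" by (rule power2_le_imp_le) simp
    then have P1: "cmod (P $ k) \<le> 1" for k using Finite_Cartesian_Product.norm_nth_le[of P k] by linarith
    have rr: "(r * sqrt \<delta>)\<^sup>2 \<le> r * \<delta>"
      using r r1 \<delta> by (simp add: power_mult_distrib) (simp add: power2_eq_square mult_left_le)
    have i0: "(cmod (Z $ i0))\<^sup>2 \<le> r * \<delta>"
    proof -
      have "cmod (Z $ i0) \<le> r * sqrt \<delta>" using Z[rule_format, of i0] P(2) by simp
      then have "(cmod (Z $ i0))\<^sup>2 \<le> (r * sqrt \<delta>)\<^sup>2" by (intro power_mono) auto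
      then show ?thesis using rr by linarith
    qed
    have other: "cmod (Z $ k - of_real w * P $ k) \<le> r * \<delta>" if "k \<noteq> i0" for k
      using Z[rule_format, of k] that
      unfolding vector_minus_component vector_scaleR_component scaleR_conv_of_real[where 'a = complex] w_def by simp
    have "cmod ((Z $ k)\<^sup>2 - ((w *\<^sub>R P) $ k)\<^sup>2) \<le> 3 * (r * \<delta>)" for k
    proof (cases "k = i0")
      case True
      have "0 < r * \<delta>" using r \<delta> by simp
      then show ?thesis using i0 P(2) True by (simp add: norm_power)
    next
      case False
      let ?x = "Z $ k" and ?y = "of_real w * P $ k"
      have y: "cmod ?y \<le> 1" using w P1[of k] by (simp add: norm_mult mult_le_one)
      have "r * \<delta> \<le> 1" using r r1 \<delta> by (simp add: mult_le_one)
      moreover have "cmod (?x + ?y) \<le> cmod (?x - ?y) + 2 * cmod ?y"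
        using norm_triangle_ineq[of "?x - ?y" "2 * ?y"] by (simp add: norm_mult add.commute)
      ultimately have "cmod (?x + ?y) \<le> 3" using other[OF False] y by linarith
      then have "cmod (?x - ?y) * cmod (?x + ?y) \<le> (r * \<delta>) * 3"
        using other[OF False] r \<delta> by (intro mult_mono) auto
      then show ?thesis
        unfolding vector_scaleR_component scaleR_conv_of_real[where 'a = complex]
        by (simp add: power2_eq_square square_diff_square_factored norm_mult mult.commute)
    qed
    then have "(\<Sum>k\<in>UNIV. cmod ((Z $ k)\<^sup>2 - ((w *\<^sub>R P) $ k)\<^sup>2)) \<le> (\<Sum>k\<in>(UNIV :: 'k set). 3 * (r * \<delta>))"
      by (intro sum_mono)
    then have "gauge Z \<le> w\<^sup>2 + 2 * (c * (3 * (r * \<delta>)))"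
      using gauge_le[of Z "w *\<^sub>R P"] P(1) by (simp add: gauge_scaleR c_def)
    also have "\<dots> = w\<^sup>2 + (12 * c * r) * \<delta> / 2" by simp
    also have "\<dots> \<le> w\<^sup>2 + 1 * \<delta> / 2"
      using rc \<delta> by (intro add_left_mono divide_right_mono mult_right_mono) auto
    also have "w\<^sup>2 \<le> w" using w by (simp add: power2_eq_square mult_left_le)
    finally have "gauge Z < 1" using w \<delta> by linarith
    moreover have "cmod (g Z - of_real (t * \<delta>)) \<le> \<kappa> * \<delta>"
    proof -
      let ?s = "\<Sum>k\<in>UNIV. if k = i0 then (cmod (Z $ k))\<^sup>2 else cmod (Z $ k - of_real w * P $ k)"
      have "?s \<le> (\<Sum>k\<in>(UNIV :: 'k set). r * \<delta>)"
        by (intro sum_mono) (use i0 other in auto)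
      then have s: "?s \<le> c * (r * \<delta>)" by (simp add: c_def)
      have s0: "0 \<le> ?s" by (intro sum_nonneg) auto
      have "cmod (g Z - of_real (t * \<delta>)) \<le> L * ?s"
        using g[of Z "t * \<delta>"] unfolding w_def .
      also have "\<dots> \<le> \<bar>L\<bar> * (c * (r * \<delta>))"
        using s s0 by (intro mult_mono) auto
      also have "\<dots> = (\<bar>L\<bar> * (c * r)) * \<delta>" by simp
      also have "\<dots> \<le> \<kappa> * \<delta>" using rk \<delta> by (intro mult_right_mono) auto
      finally show ?thesis .
    qed
    ultimately show ?thesis by (simp add: Omega_eq)
  qed
  then show ?thesis using r by (intro exI[of _ r] conjI exI[of _ "1 / 3"]) auto
qed

end

section \<open>The peak function at a boundary point with isotropic blocks\<close>

lemma sum_axis_ii: "(\<Sum>j\<in>J. (axis k \<i> $ f j) - \<i> * (axis k \<i> $ h j))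
    = \<i> * (\<Sum>j\<in>J. (axis k 1 $ f j) - \<i> * (axis k (1::complex) $ h j))"
  unfolding sum_distrib_left by (rule sum.cong) (auto simp: axis_def algebra_simps)

text \<open>\<open>i0\<close> may lie inside a block of \<open>J\<close>, as long as it is not one
  of the two coordinates that carry the isotropic vector.\<close>

locale singular_blocks = labelled_blocks m n e for m n and e :: "nat \<Rightarrow> nat \<Rightarrow> 'k::finite" +
  fixes J :: "nat set" and i0 :: 'k
  assumes J: "J \<subseteq> {1..m}" "J \<noteq> {}"
    and n2: "\<And>j. j \<in> J \<Longrightarrow> 2 \<le> n j"
    and i0: "\<And>j. j \<in> J \<Longrightarrow> i0 \<noteq> e j 1 \<and> i0 \<noteq> e j 2"
begin

text \<open>Null coordinates: the squares of the first two entries add up to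
  \<open>\<zeta> * \<eta>\<close>, so with zero tail \<open>\<eta> = 0\<close> describes isotropic
  vectors.\<close>

definition \<zeta> :: "nat \<Rightarrow> complex ^ 'k \<Rightarrow> complex" where "\<zeta> j Z = Z $ e j 1 - \<i> * Z $ e j 2"
definition \<eta> :: "nat \<Rightarrow> complex ^ 'k \<Rightarrow> complex" where "\<eta> j Z = Z $ e j 1 + \<i> * Z $ e j 2"
definition tail :: "nat \<Rightarrow> complex ^ 'k \<Rightarrow> complex" where "tail j Z = (\<Sum>i=3..n j. (Z $ e j i)\<^sup>2)"
text \<open>Normalisation: \<rho> is the value of \<zeta> at the vertex.
  \<open>card J * \<rho>^2 = 2\<close> puts the vertex on the boundary, and
  \<open>card J * \<rho> = \<sigma>\<close> makes the peak function vanish there.\<close>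

definition \<sigma> :: real where "\<sigma> = sqrt (2 * card J)"
definition \<rho> :: real where "\<rho> = 2 / \<sigma>"
definition peak :: "complex ^ 'k \<Rightarrow> complex" where "peak Z = 1 - (\<Sum>j\<in>J. \<zeta> j Z) / \<sigma>"
definition vertex :: "complex ^ 'k" where
  "vertex = (\<chi> k. if k \<in> (\<lambda>j. e j 1) ` J then of_real (\<rho> / 2) else
     if k \<in> (\<lambda>j. e j 2) ` J then \<i> * of_real (\<rho> / 2) else 0)"

lemma finJ: "finite J"
  using J(1) finite_subset by blast

lemma cardJ: "card J \<ge> 1"
  using finJ J(2) by (simp add: Suc_le_eq card_gt_0_iff)

lemma \<sigma>: "\<sigma> > 0" "\<sigma>\<^sup>2 = 2 * card J" "\<sigma> \<ge> 1"
proof -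
  have c: "real (card J) \<ge> 1" using cardJ by simp
  show "\<sigma> > 0" "\<sigma>\<^sup>2 = 2 * card J" using c by (simp_all add: \<sigma>_def)
  show "\<sigma> \<ge> 1" unfolding \<sigma>_def using c by simp
qed

lemma \<rho>: "\<rho> > 0" "\<rho> * \<sigma> = 2" "card J * \<rho>\<^sup>2 = 2"
  using \<sigma> cardJ by (simp_all add: \<rho>_def power_divide)

lemma in_J_labels:
  assumes "j \<in> J"
  shows "j \<in> {1..m}" "1 \<in> {1..n j}" "2 \<in> {1..n j}" "{1..n j} = insert 1 (insert 2 {3..n j})"
  using assms J(1) n2[OF assms] by auto

lemma label_eq_iff:
  assumes "j \<in> J" "j' \<in> {1..m}" "i' \<in> {1..n j'}"
  shows "e j' i' = e j 1 \<longleftrightarrow> j' = j \<and> i' = 1" "e j' i' = e j 2 \<longleftrightarrow> j' = j \<and> i' = 2"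
  using inj_label[OF assms(2,3) in_J_labels(1,2)[OF assms(1)]]
    inj_label[OF assms(2,3) in_J_labels(1,3)[OF assms(1)]] by auto

lemma block_sum:
  assumes "j \<in> J"
  shows "(\<Sum>i=1..n j. f i) = f 1 + f 2 + (\<Sum>i=3..n j. f i)"
  unfolding in_J_labels(4)[OF assms] by (simp add: add.assoc)

lemma block_square: "j \<in> J \<Longrightarrow> (\<Sum>i=1..n j. (Z $ e j i)\<^sup>2) = \<zeta> j Z * \<eta> j Z + tail j Z"
  unfolding block_sum by (simp add: \<zeta>_def \<eta>_def tail_def algebra_simps power2_eq_square)

lemma block_norm:
  assumes "j \<in> J"
  shows "(\<Sum>i=1..n j. (cmod (Z $ e j i))\<^sup>2)
    = ((cmod (\<zeta> j Z))\<^sup>2 + (cmod (\<eta> j Z))\<^sup>2) / 2 + (\<Sum>i=3..n j. (cmod (Z $ e j i))\<^sup>2)"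
proof -
  have "(cmod (x - \<i> * y))\<^sup>2 + (cmod (x + \<i> * y))\<^sup>2 = 2 * ((cmod x)\<^sup>2 + (cmod y)\<^sup>2)" for x y
    by (simp add: cmod_power2) (simp add: power2_eq_square algebra_simps)
  then show ?thesis unfolding block_sum[OF assms] \<zeta>_def \<eta>_def by simp
qed

text \<open>What remains of block \<open>j\<close> in the gauge once
  \<open>(cmod (\<zeta> j Z))^2 / 2\<close> has gone into the completed square, which concerns only
  blocks of \<open>J\<close>.\<close>

definition rest :: "nat \<Rightarrow> complex ^ 'k \<Rightarrow> real" where
  "rest j Z = (if j \<in> J
    then (cmod (\<eta> j Z))\<^sup>2 / 2 + (\<Sum>i=3..n j. (cmod (Z $ e j i))\<^sup>2) + cmod (\<zeta> j Z * \<eta> j Z + tail j Z)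
    else (\<Sum>i=1..n j. (cmod (Z $ e j i))\<^sup>2) + cmod (\<Sum>i=1..n j. (Z $ e j i)\<^sup>2))"

lemma rest_nonneg: "rest j Z \<ge> 0"
  by (auto simp: rest_def intro!: add_nonneg_nonneg sum_nonneg)

text \<open>Completing the square: the peak function bounds the deviation from the vertex in every
  direction.\<close>

lemma gauge_peak:
  "gauge Z + 1 - 2 * Re (1 - peak Z) = (\<Sum>j\<in>J. (cmod (\<zeta> j Z - \<rho>))\<^sup>2 / 2) + (\<Sum>j=1..m. rest j Z)"
proof -
  have "gauge Z = (\<Sum>j=1..m. (if j \<in> J then (cmod (\<zeta> j Z))\<^sup>2 / 2 else 0) + rest j Z)"
    unfolding gauge_def
  proof (rule sum.cong[OF refl])
    fix j
    show "(\<Sum>i=1..n j. (cmod (Z $ e j i))\<^sup>2) + cmod (\<Sum>i=1..n j. (Z $ e j i)\<^sup>2)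
      = (if j \<in> J then (cmod (\<zeta> j Z))\<^sup>2 / 2 else 0) + rest j Z"
      unfolding rest_def
      by (cases "j \<in> J") (simp_all only: block_norm block_square if_True if_False, simp_all add: add_divide_distrib)
  qed
  also have "\<dots> = (\<Sum>j\<in>J. (cmod (\<zeta> j Z))\<^sup>2 / 2) + (\<Sum>j=1..m. rest j Z)"
    using J(1) by (simp add: sum.distrib sum.If_cases Int_absorb1)
  finally have g: "gauge Z = (\<Sum>j\<in>J. (cmod (\<zeta> j Z))\<^sup>2 / 2) + (\<Sum>j=1..m. rest j Z)" .
  \<comment> \<open>\<open>\<rho> = 2 / \<sigma>\<close> is the center for which the cross terms add
    up to \<open>2 * Re (1 - peak Z)\<close>.\<close>
  have "(cmod (\<zeta> j Z - \<rho>))\<^sup>2 / 2 = (cmod (\<zeta> j Z))\<^sup>2 / 2 - \<rho> * Re (\<zeta> j Z) + \<rho>\<^sup>2 / 2" for j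
    by (simp add: cmod_power2) (simp add: power2_eq_square field_simps)
  then have "(\<Sum>j\<in>J. (cmod (\<zeta> j Z - \<rho>))\<^sup>2 / 2)
      = (\<Sum>j\<in>J. (cmod (\<zeta> j Z))\<^sup>2 / 2) - \<rho> * (\<Sum>j\<in>J. Re (\<zeta> j Z)) + card J * \<rho>\<^sup>2 / 2"
    by (simp only: sum.distrib sum_subtractf) (simp add: sum_distrib_left)
  moreover have "2 * Re (1 - peak Z) = \<rho> * (\<Sum>j\<in>J. Re (\<zeta> j Z))"
    by (simp add: peak_def \<rho>_def)
  ultimately show ?thesis using g \<rho>(3) by simp
qed

lemma peak_bound:
  assumes "Z \<in> Omega m n e"
  shows "(\<Sum>j\<in>J. (cmod (\<zeta> j Z - \<rho>))\<^sup>2 / 2) + (\<Sum>j=1..m. rest j Z) < 2 * Re (peak Z)"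
proof -
  have "gauge Z < 1" using assms by (simp add: Omega_eq)
  then have "gauge Z + 1 - 2 * Re (1 - peak Z) < 2 * Re (peak Z)" by simp
  then show ?thesis unfolding gauge_peak .
qed

lemma Re_peak_pos:
  assumes "Z \<in> Omega m n e" shows "Re (peak Z) > 0"
proof -
  have "0 \<le> (\<Sum>j\<in>J. (cmod (\<zeta> j Z - \<rho>))\<^sup>2 / 2) + (\<Sum>j=1..m. rest j Z)"
    by (intro add_nonneg_nonneg sum_nonneg rest_nonneg) auto
  then show ?thesis using peak_bound[OF assms] by linarith
qed

text \<open>Each quantity is part of a sum of nonnegative terms that \<open>peak_bound\<close> keeps
  below \<open>2 * d\<close>.\<close>

lemma peak_estimates:
  assumes Z: "Z \<in> Omega m n e" and d: "cmod (peak Z) < d"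
  shows "j \<in> J \<Longrightarrow> (cmod (\<zeta> j Z - \<rho>))\<^sup>2 \<le> 4 * d"
    and "j \<in> J \<Longrightarrow> (cmod (\<eta> j Z))\<^sup>2 \<le> 4 * d"
    and "j \<in> J \<Longrightarrow> cmod (\<zeta> j Z * \<eta> j Z + tail j Z) \<le> 2 * d"
    and "j \<in> J \<Longrightarrow> i \<in> {3..n j} \<Longrightarrow> (cmod (Z $ e j i))\<^sup>2 \<le> 2 * d"
    and "j \<in> {1..m} \<Longrightarrow> j \<notin> J \<Longrightarrow> i \<in> {1..n j} \<Longrightarrow> (cmod (Z $ e j i))\<^sup>2 \<le> 2 * d"
proof -
  have "Re (peak Z) < d" using complex_Re_le_cmod[of "peak Z"] d by linarith
  then have tot: "(\<Sum>j\<in>J. (cmod (\<zeta> j Z - \<rho>))\<^sup>2 / 2) + (\<Sum>j=1..m. rest j Z) \<le> 2 * d"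
    using peak_bound[OF Z] by linarith
  have s1: "0 \<le> (\<Sum>j\<in>J. (cmod (\<zeta> j Z - \<rho>))\<^sup>2 / 2)" and s2: "0 \<le> (\<Sum>j=1..m. rest j Z)"
    by (auto intro!: sum_nonneg rest_nonneg)
  have rest: "rest j Z \<le> 2 * d" if "j \<in> {1..m}" for j
    using member_le_sum[of j "{1..m}" "\<lambda>j. rest j Z"] that rest_nonneg tot s1 by simp
  show "(cmod (\<zeta> j Z - \<rho>))\<^sup>2 \<le> 4 * d" if "j \<in> J"
    using member_le_sum[of j J "\<lambda>j. (cmod (\<zeta> j Z - \<rho>))\<^sup>2 / 2"] that finJ tot s2 by simp
  have t0: "0 \<le> (\<Sum>i=3..n j. (cmod (Z $ e j i))\<^sup>2)" by (intro sum_nonneg) simp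
  have rJ: "(cmod (\<eta> j Z))\<^sup>2 / 2 + (\<Sum>i=3..n j. (cmod (Z $ e j i))\<^sup>2)
      + cmod (\<zeta> j Z * \<eta> j Z + tail j Z) \<le> 2 * d" if "j \<in> J"
    using rest[of j] that in_J_labels(1)[OF that] by (simp add: rest_def)
  show "(cmod (\<eta> j Z))\<^sup>2 \<le> 4 * d" if "j \<in> J"
    using rJ[OF that] t0 norm_ge_zero[of "\<zeta> j Z * \<eta> j Z + tail j Z"] by linarith
  show "cmod (\<zeta> j Z * \<eta> j Z + tail j Z) \<le> 2 * d" if "j \<in> J"
    using rJ[OF that] t0 zero_le_power2[of "cmod (\<eta> j Z)"] by linarith
  show "(cmod (Z $ e j i))\<^sup>2 \<le> 2 * d" if "j \<in> J" "i \<in> {3..n j}"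
  proof -
    have "(cmod (Z $ e j i))\<^sup>2 \<le> (\<Sum>i=3..n j. (cmod (Z $ e j i))\<^sup>2)"
      using that(2) by (intro member_le_sum) auto
    then show ?thesis
      using rJ[OF that(1)] zero_le_power2[of "cmod (\<eta> j Z)"] norm_ge_zero[of "\<zeta> j Z * \<eta> j Z + tail j Z"]
      by linarith
  qed
  show "(cmod (Z $ e j i))\<^sup>2 \<le> 2 * d" if "j \<in> {1..m}" "j \<notin> J" "i \<in> {1..n j}"
  proof -
    have "(cmod (Z $ e j i))\<^sup>2 \<le> (\<Sum>i=1..n j. (cmod (Z $ e j i))\<^sup>2)"
      using that(3) by (intro member_le_sum) auto
    also have "\<dots> \<le> rest j Z" using that(2) by (simp add: rest_def)
    also have "\<dots> \<le> 2 * d" by (rule rest[OF that(1)])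
    finally show ?thesis .
  qed
qed

lemma sqrt_le: "x\<^sup>2 \<le> c\<^sup>2 * d \<Longrightarrow> 0 \<le> c \<Longrightarrow> x \<le> c * sqrt d" for x c d :: real
  using real_le_rsqrt[of x "c\<^sup>2 * d"] by (simp add: real_sqrt_mult)

text \<open>The gain of precision: \<zeta> stays near the nonzero value \<rho>, so the bound on
  \<open>\<zeta> * \<eta> + tail\<close> determines \<eta> up to order \<open>d\<close> instead of
  \<open>sqrt d\<close>. The replacement error \<open>(\<zeta> - \<rho>) * \<eta>\<close> is a
  product of two terms of order \<open>sqrt d\<close>. The constant is
  \<open>(2 + 4) * d / \<rho> = 3 * \<sigma> * d\<close>.\<close>

lemma peak_estimates_linear:
  assumes Z: "Z \<in> Omega m n e" and d: "cmod (peak Z) < d" and j: "j \<in> J"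
  shows "cmod (2 * Z $ e j 1 - \<rho>) \<le> 4 * sqrt d" and "cmod (\<eta> j Z + tail j Z / \<rho>) \<le> 3 * \<sigma> * d"
proof -
  note est = peak_estimates[OF Z d]
  have d0: "d > 0" using d norm_ge_zero le_less_trans by blast
  have z: "cmod (\<zeta> j Z - \<rho>) \<le> 2 * sqrt d" and h: "cmod (\<eta> j Z) \<le> 2 * sqrt d"
    using est(1,2)[OF j] by (auto intro: sqrt_le)
  have eq: "2 * Z $ e j 1 - \<rho> = (\<zeta> j Z - \<rho>) + \<eta> j Z" by (simp add: \<zeta>_def \<eta>_def)
  show "cmod (2 * Z $ e j 1 - \<rho>) \<le> 4 * sqrt d"
    unfolding eq using norm_triangle_ineq[of "\<zeta> j Z - \<rho>" "\<eta> j Z"] z h by linarith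
  have "cmod ((\<zeta> j Z - \<rho>) * \<eta> j Z) \<le> (2 * sqrt d) * (2 * sqrt d)"
    unfolding norm_mult using z h d0 by (intro mult_mono) auto
  then have "cmod ((\<zeta> j Z - \<rho>) * \<eta> j Z) \<le> 4 * d" using d0 by simp
  moreover have "\<rho> * (\<eta> j Z + tail j Z / \<rho>) = (\<zeta> j Z * \<eta> j Z + tail j Z) - (\<zeta> j Z - \<rho>) * \<eta> j Z"
    using \<rho>(1) by (simp add: algebra_simps)
  ultimately have "cmod (\<rho> * (\<eta> j Z + tail j Z / \<rho>)) \<le> 6 * d"
    using norm_triangle_ineq4[of "\<zeta> j Z * \<eta> j Z + tail j Z" "(\<zeta> j Z - \<rho>) * \<eta> j Z"] est(3)[OF j] by simp
  then have "\<rho> * cmod (\<eta> j Z + tail j Z / \<rho>) \<le> 6 * d"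
    using \<rho>(1) by (simp only: norm_mult norm_of_real abs_of_pos)
  then have "\<sigma> * (\<rho> * cmod (\<eta> j Z + tail j Z / \<rho>)) \<le> \<sigma> * (6 * d)"
    using \<sigma>(1) by (intro mult_left_mono) auto
  moreover have "\<sigma> * (\<rho> * x) = 2 * x" for x using \<sigma>(1) by (simp add: \<rho>_def)
  ultimately have "2 * cmod (\<eta> j Z + tail j Z / \<rho>) \<le> \<sigma> * (6 * d)" by metis
  also have "\<dots> = 2 * (3 * \<sigma> * d)" by simp
  finally show "cmod (\<eta> j Z + tail j Z / \<rho>) \<le> 3 * \<sigma> * d" by linarith
qed

lemma gauge_vertex: "gauge vertex = 1" and vertex_i0: "vertex $ i0 = 0"
  and peak_vertex: "peak vertex = 0"
proof -
  have v1: "vertex $ e j 1 = of_real (\<rho> / 2)" if "j \<in> J" for j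
    using that by (auto simp: vertex_def)
  have v2: "vertex $ e j 2 = \<i> * of_real (\<rho> / 2)" if "j \<in> J" for j
  proof -
    have "e j 2 \<notin> (\<lambda>j. e j 1) ` J"
      using label_eq_iff(1)[OF _ in_J_labels(1,3)[OF that]] by auto
    then show ?thesis using that by (auto simp: vertex_def)
  qed
  have v3: "vertex $ e j i = 0" if "j \<in> {1..m}" "i \<in> {1..n j}" "j \<notin> J \<or> i \<ge> 3" for j i
  proof -
    have "e j i \<noteq> e j' 1 \<and> e j i \<noteq> e j' 2" if "j' \<in> J" for j'
      using label_eq_iff[OF that \<open>j \<in> {1..m}\<close> \<open>i \<in> {1..n j}\<close>] that \<open>j \<notin> J \<or> i \<ge> 3\<close> by auto
    then show ?thesis by (auto simp: vertex_def)
  qed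
  have z: "\<zeta> j vertex = \<rho>" and h: "\<eta> j vertex = 0" if "j \<in> J" for j
    using v1[OF that] v2[OF that] by (simp_all add: \<zeta>_def \<eta>_def complex_eq_iff)
  show p: "peak vertex = 0"
  proof -
    have "(\<Sum>j\<in>J. \<zeta> j vertex) = of_real (card J * \<rho>)" using z by simp
    also have "card J * \<rho> = \<sigma>"
      using \<rho>(2,3) \<rho>(1) by (simp add: power2_eq_square) (metis mult.commute mult.left_commute mult_cancel_left less_irrefl)
    finally show ?thesis using \<sigma>(1) by (simp add: peak_def)
  qed
  have "rest j vertex = 0" if "j \<in> {1..m}" for j
  proof (cases "j \<in> J")
    case True
    have "vertex $ e j i = 0" if "i \<in> {3..n j}" for i
      using v3[of j i] that \<open>j \<in> {1..m}\<close> by auto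
    then show ?thesis using True h by (simp add: rest_def tail_def)
  next
    case False
    then show ?thesis using v3 that by (simp add: rest_def)
  qed
  then show "gauge vertex = 1" using gauge_peak[of vertex] p z by simp
  show "vertex $ i0 = 0" using i0 by (auto simp: vertex_def)
qed

text \<open>The peak function is affine with value \<open>t\<close> at \<open>1 - t\<close> times
  the vertex, so the difference is a linear form in the offsets. That form does not involve
  coordinate \<open>i0\<close>, so a square may stand there.\<close>

lemma peak_affine:
  "cmod (peak Z - of_real t)
    \<le> 1 * (\<Sum>k\<in>UNIV. if k = i0 then (cmod (Z $ k))\<^sup>2 else cmod (Z $ k - of_real (1 - t) * vertex $ k))"
proof -
  define x where "x k = Z $ k - of_real (1 - t) * vertex $ k" for k
  let ?X = "\<Sum>k\<in>UNIV. if k = i0 then (cmod (Z $ k))\<^sup>2 else cmod (x k)"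
  have "(\<Sum>j\<in>J. \<zeta> j vertex) = \<sigma>" using peak_vertex \<sigma>(1) by (simp add: peak_def)
  then have A: "(\<Sum>j\<in>J. x (e j 1) - \<i> * x (e j 2)) = (\<Sum>j\<in>J. \<zeta> j Z) - of_real (1 - t) * \<sigma>"
  proof -
    have "(\<Sum>j\<in>J. x (e j 1) - \<i> * x (e j 2))
      = (\<Sum>j\<in>J. \<zeta> j Z) - of_real (1 - t) * (\<Sum>j\<in>J. \<zeta> j vertex)"
    unfolding sum_distrib_left sum_subtractf[symmetric]
      by (rule sum.cong) (auto simp: x_def \<zeta>_def algebra_simps)
    then show ?thesis using \<open>(\<Sum>j\<in>J. \<zeta> j vertex) = \<sigma>\<close> by simp
  qed
  have "peak Z - of_real t = - (\<Sum>j\<in>J. x (e j 1) - \<i> * x (e j 2)) / \<sigma>"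
    unfolding A peak_def using \<sigma>(1) by (simp add: field_simps)
  then have "cmod (peak Z - of_real t) = cmod (\<Sum>j\<in>J. x (e j 1) - \<i> * x (e j 2)) / \<sigma>"
    using \<sigma>(1) by (simp add: norm_divide)
  also have "\<dots> \<le> cmod (\<Sum>j\<in>J. x (e j 1) - \<i> * x (e j 2))"
    using \<sigma>(1,3) by (simp add: divide_le_eq mult_le_cancel_left1)
  also have "\<dots> \<le> (\<Sum>j\<in>J. cmod (x (e j 1)) + cmod (x (e j 2)))"
    by (rule sum_norm_le) (metis norm_triangle_ineq4 norm_mult norm_ii mult_1)
  also have "\<dots> = (\<Sum>k\<in>(\<lambda>j. e j 1) ` J \<union> (\<lambda>j. e j 2) ` J. cmod (x k))"
  proof -
    have "inj_on (\<lambda>j. e j 1) J" "inj_on (\<lambda>j. e j 2) J"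
      using label_eq_iff in_J_labels by (auto intro!: inj_onI)
    moreover have "(\<lambda>j. e j 1) ` J \<inter> (\<lambda>j. e j 2) ` J = {}"
    proof -
      have "e j 1 \<noteq> e j' 2" if "j \<in> J" "j' \<in> J" for j j'
        using label_eq_iff(1)[OF that(1) in_J_labels(1,3)[OF that(2)]] by auto
      then show ?thesis by blast
    qed
    ultimately show ?thesis
      using finJ by (simp add: sum.union_disjoint sum.reindex sum.distrib)
  qed
  also have "\<dots> = (\<Sum>k\<in>(\<lambda>j. e j 1) ` J \<union> (\<lambda>j. e j 2) ` J. if k = i0 then (cmod (Z $ k))\<^sup>2 else cmod (x k))"
    using i0 by (intro sum.cong) auto
  also have "\<dots> \<le> ?X" by (rule sum_mono2) auto
  finally show ?thesis by (simp only: x_def mult_1_left)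
qed

lemma C_infinity_peak: "C_infinity_on S peak" if "open S"
proof -
  have lin: "bounded_linear (\<lambda>Z::complex^'k. Z $ k)" for k by (rule bounded_linear_vec_nth)
  have "C_infinity_on S (\<lambda>Z. 1 + (- 1 / \<sigma>) * (\<Sum>j\<in>J. Z $ e j 1 + (- \<i>) * Z $ e j 2))"
    by (intro C_infinity_on_add C_infinity_on_mult C_infinity_on_const C_infinity_on_sum
        C_infinity_on_bounded_linear lin that)
  moreover have "(\<lambda>Z. 1 + (- 1 / \<sigma>) * (\<Sum>j\<in>J. Z $ e j 1 + (- \<i>) * Z $ e j 2)) = peak"
    by (simp add: fun_eq_iff peak_def \<zeta>_def)
  ultimately show ?thesis by simp
qed

lemma peak_holomorphic:
  "frechet_derivative peak (at Z) (axis i \<i>) = \<i> * frechet_derivative peak (at Z) (axis i 1)"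
proof -
  have "(peak has_derivative (\<lambda>v. - (\<Sum>j\<in>J. v $ e j 1 - \<i> * v $ e j 2) / \<sigma>)) (at Z)"
    unfolding peak_def[abs_def] \<zeta>_def
    by (auto intro!: derivative_eq_intros bounded_linear_imp_has_derivative bounded_linear_vec_nth
        simp: divide_inverse)
  then have "frechet_derivative peak (at Z) = (\<lambda>v. - (\<Sum>j\<in>J. v $ e j 1 - \<i> * v $ e j 2) / \<sigma>)"
    by (rule frechet_derivative_at[symmetric])
  then show ?thesis by (simp add: sum_axis_ii)
qed

section \<open>Volume of the sublevel sets of the peak function\<close>

definition block_of :: "'k \<Rightarrow> nat" where
  "block_of k = (SOME j. j \<in> {1..m} \<and> (\<exists>i\<in>{1..n j}. k = e j i))"

definition index_of :: "'k \<Rightarrow> nat" where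
  "index_of k = (SOME i. i \<in> {1..n (block_of k)} \<and> k = e (block_of k) i)"

lemma label_of:
  "block_of k \<in> {1..m}" "index_of k \<in> {1..n (block_of k)}" "e (block_of k) (index_of k) = k"
proof -
  have "\<exists>j. j \<in> {1..m} \<and> (\<exists>i\<in>{1..n j}. k = e j i)" using surj_label[of k] by metis
  from someI_ex[OF this] have b: "block_of k \<in> {1..m}" "\<exists>i. i \<in> {1..n (block_of k)} \<and> k = e (block_of k) i"
    unfolding block_of_def by auto
  from someI_ex[OF b(2)] b(1) show "block_of k \<in> {1..m}" "index_of k \<in> {1..n (block_of k)}"
    "e (block_of k) (index_of k) = k"
    unfolding index_of_def by auto
qed

text \<open>On a sublevel set of the peak function, all coordinates outside the blocks of \<^term>\<open>J\<close> and all
  third and later ones inside these blocks are small, the first coordinates are near those of the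
  vertex, and one of these (that of the block \<^term>\<open>j0\<close>) as well as the second coordinates are
  then determined by the others with the better precision \<^term>\<open>d\<close>.\<close>

lemma peak_volume:
  "\<exists>C\<ge>0. \<forall>d>0. emeasure lborel {Z \<in> Omega m n e. cmod (peak Z) < d}
     \<le> ennreal (C * d powr real (tuple_sum m n + card J + 1))"
proof -
  obtain j0 where j0: "j0 \<in> J" using J(2) by blast
  \<comment> \<open>Order of dependence: tails and blocks outside \<open>J\<close>, then the first
    coordinates except that of \<open>j0\<close>, then that of \<open>j0\<close>, and last the
    second coordinates.\<close>
  define rank where "rank k = (if block_of k \<in> J then
      if index_of k = 1 then if block_of k = j0 then 2 else 1
      else if index_of k = 2 then 3 else 0 else (0::nat))" for k
  \<comment> \<open>The second coordinates solve \<open>\<eta> = - tail / \<rho>\<close>. For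
    \<open>j0\<close>, \<open>2 * Z $ e j 1 = \<zeta> + \<eta>\<close> is summed over
    \<open>J\<close>, with the same value for \<eta> and total \<sigma> for \<zeta>, its value where
    the peak function vanishes.\<close>
  define center where "center k Z = (if block_of k \<in> J then
      if index_of k = 1 then if block_of k = j0
        then (\<sigma> - (\<Sum>j\<in>J - {j0}. 2 * Z $ e j 1) - (\<Sum>j\<in>J. tail j Z / \<rho>)) / 2
        else of_real (\<rho> / 2)
      else if index_of k = 2 then \<i> * (tail (block_of k) Z / \<rho> + Z $ e (block_of k) 1) else 0 else 0)"
    for k Z
  have lab: "block_of (e j i) = j" "index_of (e j i) = i" if "j \<in> {1..m}" "i \<in> {1..n j}" for j i
    using inj_label[OF label_of(1,2)[of "e j i"] that label_of(3)] by auto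
  have rank_tail: "rank (e j i) = 0" if "j \<in> J" "i \<in> {3..n j}" for j i
    using lab[of j i] that in_J_labels(1)[OF that(1)] by (auto simp: rank_def)
  have rank_1: "rank (e j 1) = (if j = j0 then 2 else 1)" if "j \<in> J" for j
    using lab[OF in_J_labels(1,2)[OF that]] that by (simp add: rank_def)
  have rank_2: "rank (e j 2) = 3" if "j \<in> J" for j
    using lab[OF in_J_labels(1,3)[OF that]] that by (simp add: rank_def)
  have center_dep: "center k Z = center k Z'" if eq: "\<And>l. rank l < rank k \<Longrightarrow> Z $ l = Z' $ l" for k Z Z'
  proof -
    have tail: "tail j Z = tail j Z'" if "j \<in> J" "rank k > 0" for j
      unfolding tail_def using rank_tail[OF that(1)] eq that(2) by (intro sum.cong) auto
    consider "block_of k \<notin> J \<or> index_of k \<noteq> 1 \<and> index_of k \<noteq> 2"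
      | "index_of k = 1" "block_of k \<noteq> j0" | "index_of k = 1" "block_of k = j0"
      | "block_of k \<in> J" "index_of k = 2" by metis
    then show ?thesis
    proof cases
      case 1
      then show ?thesis by (auto simp: center_def)
    next
      case 2
      then show ?thesis by (simp add: center_def)
    next
      case 3
      then have r: "rank k = 2" using j0 by (simp add: rank_def)
      then have "(\<Sum>j\<in>J. tail j Z / \<rho>) = (\<Sum>j\<in>J. tail j Z' / \<rho>)"
        using tail by (intro sum.cong) auto
      moreover have "(\<Sum>j\<in>J - {j0}. 2 * Z $ e j 1) = (\<Sum>j\<in>J - {j0}. 2 * Z' $ e j 1)"
        using r by (intro sum.cong refl) (use eq rank_1 in auto)
      ultimately show ?thesis using 3 by (simp add: center_def)
    next
      case 4
      then have r: "rank k = 3" by (simp add: rank_def)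
      then have "Z $ e (block_of k) 1 = Z' $ e (block_of k) 1"
        using rank_1[OF 4(1)] by (intro eq) auto
      then show ?thesis using tail[OF 4(1)] r 4(2) by (simp add: center_def)
    qed
  qed
  have center_meas: "center k \<in> borel_measurable borel" for k
  proof -
    have [measurable]: "(\<lambda>Z. Z $ l) \<in> borel_measurable borel" for l :: 'k
      by (intro borel_measurable_continuous_onI continuous_intros)
    have [measurable]: "tail j \<in> borel_measurable borel" for j
      unfolding tail_def[abs_def] by measurable
    show ?thesis unfolding center_def[abs_def] by measurable
  qed
  \<comment> \<open>\<open>2\<close> serves the coordinates of precision \<open>sqrt d\<close>,
    \<open>3 * \<sigma>\<close> the second coordinates, and the last term the first coordinate of
    \<open>j0\<close>, where \<open>\<sigma> * peak Z\<close> and one error per block of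
    \<open>J\<close> accumulate.\<close>
  define K where "K = 2 + 3 * \<sigma> + (\<sigma> + real (card J) * (3 * \<sigma>))"
  have K: "K \<ge> 2" "K \<ge> 3 * \<sigma>" "K \<ge> \<sigma> + real (card J) * (3 * \<sigma>)"
    using \<sigma>(1) by (simp_all add: K_def)
  define R where "R d k = K * (if rank k \<ge> 2 then d else sqrt d)" for d k
  have bound: "cmod (Z $ k - center k Z) \<le> R d k"
    if Z: "Z \<in> Omega m n e" and d: "cmod (peak Z) < d" for Z d k
  proof -
    define j i where "j = block_of k" and "i = index_of k"
    have ji: "j \<in> {1..m}" "i \<in> {1..n j}" "k = e j i"
      using label_of[of k] by (simp_all add: j_def i_def)
    have d0: "d > 0" using d norm_ge_zero le_less_trans by blast
    note est = peak_estimates[OF Z d] and lin = peak_estimates_linear[OF Z d]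
    have two: "cmod (2 * w) = 2 * cmod w" for w by (simp add: norm_mult)
    have sq: "cmod w \<le> K * sqrt d" if "(cmod w)\<^sup>2 \<le> 2 * d" for w
    proof -
      have "(cmod w)\<^sup>2 \<le> 2\<^sup>2 * d" using that d0 by simp
      then have "cmod w \<le> 2 * sqrt d" by (rule sqrt_le) simp
      also have "\<dots> \<le> K * sqrt d" using K(1) d0 by (intro mult_right_mono) auto
      finally show ?thesis .
    qed
    consider "j \<notin> J" | "j \<in> J" "i \<ge> 3" | "j \<in> J" "i = 1" "j \<noteq> j0" | "j \<in> J" "i = 1" "j = j0"
      | "j \<in> J" "i = 2" using ji(2) by fastforce
    then show ?thesis
    proof cases
      case 1
      then have "center k Z = 0" "rank k = 0" by (simp_all add: center_def rank_def j_def)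
      then show ?thesis using sq est(5)[OF ji(1) 1 ji(2)] ji(3) by (simp add: R_def)
    next
      case 2
      then have "center k Z = 0" "rank k = 0" by (auto simp: center_def rank_def j_def i_def)
      then show ?thesis using sq est(4)[OF 2(1), of i] 2 ji(2,3) by (simp add: R_def)
    next
      case 3
      then have c: "center k Z = of_real (\<rho> / 2)" "rank k = 1" by (auto simp: center_def rank_def j_def i_def)
      have "2 * (Z $ k - center k Z) = 2 * Z $ e j 1 - \<rho>"
        unfolding c(1) unfolding ji(3) 3(2) by simp
      then have "cmod (2 * (Z $ k - center k Z)) \<le> 4 * sqrt d"
        using lin(1)[OF 3(1)] by simp
      then have "cmod (Z $ k - center k Z) \<le> 2 * sqrt d" unfolding two by linarith
      also have "\<dots> \<le> K * sqrt d" using K(1) d0 by (intro mult_right_mono) auto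
      finally show ?thesis using c(2) by (simp add: R_def)
    next
      case 4
      then have r: "rank k = 2" by (auto simp: rank_def j_def i_def)
      let ?err = "\<Sum>j\<in>J. \<eta> j Z + tail j Z / \<rho>"
      have "2 * (Z $ k - center k Z) = (\<Sum>j\<in>J. 2 * Z $ e j 1) - \<sigma> + (\<Sum>j\<in>J. tail j Z / \<rho>)"
      proof -
        have "center k Z = (\<sigma> - (\<Sum>j\<in>J - {j0}. 2 * Z $ e j 1) - (\<Sum>j\<in>J. tail j Z / \<rho>)) / 2"
          using 4 unfolding center_def j_def i_def by simp
        moreover have "Z $ k = Z $ e j0 1" unfolding ji(3) using 4 by simp
        moreover have "(\<Sum>j\<in>J. 2 * Z $ e j 1) = 2 * Z $ e j0 1 + (\<Sum>j\<in>J - {j0}. 2 * Z $ e j 1)"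
          using j0 finJ by (rule sum.remove[rotated])
        ultimately show ?thesis by (simp only:) (simp add: field_simps)
      qed
      also have "(\<Sum>j\<in>J. 2 * Z $ e j 1) = (\<Sum>j\<in>J. \<zeta> j Z) + (\<Sum>j\<in>J. \<eta> j Z)"
        unfolding sum.distrib[symmetric] by (simp add: \<zeta>_def \<eta>_def)
      also have "(\<Sum>j\<in>J. \<zeta> j Z) = \<sigma> - \<sigma> * peak Z" using \<sigma>(1) by (simp add: peak_def field_simps)
      finally have "2 * (Z $ k - center k Z) = ?err - \<sigma> * peak Z"
        by (simp add: sum.distrib)
      then have "cmod (2 * (Z $ k - center k Z)) \<le> cmod ?err + cmod (\<sigma> * peak Z)"
        using norm_triangle_ineq4[of ?err "\<sigma> * peak Z"] by simp
      also have "cmod ?err \<le> (\<Sum>j\<in>J. 3 * \<sigma> * d)" by (rule sum_norm_le) (rule lin(2))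
      also have "cmod (\<sigma> * peak Z) \<le> \<sigma> * d"
        using d \<sigma>(1) by (simp add: norm_mult)
      finally have "2 * cmod (Z $ k - center k Z) \<le> (\<sigma> + real (card J) * (3 * \<sigma>)) * d"
        unfolding two by (simp add: algebra_simps)
      also have "\<dots> \<le> K * d" using K(3) d0 by (intro mult_right_mono) auto
      finally have "cmod (Z $ k - center k Z) \<le> K * d" using norm_ge_zero[of "Z $ k - center k Z"] by linarith
      then show ?thesis using r by (simp add: R_def)
    next
      case 5
      then have r: "rank k = 3" by (auto simp: rank_def j_def i_def)
      have "Z $ k - center k Z = - \<i> * (\<eta> j Z + tail j Z / \<rho>)"
      proof -
        have "center k Z = \<i> * (tail j Z / \<rho> + Z $ e j 1)"
          using 5 unfolding center_def j_def i_def by simp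
        moreover have "Z $ k = Z $ e j 2" unfolding ji(3) using 5 by simp
        ultimately show ?thesis by (simp only: \<eta>_def) (simp add: algebra_simps)
      qed
      then have "cmod (Z $ k - center k Z) \<le> 3 * \<sigma> * d" using lin(2)[OF 5(1)] by (simp add: norm_mult)
      also have "\<dots> \<le> K * d" using K(2) d0 by (intro mult_right_mono) auto
      finally show ?thesis using r by (simp add: R_def)
    qed
  qed
  have cardR: "card {k. 2 \<le> rank k} = card J + 1"
  proof -
    have "{k. 2 \<le> rank k} = insert (e j0 1) ((\<lambda>j. e j 2) ` J)"
    proof (intro equalityI subsetI)
      fix k assume "k \<in> {k. 2 \<le> rank k}"
      then show "k \<in> insert (e j0 1) ((\<lambda>j. e j 2) ` J)"
        using label_of(3)[of k] by (auto simp: rank_def split: if_splits) (metis image_eqI)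
    qed (use rank_1[OF j0] rank_2 in auto)
    moreover have "inj_on (\<lambda>j. e j 2) J" using label_eq_iff(2) in_J_labels by (auto intro!: inj_onI)
    moreover have "e j0 1 \<notin> (\<lambda>j. e j 2) ` J" using rank_1[OF j0] rank_2 by auto
    ultimately show ?thesis using finJ by (simp add: card_image)
  qed
  have prod: "(\<Prod>k\<in>UNIV. 4 * (R d k)\<^sup>2) = (4 * K\<^sup>2) ^ CARD('k) * d powr real (tuple_sum m n + card J + 1)"
    if "d > 0" for d
  proof -
    \<comment> \<open>Every coordinate contributes one factor \<open>d\<close>; the
      \<open>card J + 1\<close> coordinates of rank at least 2 contribute a second one.\<close>
    have "4 * (R d k)\<^sup>2 = 4 * K\<^sup>2 * (d * (if 2 \<le> rank k then d else 1))" for k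
      using that by (simp add: R_def power_mult_distrib) (simp add: power2_eq_square)
    then have "(\<Prod>k\<in>UNIV. 4 * (R d k)\<^sup>2)
        = (4 * K\<^sup>2) ^ CARD('k) * (d ^ CARD('k) * (\<Prod>k\<in>UNIV. if 2 \<le> rank k then d else 1))"
      by (simp add: prod.distrib)
    also have "(\<Prod>k\<in>UNIV. if 2 \<le> rank k then d else 1) = d ^ (card J + 1)"
      using cardR by (simp add: prod.If_cases)
    also have "d ^ CARD('k) * d ^ (card J + 1) = d powr real (tuple_sum m n + card J + 1)"
      using that by (simp only: card_label power_add[symmetric] powr_realpow add.assoc)
    finally show ?thesis .
  qed
  have "emeasure lborel {Z \<in> Omega m n e. cmod (peak Z) < d}
      \<le> ennreal ((4 * K\<^sup>2) ^ CARD('k) * d powr real (tuple_sum m n + card J + 1))" if "d > 0" for d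
    unfolding prod[OF that, symmetric]
    by (rule emeasure_triangular_polydisc_le[where rank = rank and c = center, OF center_meas center_dep])
      (auto intro: bound)
  then show ?thesis by (intro exI[of _ "(4 * K\<^sup>2) ^ CARD('k)"]) auto
qed

end

lemma (in singular_blocks) dbar_sharpness_singular:
  assumes "p > ereal (2 * real (tuple_sum m n + card J + 1))"
  shows "dbar_sharpness (Omega m n e) p (1 / 2 - real_of_ereal (ereal (real (tuple_sum m n + card J + 1)) / p))"
proof -
  obtain C where C: "C \<ge> 0" "\<And>d. d > 0 \<Longrightarrow> emeasure lborel {Z \<in> Omega m n e. cmod (peak Z) < d}
     \<le> ennreal (C * d powr real (tuple_sum m n + card J + 1))"
    using peak_volume by blast
  show ?thesis
    by (rule dbar_counterexample[OF open_Omega bounded_Omega C_infinity_peak[OF open_Omega] peak_holomorphic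
          Re_peak_pos C(2) C(1) _ assms near_boundary_point[OF gauge_vertex vertex_i0 peak_affine]]) auto
qed

text \<open>For a single block of length two the vertex used above leaves no direction in which the domain is
  as wide as the square root of the distance to the boundary. There the peak function is
  the product of \<open>1 \<pm> a \<pm> b\<close> over all signs, where \<open>2 a\<^sup>2\<close> and \<open>2 b\<^sup>2\<close> are
  \<open>(z1 \<mp> \<i> z2) / \<surd>2\<close>: these square roots map the domain onto a ball.\<close>

lemma (in labelled_blocks) dbar_sharpness_2:
  assumes mn: "m = 1" "n 1 = 2" and p: "p > ereal (2 * 3)"
  shows "dbar_sharpness (Omega m n e) p (1 / 2 - real_of_ereal (ereal 3 / p))"
proof -
  define x y where "x = e 1 1" and "y = e 1 2"
  have two: "{1..2::nat} = {1, 2}" by auto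
  have xy: "x \<noteq> y"
    unfolding x_def y_def using inj_label(2)[of 1 1 1 2] mn by auto
  have UN: "UNIV = {x, y}"
  proof -
    have "k = x \<or> k = y" for k
      using surj_label[of k] mn two by (metis x_def y_def atLeastAtMost_singleton insertE singletonD)
    then show ?thesis by auto
  qed
  define g where "g Z = 1 - sqrt 2 * Z $ x - (Z $ y)\<^sup>2 / 2" for Z :: "complex ^ 'k"
  \<comment> \<open>The second coordinate vanishes at \<open>P\<close> and enters \<open>g\<close>
    only squared, so it serves as the wide direction.\<close>
  define P where "P = (\<chi> k. if k = x then complex_of_real (1 / sqrt 2) else 0)"
  have gauge: "gauge Z = (cmod (Z $ x))\<^sup>2 + (cmod (Z $ y))\<^sup>2 + cmod ((Z $ x)\<^sup>2 + (Z $ y)\<^sup>2)" for Z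
    unfolding gauge_def unfolding mn(1) by (simp add: mn(2)[simplified] two[simplified] x_def y_def)
  have Re_g: "(cmod (Z $ y))\<^sup>2 / 2 < Re (g Z)" if "Z \<in> Omega m n e" for Z
  proof -
    define s t where "s = Re (Z $ x)" and "t = Re (Z $ y)"
    have "gauge Z < 1" using that by (simp add: Omega_eq)
    moreover have "s\<^sup>2 - (Im (Z $ x))\<^sup>2 + (t\<^sup>2 - (Im (Z $ y))\<^sup>2) \<le> cmod ((Z $ x)\<^sup>2 + (Z $ y)\<^sup>2)"
      using complex_Re_le_cmod[of "(Z $ x)\<^sup>2 + (Z $ y)\<^sup>2"]
      by (simp add: s_def t_def Re_power2)
    moreover have "(cmod (Z $ x))\<^sup>2 = s\<^sup>2 + (Im (Z $ x))\<^sup>2" "(cmod (Z $ y))\<^sup>2 = t\<^sup>2 + (Im (Z $ y))\<^sup>2"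
      by (simp_all add: s_def t_def cmod_power2)
    \<comment> \<open>\<open>(cmod z)^2 + Re (z^2) = 2 * (Re z)^2\<close>, so only the real parts
      remain.\<close>
    ultimately have st: "s\<^sup>2 + t\<^sup>2 < 1 / 2"
      unfolding gauge by linarith
    \<comment> \<open>The inequality behind this is
      \<open>2 s^2 < 1 - 2 t^2 \<le> (1 - t^2)^2\<close>.\<close>
    have "sqrt 2 * s < 1 - t\<^sup>2"
    proof (rule ccontr)
      assume "\<not> sqrt 2 * s < 1 - t\<^sup>2"
      moreover have "0 \<le> 1 - t\<^sup>2" using st zero_le_power2[of s] by linarith
      ultimately have "(1 - t\<^sup>2)\<^sup>2 \<le> (sqrt 2 * s)\<^sup>2" by (intro power_mono) auto
      then have "1 - 2 * t\<^sup>2 + (t\<^sup>2)\<^sup>2 \<le> 2 * s\<^sup>2" by (simp add: power2_diff power_mult_distrib)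
      then show False using st zero_le_power2[of "t\<^sup>2"] by linarith
    qed
    moreover have "Re (g Z) = 1 - sqrt 2 * s - (t\<^sup>2 - (Im (Z $ y))\<^sup>2) / 2"
      by (simp add: g_def s_def t_def power2_eq_square)
    moreover have "(cmod (Z $ y))\<^sup>2 = t\<^sup>2 + (Im (Z $ y))\<^sup>2" by (simp add: cmod_power2 t_def)
    ultimately show ?thesis by (simp add: field_simps)
  qed
  have pos: "Re (g Z) > 0" if "Z \<in> Omega m n e" for Z
    using Re_g[OF that] zero_le_power2[of "cmod (Z $ y)"] by linarith
  have lin: "bounded_linear (\<lambda>Z::complex^'k. Z $ k)" for k by (rule bounded_linear_vec_nth)
  have smooth: "C_infinity_on (Omega m n e) g"
  proof -
    have "C_infinity_on (Omega m n e)
      (\<lambda>Z. 1 + (- sqrt 2) * Z $ x + (- 1 / 2) * (Z $ y * Z $ y))"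
      by (intro C_infinity_on_add C_infinity_on_mult C_infinity_on_const C_infinity_on_bounded_linear
          lin open_Omega)
    moreover have "(\<lambda>Z. 1 + (- sqrt 2) * Z $ x + (- 1 / 2) * (Z $ y * Z $ y)) = g"
      by (simp add: fun_eq_iff g_def power2_eq_square)
    ultimately show ?thesis by simp
  qed
  have hol: "frechet_derivative g (at Z) (axis i \<i>) = \<i> * frechet_derivative g (at Z) (axis i 1)" for Z i
  proof -
    have "(g has_derivative (\<lambda>v. - (sqrt 2 * v $ x) - Z $ y * v $ y)) (at Z)"
      unfolding g_def[abs_def]
      by (auto intro!: derivative_eq_intros bounded_linear_imp_has_derivative lin)
    then have "frechet_derivative g (at Z) = (\<lambda>v. - (sqrt 2 * v $ x) - Z $ y * v $ y)"
      by (rule frechet_derivative_at[symmetric])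
    then show ?thesis by (simp add: axis_def algebra_simps)
  qed
  have vol: "emeasure lborel {Z \<in> Omega m n e. cmod (g Z) < d} \<le> ennreal (32 * d powr 3)" if "d > 0" for d
  proof -
    \<comment> \<open>For given \<open>Z $ y\<close>, coordinate \<open>x\<close> lies within
      \<open>d\<close> of the zero of \<open>g\<close>, with area at most \<open>4 d^2\<close>;
      coordinate \<open>y\<close> has modulus at most \<open>sqrt (2 d)\<close>, with area at most
      \<open>8 d\<close>.\<close>
    define c where "c k Z = (if k = x then (1 - (Z $ y)\<^sup>2 / 2) / sqrt 2 else 0)" for k and Z :: "complex ^ 'k"
    define R where "R k = (if k = x then d else sqrt (2 * d))" for k
    have "emeasure lborel {Z \<in> Omega m n e. cmod (g Z) < d} \<le> ennreal (\<Prod>i\<in>UNIV. 4 * (R i)\<^sup>2)"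
    proof (rule emeasure_triangular_polydisc_le[where c = c and rank = "\<lambda>k. if k = x then 1 else 0"])
      show "c i \<in> borel_measurable borel" for i
        by (cases "i = x") (auto simp: c_def[abs_def] intro!: borel_measurable_continuous_onI continuous_intros)
      show "c i Z = c i Z'"
        if "\<And>j. (if j = x then 1 else 0 :: nat) < (if i = x then 1 else 0) \<Longrightarrow> Z $ j = Z' $ j" for i Z Z'
        using that[of y] xy by (simp add: c_def)
      fix Z i assume Z: "Z \<in> {Z \<in> Omega m n e. cmod (g Z) < d}"
      show "cmod (Z $ i - c i Z) \<le> R i"
      proof (cases "i = x")
        case True
        have "Z $ x - c x Z = - (g Z / sqrt 2)"
          by (simp add: c_def g_def diff_divide_distrib)
        then have "cmod (Z $ x - c x Z) = cmod (g Z) / sqrt 2" by (simp add: norm_divide)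
        also have "\<dots> \<le> cmod (g Z)" by (simp add: divide_le_eq mult_le_cancel_left1)
        also have "\<dots> \<le> d" using Z by simp
        finally show ?thesis using True by (simp add: R_def)
      next
        case False
        then have i: "i = y" using UN by auto
        have "(cmod (Z $ y))\<^sup>2 / 2 < d"
          using Re_g[of Z] complex_Re_le_cmod[of "g Z"] Z by simp
        then have "(cmod (Z $ y))\<^sup>2 \<le> 2 * d" by simp
        then have "cmod (Z $ y) \<le> sqrt (2 * d)" by (rule real_le_rsqrt)
        then show ?thesis using i xy by (simp add: R_def c_def)
      qed
    qed
    also have "(\<Prod>i\<in>UNIV. 4 * (R i)\<^sup>2) = 32 * d powr 3"
      using xy that by (simp add: UN R_def power3_eq_cube power2_eq_square powr_numeral)
    finally show ?thesis .
  qed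
  have P: "gauge P = 1" "P $ y = 0"
    using xy by (simp_all add: gauge P_def power_divide norm_divide norm_power flip: of_real_power)
  have aff: "cmod (g Z - of_real t)
      \<le> 2 * (\<Sum>k\<in>UNIV. if k = y then (cmod (Z $ k))\<^sup>2 else cmod (Z $ k - of_real (1 - t) * P $ k))" for Z t
  proof -
    define a where "a = Z $ x - of_real (1 - t) * P $ x"
    have s2: "complex_of_real (sqrt 2) * (of_real (1 - t) / of_real (sqrt 2)) = of_real (1 - t)" by simp
    have "g Z - of_real t = - (sqrt 2 * a) - (Z $ y)\<^sup>2 / 2"
      using s2 by (simp add: g_def a_def P_def right_diff_distrib)
    then have "cmod (g Z - of_real t) \<le> cmod (sqrt 2 * a) + cmod ((Z $ y)\<^sup>2 / 2)"
      using norm_triangle_ineq4[of "- (sqrt 2 * a)" "(Z $ y)\<^sup>2 / 2"] by simp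
    also have "\<dots> = sqrt 2 * cmod a + (cmod (Z $ y))\<^sup>2 / 2"
      by (simp add: norm_mult norm_divide norm_power)
    also have "\<dots> \<le> 2 * cmod a + 2 * (cmod (Z $ y))\<^sup>2"
    proof (intro add_mono mult_right_mono)
      show "sqrt 2 \<le> 2" using real_sqrt_le_mono[of 2 4] by simp
    qed auto
    also have "\<dots> = 2 * (\<Sum>k\<in>UNIV. if k = y then (cmod (Z $ k))\<^sup>2 else cmod (Z $ k - of_real (1 - t) * P $ k))"
      using xy by (simp add: UN a_def)
    finally show ?thesis .
  qed
  show ?thesis
    by (rule dbar_counterexample[OF open_Omega bounded_Omega smooth hol pos vol _ _ p
          near_boundary_point[OF P aff]]) auto
qed

section \<open>The choice of blocks for a given tuple\<close>

theorem theorem1p2: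
  fixes m :: nat and n :: "nat \<Rightarrow> nat" and e :: "nat \<Rightarrow> nat \<Rightarrow> 'k::finite" and p :: ereal
  assumes pos: "\<And>j. j \<in> {1..m} \<Longrightarrow> 0 < n j"
    and sorted: "mono_on {1..m} n"
    and not_ones: "\<not> all_eq m n 1"
    and labelling: "coord_labelling m n e"
    and p_pos: "0 < p"
    and p_general: "\<not> all_eq m n 2 \<Longrightarrow>
      p > ereal (2 * (real (tuple_sum m n) + real m - real (ell m n) + 1))"
    and p_twos: "all_eq m n 2 \<Longrightarrow> p > ereal (6 * real m)"
  shows "\<exists>f :: 'k form01.
    dbar_closed_on (Omega m n e) f \<and>
    (\<forall>i. C_infinity_on (Omega m n e) (f i)) \<and>
    (p < \<infinity> \<longrightarrow> (\<forall>s::real. 0 < s \<longrightarrow> ereal s < p \<longrightarrow> (\<forall>i. in_Lp s (Omega m n e) (f i)))) \<and>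
    (p = \<infinity> \<longrightarrow> (\<forall>i. in_Linfty (Omega m n e) (f i))) \<and>
    (\<forall>u. dbar_solution_on (Omega m n e) u f \<longrightarrow>
      (\<forall>\<epsilon>>0. u \<notin> Lipschitz_space (alpha m n p + \<epsilon>) (Omega m n e)))"
proof -
  interpret labelled_blocks m n e by unfold_locales (rule labelling)
  have "dbar_sharpness (Omega m n e) p (alpha m n p)"
  proof (cases "all_eq m n 2")
    case True
    then have n: "n j = 2" if "j \<in> {1..m}" for j using that by (simp add: all_eq_def)
    \<comment> \<open>\<open>m = 0\<close> is excluded because \<open>all_eq 0 n 1\<close> holds
      vacuously.\<close>
    have "m \<ge> 1" using not_ones by (auto simp: all_eq_def not_less_eq_eq)
    show ?thesis
    proof (cases "m = 1")
      case m: True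
      then show ?thesis
        using dbar_sharpness_2[OF m n[of 1]] p_twos[OF True] True by (simp add: alpha_def)
    next
      case False
      then have m: "m \<ge> 2" using \<open>m \<ge> 1\<close> by simp
      \<comment> \<open>The last block stays outside \<open>J\<close> and provides the wide
        direction; the exponent is \<open>2 m + (m - 1) + 1 = 3 m\<close>.\<close>
      interpret singular_blocks m n e "{1..m - 1}" "e m 1"
      proof unfold_locales
        fix j assume "j \<in> {1..m - 1}"
        then have "j \<in> {1..m}" "j \<noteq> m" using m by auto
        then show "e m 1 \<noteq> e j 1 \<and> e m 1 \<noteq> e j 2"
          using inj_label(1)[of m 1 j 1] inj_label(1)[of m 1 j 2] m n by auto
      qed (use m n in auto)
      have E: "real (tuple_sum m n + card {1..m - 1} + 1) = 3 * real m"
        using m n by (simp add: tuple_sum_def)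
      show ?thesis
        using dbar_sharpness_singular[of p] p_twos[OF True] True unfolding E by (simp add: alpha_def)
    qed
  next
    case False
    obtain j where "j \<in> {1..m}" "n j \<noteq> 1" using not_ones by (auto simp: all_eq_def)
    then have "j - 1 < m \<and> n (j - 1 + 1) > 1" using pos[of j] by (auto simp: le_Suc_eq)
    then have "\<exists>l. l < m \<and> n (l + 1) > 1" by (rule exI)
    from LeastI_ex[OF this] have l: "ell m n < m" "n (ell m n + 1) > 1"
      unfolding ell_def by simp_all
    \<comment> \<open>As the tuple is sorted, these are all blocks of length at least two, and
      \<open>card J = m - ell m n\<close>.\<close>
    define J where "J = {ell m n + 1..m}"
    have n2: "2 \<le> n j" if "j \<in> J" for j
      using mono_onD[OF sorted, of "ell m n + 1" j] that l by (auto simp: J_def)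
    \<comment> \<open>The wide direction: if \<open>ell m n = 0\<close>, the lengths are not all 2,
      so some block has a third coordinate; otherwise the first block has length one and lies
      outside \<open>J\<close>.\<close>
    obtain i0 where i0: "i0 \<noteq> e j 1 \<and> i0 \<noteq> e j 2" if "j \<in> J" for j
    proof (cases "ell m n = 0")
      case True
      then have "\<exists>j\<in>{1..m}. n j \<noteq> 2" using False by (auto simp: all_eq_def)
      then obtain j where j: "j \<in> {1..m}" "3 \<le> n j" using n2 True by (force simp: J_def)
      have "e j 3 \<noteq> e j' 1 \<and> e j 3 \<noteq> e j' 2" if "j' \<in> J" for j'
        using inj_label(2)[of j 3 j' 1] inj_label(2)[of j 3 j' 2] j n2[OF that] that by (auto simp: J_def)
      then show ?thesis using that by blast
    next
      case False
      have "e 1 1 \<noteq> e j 1 \<and> e 1 1 \<noteq> e j 2" if "j \<in> J" for j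
        using inj_label(1)[of 1 1 j 1] inj_label(1)[of 1 1 j 2] pos[of 1] n2[OF that] that False l
        by (auto simp: J_def Suc_le_eq)
      then show ?thesis using that by blast
    qed
    interpret singular_blocks m n e J i0
      by unfold_locales (use l n2 i0 in \<open>auto simp: J_def\<close>)
    have E: "real (tuple_sum m n + card J + 1) = real (tuple_sum m n) + real m - real (ell m n) + 1"
      using l(1) by (simp add: J_def of_nat_diff)
    show ?thesis
      using dbar_sharpness_singular[of p] p_general[OF False] False unfolding E by (simp add: alpha_def)
  qed
  then show ?thesis by (simp add: dbar_sharpness_def)
qed

end
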